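(* (Perfect CSI.) Let $\pi^m$, $\theta_k$, $\rho_k$ be the Lagrange multipliers associated, respectively, with the long-term SU power constraints (C1), the long-term interference power constraints (C2) and the long-term PU capacity constraints (C3) of the resource allocation problem (P) described in the context, set to their optimal (dual-optimal) values $\pi^{m*},\theta_k^*,\rho_k^*$. For the CSI realization $\mathbf{h}[n]$ at time $n$, define for every channel $k$ and user $m$ $$\varphi_k^m(p):=\beta^m r_{k,2}^m(h_{k,2}^m[n]\,p)-\pi^m p-\theta_k a_{k,1}[n]h_{k,1}^m[n]\,p+\rho_k a_{k,1}[n]\,r_{k,1}(h_{k,1}^m[n]\,p).$$ Then the optimal solution of (P) is $$p_{k,2}^{m*}[n]=\Big[\arg\max_{p}\ \varphi_k^m(p)\Big]_0^{\check p_{k,2}^m[n]},$$ $$w_{k,2}^{m*}[n]=\mathbb{1}_{\{m=\arg\max_{l}\varphi_k^l(p_{k,2}^{l*}[n])\}}\ \mathbb{1}_{\{p_{k,2}^{m*}[n]>0\ \vee\ m=0\}},$$ where $[x]_a^b:=\min\{\max\{x,a\},b\}$ is the projection of the scalar $x$ onto $[a,b]$, i.e. the optimal power is obtained by maximizing $\varphi_k^m$ and projecting the maximizer onto $[0,\check p_{k,2}^m[n]]$. If $p_{k,2}^{m*}[n]=0$ for all users, channel $k$ is assigned to the virtual user $m=0$.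
   Context: There are $M$ secondary users (SUs) $m=1,\dots,M$, a virtual SU $m=0$ with zero power and zero rate ($p_{k,2}^0=r_{k,2}^0=0$), which is active when no actual SU transmits, and $K$ channels $k=1,\dots,K$, each with one primary user (PU). The channel state information (CSI) $\mathbf{h}$ is a stationary random process, known perfectly at each time $n$, with value $\mathbf{h}[n]$ at time $n$; its components are $a_{k,1}\in\{0,1\}$ (one if PU $k$ is active), $h_{k,1}^m$ (noise-normalized power gain from SU $m$ to PU $k$) and $h_{k,2}^m$ (noise-normalized power gain from SU $m$ to the secondary access point on channel $k$). The gains are continuous random variables (with infinite support). A quantity indexed by $[n]$ is that quantity evaluated at $\mathbf{h}=\mathbf{h}[n]$. $\mathbb{1}_{\{\cdot\}}$ is the indicator function and $\vee$ is "or". Rates: $r_{k,2}^m(x)=\log_2(1+x)$ for $m\ge1$; $r_{k,1}(x)=\log_2\big(1+\frac{\gamma_{k,1}}{1+x}\big)$, where $\gamma_{k,1}$ is the interference-free signal-to-noise ratio of PU $k$ and $x$ is the interference power at its receiver. Priorities: $\beta^m>0$. Limits: $\check p_2^m$ (maximum long-term power of SU $m$), $\check p_{k,1}$ (maximum interference power at PU $k$), $\check r_{k,1}$ (minimum rate of PU $k$). The peak power $\check p_{k,2}^m(\mathbf{h})$ accounts for the short-term constraints: it equals the maximum amplifier power $\check p_{k,\max}^m$ if $a_{k,1}=0$, and $\min\{x_k^m,y_k^m,\check p_{k,\max}^m\}$ if $a_{k,1}=1$, where $x_k^m$ and $y_k^m$ are the values of $p$ with $h_{k,1}^m p=\check p_{k,1}$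 and $r_{k,1}(h_{k,1}^m p)=\check r_{k,1}$, respectively (which of these bounds are used depends on which short-term constraints are imposed). Problem (P): maximize over the functions $w_{k,2}^m(\mathbf{h})$, $p_{k,2}^m(\mathbf{h})$ $$\sum_{k,m}\mathbb{E}_{\mathbf{h}}\big[\beta^m w_{k,2}^m(\mathbf{h})\,r_{k,2}^m(h_{k,2}^m p_{k,2}^m(\mathbf{h}))\big]$$ subject to the short-term constraints $w_{k,2}^m(\mathbf{h})\in\{0,1\}$, $0\le p_{k,2}^m(\mathbf{h})\le\check p_{k,2}^m(\mathbf{h})$, $\sum_{m=0}^M w_{k,2}^m(\mathbf{h})=1$ for all $k$, and the long-term constraints (C1) $\mathbb{E}_{\mathbf{h}}[\sum_k w_{k,2}^m(\mathbf{h})p_{k,2}^m(\mathbf{h})]\le\check p_2^m$ for all $m$; (C2) $\mathbb{E}_{\mathbf{h}}[\sum_m w_{k,2}^m(\mathbf{h})h_{k,1}^m p_{k,2}^m(\mathbf{h})\,|\,a_{k,1}=1]\le\check p_{k,1}$ for all $k$; (C3) $\mathbb{E}_{\mathbf{h}}[\sum_m w_{k,2}^m(\mathbf{h})r_{k,1}(h_{k,1}^m p_{k,2}^m(\mathbf{h}))\,|\,a_{k,1}=1]\ge\check r_{k,1}$ for all $k$. Only the long-term constraints are dualized, giving the Lagrangian $$\mathcal{L}=\mathbb{E}_{\mathbf{h}}\Big[\sum_{m,k}\beta^m w_{k,2}^m r_{k,2}^m(h_{k,2}^m p_{k,2}^m)-\sum_m\pi^m\Big(\sum_k w_{k,2}^m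 p_{k,2}^m-\check p_2^m\Big)-\sum_k\theta_k a_{k,1}\Big(\sum_m w_{k,2}^m h_{k,1}^m p_{k,2}^m-\check p_{k,1}\Big)+\sum_k\rho_k a_{k,1}\Big(\sum_m w_{k,2}^m r_{k,1}(h_{k,1}^m p_{k,2}^m)-\check r_{k,1}\Big)\Big].$$ The dual function is the maximum of $\mathcal{L}$ over $(w,p)$ satisfying the short-term constraints, and $\pi^{m*},\theta_k^*,\rho_k^*\ge0$ are the multipliers that solve the dual problem.
   Formalization: Where φ is not quasi-concave on p ≥ 0, projecting its global maximizer can be suboptimal; there the optimal power is instead a maximizer of φ over [0, peak power]. Gains have a joint density, the expectations in (P) are finite, and optimality is unique a.s. in the products w·p. *)

theory Defs
  imports "HOL-Probability.Probability"
begin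

section \<open>System model\<close>

text \<open>Secondary users are \<open>1..nSU\<close> (user \<open>0\<close> is the virtual one), channels are \<open>1..nCh\<close>.
  \<open>limI\<close> and \<open>limR\<close> are the interference and rate limits of the primary users; they serve both the
  long-term constraints and, on the channels where \<open>shortI\<close> resp. \<open>shortR\<close> is set, the short-term
  ones.\<close>

record params =
  nSU :: nat
  nCh :: nat
  beta :: "nat \<Rightarrow> real"                \<comment> \<open>priority of SU \<open>m\<close>\<close>
  gam :: "nat \<Rightarrow> real"                 \<comment> \<open>interference-free SNR of PU \<open>k\<close>\<close>
  limP :: "nat \<Rightarrow> real"                \<comment> \<open>maximum long-term power of SU \<open>m\<close>\<close>
  limI :: "nat \<Rightarrow> real"                \<comment> \<open>maximum interference power at PU \<open>k\<close>\<close>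
  limR :: "nat \<Rightarrow> real"                \<comment> \<open>minimum rate of PU \<open>k\<close>\<close>
  ampP :: "nat \<Rightarrow> nat \<Rightarrow> real"         \<comment> \<open>maximum amplifier power on channel \<open>k\<close> of SU \<open>m\<close>\<close>
  shortI :: "nat \<Rightarrow> bool"
  shortR :: "nat \<Rightarrow> bool"

definition rate1 :: "real \<Rightarrow> real \<Rightarrow> real" where
  "rate1 g x = log 2 (1 + g / (1 + x))"

definition rate2 :: "nat \<Rightarrow> real \<Rightarrow> real" where
  "rate2 m x = (if m = 0 then 0 else log 2 (1 + x))"

text \<open>The rate limit has to be achievable without interference where it is imposed as a short-term
  constraint; otherwise the power at which the rate limit is met would not exist.\<close>

definition valid_params :: "params \<Rightarrow> bool" where
  "valid_params S \<longleftrightarrow>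
     (\<forall>m\<in>{1..nSU S}. beta S m > 0 \<and> limP S m > 0) \<and>
     (\<forall>k\<in>{1..nCh S}. gam S k > 0 \<and> limI S k > 0 \<and> limR S k > 0 \<and>
        (shortR S k \<longrightarrow> limR S k \<le> rate1 (gam S k) 0)) \<and>
     (\<forall>k\<in>{1..nCh S}. \<forall>m\<in>{1..nSU S}. ampP S k m > 0)"

section \<open>Channel state information\<close>

datatype comp =
    Act nat            \<comment> \<open>\<open>Act k\<close>: activity of PU \<open>k\<close>\<close>
  | GPU nat nat        \<comment> \<open>\<open>GPU k m\<close>: gain from SU \<open>m\<close> to PU \<open>k\<close>\<close>
  | GAP nat nat        \<comment> \<open>\<open>GAP k m\<close>: gain from SU \<open>m\<close> to the access point on channel \<open>k\<close>\<close>

type_synonym csi = "comp \<Rightarrow> real"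

definition gain_comps :: "params \<Rightarrow> comp set" where
  "gain_comps S = (\<Union>k\<in>{1..nCh S}. \<Union>m\<in>{1..nSU S}. {GPU k m, GAP k m})"

definition csi_space :: "params \<Rightarrow> csi measure" where
  "csi_space S = (\<Pi>\<^sub>M c\<in>(Act ` {1..nCh S} \<union> gain_comps S). borel)"

definition act :: "csi \<Rightarrow> nat \<Rightarrow> real" where
  "act h k = h (Act k)"

text \<open>The virtual user transmits with zero power, so the value of its gains is immaterial.\<close>

definition gain1 :: "csi \<Rightarrow> nat \<Rightarrow> nat \<Rightarrow> real" where
  "gain1 h k m = (if m = 0 then 0 else h (GPU k m))"

definition gain2 :: "csi \<Rightarrow> nat \<Rightarrow> nat \<Rightarrow> real" where
  "gain2 h k m = (if m = 0 then 0 else h (GAP k m))"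

definition csi_law :: "params \<Rightarrow> 'w measure \<Rightarrow> (nat \<Rightarrow> 'w \<Rightarrow> csi) \<Rightarrow> csi measure" where
  "csi_law S Om H = distr Om (csi_space S) (H 0)"

text \<open>\<open>H n\<close> is the state at time \<open>n\<close>: a (strictly) stationary process. The gains are jointly
  continuous random variables (they have a joint Lebesgue density) with unbounded support. The
  last condition makes the expectations conditioned on \<open>a\<^sub>k = 1\<close> meaningful.\<close>

definition csi_process :: "params \<Rightarrow> 'w measure \<Rightarrow> (nat \<Rightarrow> 'w \<Rightarrow> csi) \<Rightarrow> bool" where
  "csi_process S Om H \<longleftrightarrow>
     prob_space Om \<and>
     (\<forall>n. H n \<in> measurable Om (csi_space S)) \<and>
     distr Om (\<Pi>\<^sub>M n\<in>(UNIV :: nat set). csi_space S) (\<lambda>\<omega> n. H (Suc n) \<omega>) =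
       distr Om (\<Pi>\<^sub>M n\<in>(UNIV :: nat set). csi_space S) (\<lambda>\<omega> n. H n \<omega>) \<and>
     (AE h in csi_law S Om H. (\<forall>k\<in>{1..nCh S}. act h k \<in> {0, 1}) \<and>
        (\<forall>c\<in>gain_comps S. h c \<ge> 0)) \<and>
     (\<exists>f. distributed (csi_law S Om H) (\<Pi>\<^sub>M c\<in>gain_comps S. lborel)
        (\<lambda>h. restrict h (gain_comps S)) f) \<and>
     (\<forall>c\<in>gain_comps S. \<forall>x. measure (csi_law S Om H) {h \<in> space (csi_space S). x < h c} > 0) \<and>
     (\<forall>k\<in>{1..nCh S}. measure (csi_law S Om H) {h \<in> space (csi_space S). act h k = 1} > 0)"

definition cond_active :: "params \<Rightarrow> csi measure \<Rightarrow> nat \<Rightarrow> csi measure" where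
  "cond_active S \<mu> k = uniform_measure \<mu> {h \<in> space (csi_space S). act h k = 1}"

section \<open>The resource allocation problem\<close>

definition peak :: "params \<Rightarrow> csi \<Rightarrow> nat \<Rightarrow> nat \<Rightarrow> real" where
  "peak S h k m =
     (if m = 0 then 0
      else if act h k = 1 then
        Min ({ampP S k m} \<union>
          (if shortI S k then {THE p. gain1 h k m * p = limI S k} else {}) \<union>
          (if shortR S k then {THE p. 0 \<le> p \<and> rate1 (gam S k) (gain1 h k m * p) = limR S k}
           else {}))
      else ampP S k m)"

text \<open>A scheduling or power policy: \<open>w h k m\<close> is its value for user \<open>m\<close> on channel \<open>k\<close> in state
  \<open>h\<close>.\<close>

type_synonym policy = "csi \<Rightarrow> nat \<Rightarrow> nat \<Rightarrow> real"

definition measurable_policy :: "params \<Rightarrow> policy \<Rightarrow> bool" where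
  "measurable_policy S f \<longleftrightarrow>
     (\<forall>k\<in>{1..nCh S}. \<forall>m\<in>{0..nSU S}. (\<lambda>h. f h k m) \<in> borel_measurable (csi_space S))"

definition short_term :: "params \<Rightarrow> csi measure \<Rightarrow> policy \<Rightarrow> policy \<Rightarrow> bool" where
  "short_term S \<mu> w p \<longleftrightarrow>
     measurable_policy S w \<and> measurable_policy S p \<and>
     (AE h in \<mu>. \<forall>k\<in>{1..nCh S}.
        (\<forall>m\<in>{0..nSU S}. w h k m \<in> {0, 1} \<and> 0 \<le> p h k m \<and> p h k m \<le> peak S h k m) \<and>
        (\<Sum>m=0..nSU S. w h k m) = 1)"

text \<open>The expectations in the problem exist for every policy obeying the short-term constraints iff
  they exist at peak power.\<close>

definition finite_expectations :: "params \<Rightarrow> csi measure \<Rightarrow> bool" where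
  "finite_expectations S \<mu> \<longleftrightarrow>
     (\<forall>k\<in>{1..nCh S}. \<forall>m\<in>{1..nSU S}.
        integrable \<mu> (\<lambda>h. rate2 m (gain2 h k m * peak S h k m)) \<and>
        integrable \<mu> (\<lambda>h. act h k * gain1 h k m * peak S h k m))"

definition objective :: "params \<Rightarrow> csi measure \<Rightarrow> policy \<Rightarrow> policy \<Rightarrow> real" where
  "objective S \<mu> w p =
     (\<Sum>k=1..nCh S. \<Sum>m=0..nSU S.
        \<integral>h. beta S m * w h k m * rate2 m (gain2 h k m * p h k m) \<partial>\<mu>)"

definition long_term :: "params \<Rightarrow> csi measure \<Rightarrow> policy \<Rightarrow> policy \<Rightarrow> bool" where
  "long_term S \<mu> w p \<longleftrightarrow>
     (\<forall>m\<in>{1..nSU S}. (\<integral>h. (\<Sum>k=1..nCh S. w h k m * p h k m) \<partial>\<mu>) \<le> limP S m) \<and>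
     (\<forall>k\<in>{1..nCh S}.
        (\<integral>h. (\<Sum>m=0..nSU S. w h k m * gain1 h k m * p h k m) \<partial>cond_active S \<mu> k) \<le> limI S k) \<and>
     (\<forall>k\<in>{1..nCh S}.
        (\<integral>h. (\<Sum>m=0..nSU S. w h k m * rate1 (gam S k) (gain1 h k m * p h k m))
           \<partial>cond_active S \<mu> k) \<ge> limR S k)"

definition optimal_solution :: "params \<Rightarrow> csi measure \<Rightarrow> policy \<Rightarrow> policy \<Rightarrow> bool" where
  "optimal_solution S \<mu> w p \<longleftrightarrow>
     short_term S \<mu> w p \<and> long_term S \<mu> w p \<and>
     (\<forall>w' p'. short_term S \<mu> w' p' \<and> long_term S \<mu> w' p' \<longrightarrow>
        objective S \<mu> w' p' \<le> objective S \<mu> w p)"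

section \<open>The dual problem\<close>

definition lagrangian ::
  "params \<Rightarrow> csi measure \<Rightarrow> (nat \<Rightarrow> real) \<Rightarrow> (nat \<Rightarrow> real) \<Rightarrow> (nat \<Rightarrow> real) \<Rightarrow>
     policy \<Rightarrow> policy \<Rightarrow> real" where
  "lagrangian S \<mu> \<pi> \<theta> \<rho> w p =
     (\<integral>h. (\<Sum>m=0..nSU S. \<Sum>k=1..nCh S.
              beta S m * w h k m * rate2 m (gain2 h k m * p h k m))
        - (\<Sum>m=1..nSU S. \<pi> m * ((\<Sum>k=1..nCh S. w h k m * p h k m) - limP S m))
        - (\<Sum>k=1..nCh S. \<theta> k * act h k *
             ((\<Sum>m=0..nSU S. w h k m * gain1 h k m * p h k m) - limI S k))
        + (\<Sum>k=1..nCh S. \<rho> k * act h k *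
             ((\<Sum>m=0..nSU S. w h k m * rate1 (gam S k) (gain1 h k m * p h k m)) - limR S k))
      \<partial>\<mu>)"

definition dual_function ::
  "params \<Rightarrow> csi measure \<Rightarrow> (nat \<Rightarrow> real) \<Rightarrow> (nat \<Rightarrow> real) \<Rightarrow> (nat \<Rightarrow> real) \<Rightarrow> ereal" where
  "dual_function S \<mu> \<pi> \<theta> \<rho> =
     (SUP (w, p) \<in> {(w, p). short_term S \<mu> w p}. ereal (lagrangian S \<mu> \<pi> \<theta> \<rho> w p))"

definition dual_feasible ::
  "params \<Rightarrow> (nat \<Rightarrow> real) \<Rightarrow> (nat \<Rightarrow> real) \<Rightarrow> (nat \<Rightarrow> real) \<Rightarrow> bool" where
  "dual_feasible S \<pi> \<theta> \<rho> \<longleftrightarrow>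
     (\<forall>m\<in>{1..nSU S}. \<pi> m \<ge> 0) \<and> (\<forall>k\<in>{1..nCh S}. \<theta> k \<ge> 0 \<and> \<rho> k \<ge> 0)"

definition dual_optimal ::
  "params \<Rightarrow> csi measure \<Rightarrow> (nat \<Rightarrow> real) \<Rightarrow> (nat \<Rightarrow> real) \<Rightarrow> (nat \<Rightarrow> real) \<Rightarrow> bool" where
  "dual_optimal S \<mu> \<pi> \<theta> \<rho> \<longleftrightarrow>
     dual_feasible S \<pi> \<theta> \<rho> \<and>
     (\<forall>\<pi>' \<theta>' \<rho>'. dual_feasible S \<pi>' \<theta>' \<rho>' \<longrightarrow>
        dual_function S \<mu> \<pi> \<theta> \<rho> \<le> dual_function S \<mu> \<pi>' \<theta>' \<rho>')"

section \<open>The allocation rule\<close>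

definition phi ::
  "params \<Rightarrow> (nat \<Rightarrow> real) \<Rightarrow> (nat \<Rightarrow> real) \<Rightarrow> (nat \<Rightarrow> real) \<Rightarrow>
     csi \<Rightarrow> nat \<Rightarrow> nat \<Rightarrow> real \<Rightarrow> real" where
  "phi S \<pi> \<theta> \<rho> h k m p =
     beta S m * rate2 m (gain2 h k m * p) - \<pi> m * p - \<theta> k * act h k * gain1 h k m * p
       + \<rho> k * act h k * rate1 (gam S k) (gain1 h k m * p)"

definition proj :: "real \<Rightarrow> real \<Rightarrow> real \<Rightarrow> real" where
  "proj a b x = min (max x a) b"

text \<open>\<open>p\<close> is the projection onto \<open>[0, b]\<close> of a maximizer of \<open>f\<close> over the powers \<open>x \<ge> 0\<close>. When
  \<open>f\<close> attains no maximum there (e.g. increasing \<open>f\<close>, all prices being zero), the maximizer is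
  \<open>+\<infinity>\<close>, whose projection is \<open>b\<close>.\<close>

definition projected_argmax :: "(real \<Rightarrow> real) \<Rightarrow> real \<Rightarrow> real \<Rightarrow> bool" where
  "projected_argmax f b p \<longleftrightarrow>
     (if \<exists>x. is_arg_max f (\<lambda>x. 0 \<le> x) x
      then \<exists>x. is_arg_max f (\<lambda>x. 0 \<le> x) x \<and> p = proj 0 b x
      else p = b)"

definition quasiconcave_on :: "real set \<Rightarrow> (real \<Rightarrow> real) \<Rightarrow> bool" where
  "quasiconcave_on A f \<longleftrightarrow> (\<forall>c. convex {x \<in> A. c \<le> f x})"

text \<open>The function \<open>phi\<close> is concave in the power if \<open>\<rho>\<^sub>k a\<^sub>k = 0\<close>, but since \<open>rate1\<close> is convex it
  can have several local maxima otherwise. If so, the projection onto \<open>[0, peak]\<close> of a global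
  maximizer lying beyond the peak power need not maximize \<open>phi\<close> over \<open>[0, peak]\<close>: for
  \<open>\<beta> = \<gamma> = h\<^sub>1 = 1\<close>, \<open>h\<^sub>2 = 1000\<close>, \<open>\<rho> = 8\<close>, peak 4.56 and power price close to 0, the projection is
  4.56 with \<open>phi\<close> about 14.1, whereas \<open>phi 0.44\<close> is about 14.9. In the multimodal case the
  maximization therefore takes the bound into account directly.\<close>

definition power_rule ::
  "params \<Rightarrow> (nat \<Rightarrow> real) \<Rightarrow> (nat \<Rightarrow> real) \<Rightarrow> (nat \<Rightarrow> real) \<Rightarrow>
     csi \<Rightarrow> nat \<Rightarrow> nat \<Rightarrow> real \<Rightarrow> bool" where
  "power_rule S \<pi> \<theta> \<rho> h k m p \<longleftrightarrow>
     (if quasiconcave_on {0..} (phi S \<pi> \<theta> \<rho> h k m)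
      then projected_argmax (phi S \<pi> \<theta> \<rho> h k m) (peak S h k m) p
      else is_arg_max (phi S \<pi> \<theta> \<rho> h k m) (\<lambda>x. 0 \<le> x \<and> x \<le> peak S h k m) p)"

definition schedule_rule ::
  "params \<Rightarrow> (nat \<Rightarrow> real) \<Rightarrow> (nat \<Rightarrow> real) \<Rightarrow> (nat \<Rightarrow> real) \<Rightarrow>
     csi \<Rightarrow> (nat \<Rightarrow> nat \<Rightarrow> real) \<Rightarrow> nat \<Rightarrow> nat \<Rightarrow> real" where
  "schedule_rule S \<pi> \<theta> \<rho> h p k m =
     of_bool (is_arg_max (\<lambda>l. phi S \<pi> \<theta> \<rho> h k l (p k l)) (\<lambda>l. l \<in> {0..nSU S}) m)
     * of_bool (p k m > 0 \<or> m = 0)"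

text \<open>The policies that, at each time \<open>n\<close>, apply the rule to the current state \<open>H n\<close>. They are
  determined up to ties between maximizers and up to null events.\<close>

definition follows_rule ::
  "params \<Rightarrow> 'w measure \<Rightarrow> (nat \<Rightarrow> 'w \<Rightarrow> csi) \<Rightarrow>
     (nat \<Rightarrow> real) \<Rightarrow> (nat \<Rightarrow> real) \<Rightarrow> (nat \<Rightarrow> real) \<Rightarrow> policy \<Rightarrow> policy \<Rightarrow> bool" where
  "follows_rule S Om H \<pi> \<theta> \<rho> w p \<longleftrightarrow>
     measurable_policy S w \<and> measurable_policy S p \<and>
     (\<forall>n. AE \<omega> in Om. \<forall>k\<in>{1..nCh S}. \<forall>m\<in>{0..nSU S}.
        power_rule S \<pi> \<theta> \<rho> (H n \<omega>) k m (p (H n \<omega>) k m) \<and>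
        w (H n \<omega>) k m = schedule_rule S \<pi> \<theta> \<rho> (H n \<omega>) (p (H n \<omega>)) k m)"

end

theory Submission
  imports Defs
begin

text \<open>For fixed multipliers the Lagrangian is maximized state by state and channel by channel, and this
  is what the rule does. The maximizer is unique up to null events: \<open>log\<^sub>2 (1 + g p)\<close> has strictly
  increasing differences in the gain \<open>g\<close> to the access point and the power \<open>p\<close>, so a user has two
  best powers only for countably many values of \<open>g\<close>, and the best utility of a user with positive
  power increases strictly with \<open>g\<close>, so it ties with another user for at most one value of \<open>g\<close>; the
  gains have a density. By uniqueness the maximizer is stable under perturbations of the
  multipliers, so dual optimality makes the rule and the multipliers a saddle point of the
  Lagrangian, even though the problem is not convex. Feasibility, complementary slackness and
  optimality follow, and every optimal policy maximizes the Lagrangian, hence agrees with the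
  rule.\<close>

section \<open>Maximizers of functions of one real variable\<close>

text \<open>The obstacle is strong duality: the schedule is binary and \<open>rate1\<close> is
  convex, so the usual convexity argument against a duality gap does not apply. Smoothness of the
  dual function takes its place. That function is a supremum of functions affine in the multipliers,
  with the slacks of the long-term constraints as coefficients. Where the maximizing policy is
  unique, the slacks form its gradient, and the first-order conditions for a minimum over
  nonnegative multipliers are primal feasibility and complementary slackness. The proof compares
  values along segments of multipliers and needs no derivative. Uniqueness can hold only for the
  products of schedule and power, because at zero power every user has the utility of the virtual
  one. Measurability shapes the lemmas: peak power varies with the state, so powers become fractions
  in \<open>[0, 1]\<close> before maximizers are selected, and ties, being quantified over real
  powers, are expressed through rational ones.\<close>

text \<open>Strictly increasing differences make the maximizers monotone in \<open>g\<close>, so that the open intervals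
  between two maximizers are disjoint for different \<open>g\<close>.\<close>

lemma countable_ties:
  fixes f :: "real \<Rightarrow> real \<Rightarrow> real" and b :: real
  assumes incr: "\<And>g g' p p'. \<lbrakk>0 < g; g < g'; 0 \<le> p'; p' < p; p \<le> b\<rbrakk> \<Longrightarrow> f g p - f g p' < f g' p - f g' p'"
  shows "countable {g. 0 < g \<and> (\<exists>p q. 0 \<le> p \<and> p < q \<and> q \<le> b \<and>
           (\<forall>r\<in>{0..b}. f g r \<le> f g p) \<and> (\<forall>r\<in>{0..b}. f g r \<le> f g q))}" (is "countable ?T")
proof -
  \<comment> \<open>Here \<open>u\<close> will be a rational strictly inside the gap between two
    maximizers; choosing it injectively embeds the tied gains into the rationals.\<close>
  define R where "R g u \<longleftrightarrow> (\<exists>p q. 0 \<le> p \<and> p < u \<and> u < q \<and> q \<le> b \<and>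
           (\<forall>r\<in>{0..b}. f g r \<le> f g p) \<and> (\<forall>r\<in>{0..b}. f g r \<le> f g q))" for g and u :: real
  have "\<exists>u\<in>\<rat>. R g u" if "g \<in> ?T" for g
  proof -
    from that obtain p q where pq: "0 \<le> p" "p < q" "q \<le> b" "\<forall>r\<in>{0..b}. f g r \<le> f g p"
       "\<forall>r\<in>{0..b}. f g r \<le> f g q" by blast
    obtain u where u: "u \<in> \<rat>" "p < u" "u < q" using Rats_dense_in_real[OF pq(2)] by blast
    have "R g u" unfolding R_def by (intro exI[of _ p] exI[of _ q] conjI pq u)
    with u(1) show ?thesis by blast
  qed
  then have "\<forall>g. \<exists>u. g \<in> ?T \<longrightarrow> u \<in> \<rat> \<and> R g u" by blast
  from choice[OF this] obtain u where u: "\<And>g. g \<in> ?T \<Longrightarrow> u g \<in> \<rat> \<and> R g (u g)" by blast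
  \<comment> \<open>\<open>q\<close> is a maximizer for \<open>g\<close> above \<open>u g\<close>,
    and \<open>p\<close> one for \<open>g'\<close> below \<open>u g'\<close>. If
    \<open>p < q\<close>, the increment from \<open>p\<close> to \<open>q\<close>, nonnegative at
    \<open>g\<close>, would be positive at \<open>g'\<close>, against the maximality of
    \<open>p\<close>.\<close>
  have less: "u g < u g'" if g: "g \<in> ?T" "g' \<in> ?T" "g < g'" for g g'
  proof -
    obtain q where q: "u g < q" "q \<le> b" "0 < q" "\<forall>r\<in>{0..b}. f g r \<le> f g q"
      using u[OF g(1)] unfolding R_def by fastforce
    obtain p where p: "0 \<le> p" "p < u g'" "p \<le> b" "\<forall>r\<in>{0..b}. f g' r \<le> f g' p"
      using u[OF g(2)] unfolding R_def by fastforce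
    have "q \<le> p"
    proof (rule ccontr)
      assume "\<not> q \<le> p"
      then have "f g q - f g p < f g' q - f g' p" using incr[of g g' p q] g p q by auto
      moreover have "f g p \<le> f g q" "f g' q \<le> f g' p" using p q by auto
      ultimately show False by simp
    qed
    then show ?thesis using q(1) p(2) by simp
  qed
  have "inj_on u ?T"
  proof (rule inj_onI)
    fix g g' assume *: "g \<in> ?T" "g' \<in> ?T" "u g = u g'"
    show "g = g'" using less[OF *(1,2)] less[OF *(2,1)] *(3) by (cases g g' rule: linorder_cases) auto
  qed
  moreover have "countable (u ` ?T)"
    by (rule countable_subset[OF _ countable_rat]) (use u in auto)
  ultimately show ?thesis by (rule countable_image_inj_on[rotated])
qed

text \<open>After exponentiation two products are compared whose difference is
  \<open>(g' - g) * (p - p')\<close>.\<close>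

lemma log_increasing_differences:
  fixes g g' p p' :: real
  assumes "0 < g" "g < g'" "0 \<le> p'" "p' < p"
  shows "log 2 (1 + g * p) - log 2 (1 + g * p') < log 2 (1 + g' * p) - log 2 (1 + g' * p')"
proof -
  have pos: "0 < 1 + g * p" "0 < 1 + g * p'" "0 < 1 + g' * p" "0 < 1 + g' * p'"
    using assms by (auto intro!: add_pos_nonneg)
  have "0 < (g' - g) * (p - p')" using assms by simp
  then have "(1 + g * p) * (1 + g' * p') < (1 + g' * p) * (1 + g * p')" by (simp add: algebra_simps)
  then have "log 2 ((1 + g * p) * (1 + g' * p')) < log 2 ((1 + g' * p) * (1 + g * p'))"
    using pos by simp
  then show ?thesis using pos by (simp add: log_mult)
qed

text \<open>If a global maximizer lies beyond \<open>b\<close>, quasiconcavity lets no value before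
  \<open>b\<close> exceed \<open>f b\<close>. If there is no global maximizer, a value before
  \<open>b\<close> above \<open>f b\<close> would keep \<open>f\<close> at most \<open>f b\<close>
  beyond \<open>b\<close>, and the maximum over the compact \<open>[0, b]\<close> would be global
  after all.\<close>

lemma projected_argmax_quasiconcave:
  fixes f :: "real \<Rightarrow> real"
  assumes cont: "continuous_on {0..} f" and qc: "quasiconcave_on {0..} f" and b: "0 \<le> b"
    and p: "projected_argmax f b p"
  shows "is_arg_max f (\<lambda>x. 0 \<le> x \<and> x \<le> b) p"
proof -
  have qcD: "min (f x) (f z) \<le> f y" if "0 \<le> x" "x \<le> y" "y \<le> z" for x y z
  proof -
    have "convex {u \<in> {0..}. min (f x) (f z) \<le> f u}" using qc unfolding quasiconcave_on_def by blast
    moreover have "x \<in> {u \<in> {0..}. min (f x) (f z) \<le> f u}" "z \<in> {u \<in> {0..}. min (f x) (f z) \<le> f u}"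
      using that by auto
    ultimately have "closed_segment x z \<subseteq> {u \<in> {0..}. min (f x) (f z) \<le> f u}"
      by (simp add: closed_segment_subset)
    moreover have "y \<in> closed_segment x z" using that by (simp add: closed_segment_eq_real_ivl)
    ultimately show ?thesis by blast
  qed
  show ?thesis
  proof (cases "\<exists>x. is_arg_max f (\<lambda>x. 0 \<le> x) x")
    case True
    then obtain x where x: "is_arg_max f (\<lambda>x. 0 \<le> x) x" "p = proj 0 b x"
      using p unfolding projected_argmax_def by auto
    then have x0: "0 \<le> x" and xm: "\<And>y. 0 \<le> y \<Longrightarrow> f y \<le> f x" by (auto simp: is_arg_max_linorder)
    have "p = min x b" using x(2) x0 by (simp add: proj_def)
    moreover have "f y \<le> f b" if "0 \<le> y" "y \<le> b" "b \<le> x" for y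
      using qcD[of y b x] xm[of y] that by auto
    ultimately show ?thesis using x0 xm b by (auto simp: is_arg_max_linorder min_def)
  next
    case False
    then have pb: "p = b" using p unfolding projected_argmax_def by auto
    have "f y \<le> f b" if "0 \<le> y" "y \<le> b" for y
    proof (rule ccontr)
      assume less: "\<not> f y \<le> f b"
      have "compact {0..b}" "{0..b} \<noteq> {}" "continuous_on {0..b} f"
        using b continuous_on_subset[OF cont] by auto
      then obtain x where x: "x \<in> {0..b}" "\<forall>z\<in>{0..b}. f z \<le> f x"
        using continuous_attains_sup by blast
      have "f z \<le> f x" if "0 \<le> z" for z
      proof (cases "z \<le> b")
        case False
        then have "f z \<le> f b" using qcD[of y b z] less \<open>0 \<le> y\<close> \<open>y \<le> b\<close> by (auto simp: min_def split: if_splits)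
        also have "\<dots> \<le> f x" using x(2) b by auto
        finally show ?thesis .
      qed (use x that in auto)
      then have "is_arg_max f (\<lambda>x. 0 \<le> x) x" using x by (auto simp: is_arg_max_linorder)
      then show False using False by blast
    qed
    then show ?thesis using pb b by (auto simp: is_arg_max_linorder)
  qed
qed

text \<open>The values of \<open>d\<close> converge although the maximizers need not:
  \<open>d\<close> is the same at all maximizers of \<open>F\<close>, so by compactness the points
  with a clearly different value of \<open>d\<close> lose a fixed amount of \<open>F\<close>, more
  than a small perturbation can restore. In the application \<open>F\<close> and \<open>c\<close>
  are the utilities at the two ends of a segment of multipliers, and \<open>d\<close> is the utility
  at arbitrary third multipliers.\<close>

lemma argmax_stability:
  fixes F c d :: "'i \<Rightarrow> real \<Rightarrow> real" and t :: "nat \<Rightarrow> real"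
  assumes fin: "finite I"
    and cont: "\<And>m. m \<in> I \<Longrightarrow> continuous_on {0..b m} (F m)" "\<And>m. m \<in> I \<Longrightarrow> continuous_on {0..b m} (c m)"
      "\<And>m. m \<in> I \<Longrightarrow> continuous_on {0..b m} (d m)"
    and star: "ms \<in> I" "ps \<in> {0..b ms}"
    and best: "\<And>m q. m \<in> I \<Longrightarrow> q \<in> {0..b m} \<Longrightarrow> F m q \<le> F ms ps"
    and uniq: "\<And>m q. m \<in> I \<Longrightarrow> q \<in> {0..b m} \<Longrightarrow> F m q = F ms ps \<Longrightarrow> d m q = d ms ps"
    and t: "t \<longlonglongrightarrow> 0"
    and mn: "\<And>n. mn n \<in> I" "\<And>n. pn n \<in> {0..b (mn n)}"
    and nbest: "\<And>n. (1 - t n) * F ms ps + t n * c ms ps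
        \<le> (1 - t n) * F (mn n) (pn n) + t n * c (mn n) (pn n)"
  shows "(\<lambda>n. d (mn n) (pn n)) \<longlonglongrightarrow> d ms ps"
proof -
  have bnd: "\<exists>B. \<forall>m\<in>I. \<forall>q\<in>{0..b m}. \<bar>G m q\<bar> \<le> B"
    if G: "\<And>m. m \<in> I \<Longrightarrow> continuous_on {0..b m} (G m)" for G :: "'i \<Rightarrow> real \<Rightarrow> real"
  proof -
    have "\<exists>B. \<forall>q\<in>{0..b m}. \<bar>G m q\<bar> \<le> B" if "m \<in> I" for m
      using compact_imp_bounded[OF compact_continuous_image[OF G[OF that] compact_Icc]]
      by (auto simp: bounded_iff)
    then obtain B where B: "\<And>m. m \<in> I \<Longrightarrow> \<forall>q\<in>{0..b m}. \<bar>G m q\<bar> \<le> B m" by metis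
    have "\<bar>G m q\<bar> \<le> (\<Sum>m\<in>I. \<bar>B m\<bar>)" if "m \<in> I" "q \<in> {0..b m}" for m q
    proof -
      have "\<bar>G m q\<bar> \<le> B m" using B[OF that(1)] that(2) by auto
      also have "\<dots> \<le> \<bar>B m\<bar>" by simp
      also have "\<dots> \<le> (\<Sum>m\<in>I. \<bar>B m\<bar>)" using member_le_sum[of m I "\<lambda>m. \<bar>B m\<bar>"] fin that by auto
      finally show ?thesis .
    qed
    then show ?thesis by blast
  qed
  obtain BF where BF: "\<And>m q. m \<in> I \<Longrightarrow> q \<in> {0..b m} \<Longrightarrow> \<bar>F m q\<bar> \<le> BF" using bnd[OF cont(1)] by blast
  obtain Bc where Bc: "\<And>m q. m \<in> I \<Longrightarrow> q \<in> {0..b m} \<Longrightarrow> \<bar>c m q\<bar> \<le> Bc" using bnd[OF cont(2)] by blast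
  \<comment> \<open>\<open>B\<close> bounds the change of \<open>F - c\<close> between any two
    admissible points. The sign of \<open>t n\<close> is free, hence the absolute value in the
    estimate.\<close>
  define B where "B = 2 * BF + 2 * Bc"
  have gap: "F ms ps - \<bar>t n\<bar> * B \<le> F (mn n) (pn n)" for n
  proof -
    let ?D = "(F (mn n) (pn n) - c (mn n) (pn n)) - (F ms ps - c ms ps)"
    have "\<bar>?D\<bar> \<le> B" using BF[OF star] Bc[OF star] BF[OF mn[of n]] Bc[OF mn[of n]] unfolding B_def by linarith
    then have "\<bar>t n\<bar> * \<bar>?D\<bar> \<le> \<bar>t n\<bar> * B" by (simp add: mult_left_mono)
    then have "- (\<bar>t n\<bar> * B) \<le> t n * ?D" by (simp flip: abs_mult)
    moreover have "F ms ps + t n * ?D \<le> F (mn n) (pn n)" using nbest[of n] by (simp add: algebra_simps)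
    ultimately show ?thesis by simp
  qed
  show ?thesis
  proof (rule tendstoI)
    fix e :: real assume e: "0 < e"
    \<comment> \<open>The points where \<open>d\<close> is off by at least \<open>e\<close> form a
      compact set on which the overall maximum of \<open>F\<close> is not attained, which leaves a
      margin.\<close>
    have "\<exists>\<eta>>0. \<forall>q\<in>{0..b m}. e \<le> \<bar>d m q - d ms ps\<bar> \<longrightarrow> F m q \<le> F ms ps - \<eta>" if m: "m \<in> I" for m
    proof (cases "{q\<in>{0..b m}. e \<le> \<bar>d m q - d ms ps\<bar>} = {}")
      case True
      then show ?thesis by (intro exI[of _ 1]) auto
    next
      case False
      let ?K = "{q\<in>{0..b m}. e \<le> \<bar>d m q - d ms ps\<bar>}"
      have "closedin (top_of_set {0..b m}) ({0..b m} \<inter> (\<lambda>q. \<bar>d m q - d ms ps\<bar>) -` {e..})"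
        by (intro continuous_closedin_preimage continuous_intros cont m)
      then have "closed ({0..b m} \<inter> (\<lambda>q. \<bar>d m q - d ms ps\<bar>) -` {e..})"
        using closedin_closed_trans by blast
      then have "compact ({0..b m} \<inter> ({0..b m} \<inter> (\<lambda>q. \<bar>d m q - d ms ps\<bar>) -` {e..}))"
        by (intro compact_Int_closed) auto
      also have "({0..b m} \<inter> ({0..b m} \<inter> (\<lambda>q. \<bar>d m q - d ms ps\<bar>) -` {e..})) = ?K" by auto
      finally have "compact ?K" .
      moreover have "continuous_on ?K (F m)" by (rule continuous_on_subset[OF cont(1)[OF m]]) auto
      ultimately obtain q0 where q0: "q0 \<in> ?K" "\<forall>q\<in>?K. F m q \<le> F m q0"
        using continuous_attains_sup[of ?K "F m"] False by blast
      have "F m q0 < F ms ps" using best[OF m, of q0] uniq[OF m, of q0] q0(1) e by force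
      then show ?thesis using q0 by (intro exI[of _ "F ms ps - F m q0"]) auto
    qed
    then obtain \<eta> where \<eta>: "\<And>m. m \<in> I \<Longrightarrow> 0 < \<eta> m"
        "\<And>m q. m \<in> I \<Longrightarrow> q \<in> {0..b m} \<Longrightarrow> e \<le> \<bar>d m q - d ms ps\<bar> \<Longrightarrow> F m q \<le> F ms ps - \<eta> m"
      by metis
    have "0 < Min (\<eta> ` I)" using fin star(1) \<eta>(1) by (subst Min_gr_iff) auto
    moreover have "(\<lambda>n. \<bar>t n\<bar> * B) \<longlonglongrightarrow> \<bar>0\<bar> * B" by (intro tendsto_intros t)
    ultimately have "eventually (\<lambda>n. \<bar>t n\<bar> * B < Min (\<eta> ` I)) sequentially"
      by (intro order_tendstoD) auto
    then show "eventually (\<lambda>n. dist (d (mn n) (pn n)) (d ms ps) < e) sequentially"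
    proof eventually_elim
      case (elim n)
      have "Min (\<eta> ` I) \<le> \<eta> (mn n)" using fin mn(1) by simp
      then show ?case using \<eta>(2)[OF mn, of n] gap[of n] elim by (fastforce simp: dist_real_def)
    qed
  qed
qed

section \<open>Measurable selection of a maximizer\<close>

definition maxim_on :: "(real \<Rightarrow> real) \<Rightarrow> real \<Rightarrow> real \<Rightarrow> bool" where
  "maxim_on f b p \<longleftrightarrow> p \<in> {0..b} \<and> (\<forall>q\<in>{0..b}. f q \<le> f p)"

text \<open>By continuity the quantifiers over reals reduce to rationals: every rational competitor
  is exceeded within \<open>[c, d]\<close> up to every tolerance. The tolerance is there because the
  maximizer itself may be irrational.\<close>

lemma pred_maxim_on_ivl:
  fixes f :: "'a \<Rightarrow> real \<Rightarrow> real"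
  assumes meas: "\<And>t. t \<in> {0..1} \<Longrightarrow> (\<lambda>x. f x t) \<in> borel_measurable M"
    and cont: "\<And>x. x \<in> space M \<Longrightarrow> continuous_on {0..1} (f x)"
    and cd: "0 \<le> c" "c < d" "d \<le> 1"
  shows "{x \<in> space M. \<exists>t\<in>{c..d}. maxim_on (f x) 1 t} \<in> sets M"
proof -
  \<comment> \<open>Rationals in the open interval suffice, the endpoints being limits of
    them.\<close>
  have cl: "closure (\<rat> \<inter> {u<..<v}) = {u..v}" if "u < v" for u v :: real
  proof -
    have "closure (\<rat> :: real set) = UNIV"
    proof -
      have "\<exists>y\<in>\<rat>. dist y x < e" if "0 < e" for x e :: real
        using Rats_dense_in_real[of x "x + e"] that by (force simp: dist_real_def)
      then show ?thesis by (auto simp: closure_approachable)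
    qed
    then have "closure ({u<..<v} \<inter> \<rat>) = closure {u<..<v}"
      by (intro closure_open_Int_superset) auto
    then show ?thesis using that by (simp add: Int_commute)
  qed
  have eq: "{x \<in> space M. \<exists>t\<in>{c..d}. maxim_on (f x) 1 t} =
     {x \<in> space M. \<forall>q\<in>\<rat> \<inter> {0<..<1}. \<forall>n::nat. \<exists>r\<in>\<rat> \<inter> {c<..<d}. f x q < f x r + inverse (Suc n)}"
    (is "?L = ?R")
  proof (intro set_eqI iffI)
    fix x assume x: "x \<in> ?L"
    then obtain t where t: "t \<in> {c..d}" "maxim_on (f x) 1 t" by auto
    have "\<exists>r\<in>\<rat> \<inter> {c<..<d}. f x q < f x r + inverse (Suc n)" if q: "q \<in> \<rat> \<inter> {0<..<1}" for q and n :: nat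
    proof -
      have "continuous_on {c..d} (f x)" using x cd by (auto intro: continuous_on_subset[OF cont])
      then have "(f x \<longlongrightarrow> f x t) (at t within {c..d})" using t by (auto simp: continuous_on_def)
      then have "\<forall>\<^sub>F y in at t within {c..d}. f x t - inverse (Suc n) < f x y"
        by (rule order_tendstoD) auto
      then obtain e where e: "0 < e" "\<And>y. y \<in> {c..d} \<Longrightarrow> y \<noteq> t \<Longrightarrow> dist y t < e \<Longrightarrow> f x t - inverse (Suc n) < f x y"
        by (auto simp: eventually_at)
      have "t \<in> closure (\<rat> \<inter> {c<..<d})" using cl t cd by auto
      then obtain r where r: "r \<in> \<rat> \<inter> {c<..<d}" "dist r t < e"
        using e(1) by (auto simp: closure_approachable)
      have "f x t - inverse (Suc n) < f x r" using e(2)[of r] r by (cases "r = t") auto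
      moreover have "f x q \<le> f x t" using t q by (auto simp: maxim_on_def)
      ultimately show ?thesis using r(1) by (intro bexI[of _ r]) auto
    qed
    then show "x \<in> ?R" using x by auto
  next
    fix x assume x: "x \<in> ?R"
    have "continuous_on {c..d} (f x)" using x cd by (auto intro: continuous_on_subset[OF cont])
    \<comment> \<open>The maximum over \<open>[c, d]\<close> absorbs the tolerances, so
      \<open>t\<close> beats all rationals in the open unit interval and, by continuity, all of
      \<open>[0, 1]\<close>.\<close>
    then obtain t where t: "t \<in> {c..d}" "\<forall>r\<in>{c..d}. f x r \<le> f x t"
      using continuous_attains_sup[of "{c..d}" "f x"] cd by auto
    have rat: "f x q \<le> f x t" if q: "q \<in> \<rat> \<inter> {0<..<1}" for q
    proof (rule ccontr)
      assume "\<not> f x q \<le> f x t"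
      then obtain n where "inverse (real (Suc n)) < f x q - f x t"
        using reals_Archimedean[of "f x q - f x t"] by auto
      moreover obtain r where "r \<in> \<rat> \<inter> {c<..<d}" "f x q < f x r + inverse (Suc n)" using x q by blast
      moreover have "f x r \<le> f x t" using t(2) calculation(2) by auto
      ultimately show False by simp
    qed
    have "f x q \<le> f x t" if q: "q \<in> {0..1}" for q
    proof -
      have "continuous_on (closure (\<rat> \<inter> {0<..<1})) (f x)" using cl[of 0 1] cont[of x] x by simp
      from continuous_le_on_closure[OF this, of q "f x t"] show ?thesis using cl[of 0 1] q rat by auto
    qed
    then show "x \<in> ?L" using x t cd by (auto simp: maxim_on_def intro!: bexI[of _ t])
  qed
  have [measurable]: "(\<lambda>x. f x t) \<in> borel_measurable M" if "t \<in> \<rat> \<inter> {u<..<v}" "0 \<le> u" "v \<le> 1" for t u v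
    using meas that by auto
  have c: "countable (\<rat> \<inter> {u<..<v})" for u v :: real using countable_rat by auto
  have "{x \<in> space M. f x q < f x r + inverse (Suc n)} \<in> sets M"
    if "q \<in> \<rat> \<inter> {0<..<1}" "r \<in> \<rat> \<inter> {c<..<d}" for q r and n :: nat
  proof -
    have [measurable]: "(\<lambda>x. f x q) \<in> borel_measurable M" "(\<lambda>x. f x r) \<in> borel_measurable M"
      using meas that cd by auto
    show ?thesis by measurable
  qed
  then show ?thesis unfolding eq
    by (intro sets.sets_Collect_countable_All' sets.sets_Collect_countable_Ex' sets.sets_Collect_countable_All c) auto
qed

text \<open>The largest maximizer is selected: it exceeds \<open>a\<close> iff some maximizer lies
  in \<open>[c, 1]\<close> for a rational \<open>c > a\<close>, which is a countable union of the
  events of \<open>pred_maxim_on_ivl\<close>.\<close>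

lemma measurable_maximizer:
  fixes f :: "'a \<Rightarrow> real \<Rightarrow> real"
  assumes meas: "\<And>t. t \<in> {0..1} \<Longrightarrow> (\<lambda>x. f x t) \<in> borel_measurable M"
    and cont: "\<And>x. x \<in> space M \<Longrightarrow> continuous_on {0..1} (f x)"
  obtains T where "T \<in> borel_measurable M" "\<And>x. x \<in> space M \<Longrightarrow> maxim_on (f x) 1 (T x)"
proof -
  define T where "T x = Sup {t. maxim_on (f x) 1 t}" for x
  have bdd: "bdd_above {t. maxim_on (f x) 1 t}" for x by (rule bdd_aboveI[of _ 1]) (auto simp: maxim_on_def)
  have ne: "\<exists>t. maxim_on (f x) 1 t" if "x \<in> space M" for x
    using continuous_attains_sup[of "{0..1}" "f x"] cont[OF that] by (auto simp: maxim_on_def)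
  have max: "maxim_on (f x) 1 (T x)" if x: "x \<in> space M" for x
  proof -
    obtain t0 where t0: "maxim_on (f x) 1 t0" using ne[OF x] by blast
    \<comment> \<open>The maximizers form a superlevel set, so they are closed and contain their
      supremum.\<close>
    have "{t. maxim_on (f x) 1 t} = {0..1} \<inter> f x -` {f x t0..}"
      using t0 by (auto simp: maxim_on_def intro: order_trans)
    moreover have "closedin (top_of_set {0..1}) ({0..1} \<inter> f x -` {f x t0..})"
      by (intro continuous_closedin_preimage cont x) auto
    ultimately have "closed {t. maxim_on (f x) 1 t}" using closedin_closed_trans by fastforce
    then show ?thesis using closed_contains_Sup[OF _ bdd, of x] t0 by (auto simp: T_def)
  qed
  have "{x \<in> space M. a < T x} \<in> sets M" for a
  proof (cases "a < 0")
    case True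
    then have "{x \<in> space M. a < T x} = space M" using max by (fastforce simp: maxim_on_def)
    then show ?thesis by simp
  next
    case False
    have "{x \<in> space M. a < T x} =
        {x \<in> space M. \<exists>c\<in>\<rat> \<inter> {a<..<1}. \<exists>t\<in>{c..1}. maxim_on (f x) 1 t}"
    proof (intro set_eqI iffI)
      fix x assume "x \<in> {x \<in> space M. a < T x}"
      then have x: "x \<in> space M" "a < T x" by auto
      obtain c where c: "c \<in> \<rat>" "a < c" "c < T x" using Rats_dense_in_real[OF x(2)] by blast
      moreover have "T x \<le> 1" using max[OF x(1)] by (auto simp: maxim_on_def)
      ultimately show "x \<in> {x \<in> space M. \<exists>c\<in>\<rat> \<inter> {a<..<1}. \<exists>t\<in>{c..1}. maxim_on (f x) 1 t}"
        using x max[OF x(1)] by (intro CollectI conjI bexI[of _ c] bexI[of _ "T x"]) auto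
    next
      fix x assume "x \<in> {x \<in> space M. \<exists>c\<in>\<rat> \<inter> {a<..<1}. \<exists>t\<in>{c..1}. maxim_on (f x) 1 t}"
      then obtain c t where "x \<in> space M" "a < c" "c \<le> t" "maxim_on (f x) 1 t" by auto
      then show "x \<in> {x \<in> space M. a < T x}" using cSup_upper[OF _ bdd, of t x] by (auto simp: T_def)
    qed
    moreover have "countable (\<rat> \<inter> {a<..<1})" using countable_rat by auto
    ultimately show ?thesis using False
      by (simp only:) (intro sets.sets_Collect_countable_Ex' pred_maxim_on_ivl meas cont; auto)
  qed
  then have "T \<in> borel_measurable M" by (simp add: borel_measurable_iff_greater)
  then show ?thesis using max that by blast
qed

text \<open>Two rationals separate two distinct maximizers. One rational would not do, since a
  maximizer equal to it would lie in both intervals.\<close>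

lemma sets_nonunique_maximizer:
  fixes f :: "'a \<Rightarrow> real \<Rightarrow> real"
  assumes meas: "\<And>t. t \<in> {0..1} \<Longrightarrow> (\<lambda>x. f x t) \<in> borel_measurable M"
    and cont: "\<And>x. x \<in> space M \<Longrightarrow> continuous_on {0..1} (f x)"
  shows "{x \<in> space M. \<exists>s t. s < t \<and> maxim_on (f x) 1 s \<and> maxim_on (f x) 1 t} \<in> sets M"
proof -
  have "{x \<in> space M. \<exists>s t. s < t \<and> maxim_on (f x) 1 s \<and> maxim_on (f x) 1 t} =
    (\<Union>c\<in>\<rat> \<inter> {0<..<1}. \<Union>d\<in>\<rat> \<inter> {c<..<1}.
       {x \<in> space M. \<exists>t\<in>{0..c}. maxim_on (f x) 1 t} \<inter> {x \<in> space M. \<exists>t\<in>{d..1}. maxim_on (f x) 1 t})"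
    (is "?L = ?R")
  proof (intro set_eqI iffI)
    fix x assume "x \<in> ?L"
    then obtain s t where st: "x \<in> space M" "s < t" "maxim_on (f x) 1 s" "maxim_on (f x) 1 t" by auto
    obtain c where c: "c \<in> \<rat>" "s < c" "c < t" using Rats_dense_in_real[OF st(2)] by blast
    obtain d where d: "d \<in> \<rat>" "c < d" "d < t" using Rats_dense_in_real[OF c(3)] by blast
    have "s \<in> {0..c}" "t \<in> {d..1}" "c \<in> \<rat> \<inter> {0<..<1}" "d \<in> \<rat> \<inter> {c<..<1}"
      using st c d by (auto simp: maxim_on_def)
    then show "x \<in> ?R" using st by blast
  next
    fix x assume "x \<in> ?R"
    then obtain c d s t where "x \<in> space M" "s \<le> c" "c < d" "d \<le> t" "maxim_on (f x) 1 s" "maxim_on (f x) 1 t"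
      by auto
    then show "x \<in> ?L" by (intro CollectI conjI exI[of _ s] exI[of _ t]) auto
  qed
  also have "\<dots> \<in> sets M"
    using countable_rat
    by (intro sets.countable_UN'' sets.Int pred_maxim_on_ivl meas cont) auto
  finally show ?thesis .
qed

section \<open>Measure-theoretic tools\<close>

text \<open>Fubini along coordinate \<open>i\<close>, countable sections being Lebesgue null. In the
  tie lemmas \<open>i\<close> is the gain of one user to the access point.\<close>

lemma null_sets_PiM_countable_sections:
  fixes I :: "'i set" and A :: "('i \<Rightarrow> real) set"
  assumes I: "finite I" "i \<in> I" and A: "A \<in> sets (\<Pi>\<^sub>M j\<in>I. lborel)"
    and sec: "\<And>x. countable {y. x(i := y) \<in> A}"
  shows "A \<in> null_sets (\<Pi>\<^sub>M j\<in>I. lborel)"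
proof -
  interpret product_sigma_finite "\<lambda>_::'i. lborel :: real measure" by standard
  let ?J = "I - {i}"
  have eq: "insert i ?J = I" using I by auto
  have "emeasure (\<Pi>\<^sub>M j\<in>I. lborel) A = (\<integral>\<^sup>+ x. indicator A x \<partial>(\<Pi>\<^sub>M j\<in>insert i ?J. lborel))"
    using A by (simp add: insert_absorb[OF I(2)])
  also have "\<dots> = (\<integral>\<^sup>+ x. (\<integral>\<^sup>+ y. indicator A (x(i := y)) \<partial>lborel) \<partial>(\<Pi>\<^sub>M j\<in>?J. lborel))"
    using I A by (intro product_nn_integral_insert) (auto simp: insert_absorb)
  also have "\<dots> = (\<integral>\<^sup>+ x. 0 \<partial>(\<Pi>\<^sub>M j\<in>?J. lborel :: real measure))"
  proof (intro nn_integral_cong)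
    fix x
    have "{y. x(i := y) \<in> A} \<in> null_sets lborel" using sec[of x] by (rule countable_imp_null_set_lborel)
    then have "AE y in lborel. y \<notin> {y. x(i := y) \<in> A}" by (rule AE_not_in)
    then have "AE y in lborel. (indicator A (x(i := y)) :: ennreal) = 0" by eventually_elim auto
    then show "(\<integral>\<^sup>+ y. indicator A (x(i := y)) \<partial>lborel) = 0"
      by (subst nn_integral_cong_AE) auto
  qed
  finally show ?thesis using A by (auto simp: null_sets_def)
qed

text \<open>Connects the expectations conditioned on an active PU, as in the long-term constraints,
  with the activity-weighted integrals of the Lagrangian.\<close>

lemma (in finite_measure) integral_uniform_measure:
  fixes f :: "'a \<Rightarrow> real"
  assumes B: "B \<in> sets M" "0 < measure M B" and f: "integrable M (\<lambda>x. indicator B x * f x)"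
    "f \<in> borel_measurable M"
  shows "measure M B * (\<integral>x. f x \<partial>uniform_measure M B) = (\<integral>x. indicator B x * f x \<partial>M)"
proof -
  have "uniform_measure M B = density M (\<lambda>x. ennreal (indicator B x / measure M B))"
    unfolding uniform_measure_def
    using B by (intro density_cong) (auto simp: emeasure_eq_measure indicator_def simp flip: divide_ennreal)
  then have "(\<integral>x. f x \<partial>uniform_measure M B) = (\<integral>x. (indicator B x / measure M B) *\<^sub>R f x \<partial>M)"
    using B f(2) by (simp add: integral_density)
  also have "\<dots> = (\<integral>x. (indicator B x * f x) / measure M B \<partial>M)" by simp
  finally show ?thesis using B by simp
qed

lemma rate1_bounds:
  assumes "0 < g" "0 \<le> x"
  shows "0 \<le> rate1 g x" "rate1 g x \<le> rate1 g 0"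
proof -
  have "0 \<le> g / (1 + x)" using assms by simp
  moreover have "g / (1 + x) \<le> g" using assms frac_le[of g g 1 "1 + x"] by simp
  ultimately show "0 \<le> rate1 g x" "rate1 g x \<le> rate1 g 0"
    using assms(1) by (auto simp: rate1_def)
qed

section \<open>Utility of a single user\<close>

text \<open>The interference power at which the rate of PU \<open>k\<close> equals
  \<open>limR S k\<close>: the solution \<open>x\<close> of
  \<open>1 + gam S k / (1 + x) = 2 powr limR S k\<close>.\<close>

definition max_interference :: "params \<Rightarrow> nat \<Rightarrow> real" where
  "max_interference S k = gam S k / (2 powr limR S k - 1) - 1"

text \<open>Closed form of \<open>peak\<close> in terms of activity and gain only, from which
  measurability is visible. A short-term limit that is not imposed is replaced by
  \<open>ampP S k m\<close>, which is neutral in the minimum.\<close>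

definition peak_power :: "params \<Rightarrow> nat \<Rightarrow> nat \<Rightarrow> real \<Rightarrow> real \<Rightarrow> real" where
  "peak_power S k m a g =
     (if a = 1 then
        min (ampP S k m)
          (min (if shortI S k then limI S k / g else ampP S k m)
               (if shortR S k then max_interference S k / g else ampP S k m))
      else ampP S k m)"

lemma max_interference_nonneg:
  assumes "valid_params S" "k \<in> {1..nCh S}" "shortR S k"
  shows "0 \<le> max_interference S k"
proof -
  have g: "0 < gam S k" "0 < limR S k" "limR S k \<le> log 2 (1 + gam S k)"
    using assms by (auto simp: valid_params_def rate1_def)
  then have "2 powr limR S k \<le> 1 + gam S k" by (simp add: le_log_iff)
  moreover have "1 < 2 powr limR S k" using g(2) by simp
  ultimately show ?thesis by (simp add: max_interference_def)
qed

lemma rate_limit_power: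
  assumes v: "valid_params S" "k \<in> {1..nCh S}" "shortR S k" and g: "0 < g"
  shows "(THE p. 0 \<le> p \<and> rate1 (gam S k) (g * p) = limR S k) = max_interference S k / g"
proof -
  have G: "0 < gam S k" "0 < limR S k" using v by (auto simp: valid_params_def)
  have R: "1 < 2 powr limR S k" using G(2) by simp
  have "0 \<le> p \<and> rate1 (gam S k) (g * p) = limR S k \<longleftrightarrow> p = max_interference S k / g" for p
  proof (cases "0 \<le> p")
    case True
    then have pos: "0 < 1 + g * p" using g by (simp add: add_pos_nonneg)
    then have pos': "0 < 1 + gam S k / (1 + g * p)" using G by (intro add_pos_pos) auto
    have "rate1 (gam S k) (g * p) = limR S k \<longleftrightarrow> 1 + gam S k / (1 + g * p) = 2 powr limR S k"
      unfolding rate1_def using powr_log_cancel[OF _ _ pos', of 2] by (auto simp del: powr_log_cancel)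
    also have "\<dots> \<longleftrightarrow> gam S k = (2 powr limR S k - 1) * (1 + g * p)" using pos by (auto simp: field_simps)
    also have "\<dots> \<longleftrightarrow> p = max_interference S k / g" 
    proof -
      define D where "D = 2 powr limR S k - 1"
      have "D \<noteq> 0" using R unfolding D_def by linarith
      then have "gam S k = D * (1 + g * p) \<longleftrightarrow> gam S k / D - 1 = g * p" by (auto simp: field_simps)
      then show ?thesis using g by (auto simp: max_interference_def D_def[symmetric] field_simps)
    qed
    finally show ?thesis using True by simp
  next
    case False
    then show ?thesis using max_interference_nonneg[OF v] g by auto
  qed
  then show ?thesis by simp
qed

text \<open>At zero gain the equations behind the definite descriptions in \<open>peak\<close> have
  no solution or infinitely many; with positive gain they can be solved for the power.\<close>

lemma peak_eq:
  assumes v: "valid_params S" "k \<in> {1..nCh S}" and m: "0 < m" and g: "0 < gain1 h k m"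
  shows "peak S h k m = peak_power S k m (act h k) (gain1 h k m)"
proof -
  have "(THE p. gain1 h k m * p = limI S k) = limI S k / gain1 h k m"
    using g by (intro the_equality) (auto simp: field_simps)
  then show ?thesis using m rate_limit_power[OF v _ g] unfolding peak_def peak_power_def
    by (auto simp: min.commute min.left_commute)
qed

lemma peak_power_bounds:
  assumes "valid_params S" "k \<in> {1..nCh S}" "m \<in> {1..nSU S}" "0 < g"
  shows "0 \<le> peak_power S k m a g" "peak_power S k m a g \<le> ampP S k m"
proof -
  have "0 < ampP S k m" "0 < limI S k" using assms by (auto simp: valid_params_def)
  then show "0 \<le> peak_power S k m a g" "peak_power S k m a g \<le> ampP S k m"
    using max_interference_nonneg[OF assms(1,2)] assms(4) by (auto simp: peak_power_def)
qed

text \<open>The almost sure conditions under which \<open>peak\<close> has its closed form and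
  \<open>phi\<close> is continuous in the power.\<close>

definition regular :: "params \<Rightarrow> csi \<Rightarrow> bool" where
  "regular S h \<longleftrightarrow> (\<forall>k\<in>{1..nCh S}. act h k \<in> {0, 1} \<and>
     (\<forall>m\<in>{1..nSU S}. 0 < gain1 h k m \<and> 0 < gain2 h k m))"

text \<open>\<open>phi\<close> with the state reduced to three real arguments, so that a single gain
  can be varied while the rest is fixed.\<close>

definition util ::
  "params \<Rightarrow> (nat \<Rightarrow> real) \<Rightarrow> (nat \<Rightarrow> real) \<Rightarrow> (nat \<Rightarrow> real) \<Rightarrow>
     nat \<Rightarrow> nat \<Rightarrow> real \<Rightarrow> real \<Rightarrow> real \<Rightarrow> real \<Rightarrow> real" where
  "util S \<pi> \<theta> \<rho> k m a g1 g2 p =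
     beta S m * log 2 (1 + g2 * p) - \<pi> m * p - \<theta> k * a * g1 * p + \<rho> k * a * rate1 (gam S k) (g1 * p)"

lemma phi_eq_util:
  "0 < m \<Longrightarrow> phi S \<pi> \<theta> \<rho> h k m p = util S \<pi> \<theta> \<rho> k m (act h k) (gain1 h k m) (gain2 h k m) p"
  by (simp add: phi_def util_def rate2_def)

lemma continuous_on_util:
  assumes "0 < gam S k" "0 < g1" "0 < g2"
  shows "continuous_on {0..} (util S \<pi> \<theta> \<rho> k m a g1 g2)"
proof -
  have *: "1 + g2 * p > 0" "1 + g1 * p > 0" if "0 \<le> p" for p
    using assms that by (auto intro!: add_pos_nonneg)
  then have **: "1 + gam S k / (1 + g1 * p) > 0" if "0 \<le> p" for p
    using assms that by (intro add_pos_pos) auto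
  show ?thesis unfolding util_def[abs_def] rate1_def log_def
    using * ** by (intro continuous_intros) (auto simp: less_le)
qed

lemma continuous_on_phi:
  assumes v: "valid_params S" "regular S h" "k \<in> {1..nCh S}" "m \<in> {0..nSU S}"
  shows "continuous_on {0..} (phi S \<pi> \<theta> \<rho> h k m)"
proof (cases "m = 0")
  case True
  then show ?thesis unfolding phi_def[abs_def] rate2_def gain1_def by (auto intro!: continuous_intros)
next
  case False
  have "continuous_on {0..} (util S \<pi> \<theta> \<rho> k m (act h k) (gain1 h k m) (gain2 h k m))"
    using assms False by (intro continuous_on_util) (auto simp: regular_def valid_params_def)
  then show ?thesis using False by (simp add: phi_eq_util cong: continuous_on_cong)
qed

lemma peak_bounds:
  assumes v: "valid_params S" "regular S h" "k \<in> {1..nCh S}" "m \<in> {0..nSU S}"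
  shows "0 \<le> peak S h k m" "0 < m \<Longrightarrow> peak S h k m \<le> ampP S k m" "m = 0 \<Longrightarrow> peak S h k m = 0"
proof -
  show "m = 0 \<Longrightarrow> peak S h k m = 0" by (simp add: peak_def)
  then show "0 \<le> peak S h k m" "0 < m \<Longrightarrow> peak S h k m \<le> ampP S k m"
    using assms peak_power_bounds[OF v(1,3), of m "gain1 h k m" "act h k"] peak_eq[OF v(1,3), of m h]
    by (cases "m = 0"; auto simp: regular_def)+
qed

text \<open>The power is written as a fraction \<open>t\<close> of the peak, because the selection
  of maximizers works on one interval common to all states. The value 0 at nonpositive gains keeps
  the function continuous in \<open>t\<close> for every triple.\<close>

definition scaled_util ::
  "params \<Rightarrow> (nat \<Rightarrow> real) \<Rightarrow> (nat \<Rightarrow> real) \<Rightarrow> (nat \<Rightarrow> real) \<Rightarrow>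
     nat \<Rightarrow> nat \<Rightarrow> real \<times> real \<times> real \<Rightarrow> real \<Rightarrow> real" where
  "scaled_util S \<pi> \<theta> \<rho> k m = (\<lambda>(a, g1, g2) t.
     if 0 < g1 \<and> 0 < g2 then util S \<pi> \<theta> \<rho> k m a g1 g2 (t * peak_power S k m a g1) else 0)"

abbreviation borel3 :: "(real \<times> real \<times> real) measure" where
  "borel3 \<equiv> borel \<Otimes>\<^sub>M borel \<Otimes>\<^sub>M borel"

lemma measurable_peak_power[measurable]: "(\<lambda>z. peak_power S k m (fst z) (fst (snd z))) \<in> borel_measurable borel3"
  unfolding peak_power_def by measurable

lemma measurable_scaled_util:
  assumes [measurable]: "T \<in> borel_measurable borel3"
  shows "(\<lambda>z. scaled_util S \<pi> \<theta> \<rho> k m z (T z)) \<in> borel_measurable borel3"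
  unfolding scaled_util_def util_def rate1_def case_prod_beta by measurable

lemma continuous_on_scaled_util:
  assumes v: "valid_params S" "k \<in> {1..nCh S}" "m \<in> {1..nSU S}"
  shows "continuous_on {0..1} (scaled_util S \<pi> \<theta> \<rho> k m z)"
proof -
  obtain a g1 g2 where z: "z = (a, g1, g2)" by (cases z)
  show ?thesis
  proof (cases "0 < g1 \<and> 0 < g2")
    case True
    have "continuous_on {0..} (util S \<pi> \<theta> \<rho> k m a g1 g2)"
      using True v by (intro continuous_on_util) (auto simp: valid_params_def)
    moreover have "continuous_on {0..1} (\<lambda>t. t * peak_power S k m a g1)" by (intro continuous_intros)
    ultimately have "continuous_on {0..1} (\<lambda>t. util S \<pi> \<theta> \<rho> k m a g1 g2 (t * peak_power S k m a g1))"
      by (rule continuous_on_compose2) (use True peak_power_bounds[OF v, of g1 a] in auto)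
    then show ?thesis using True by (simp add: z scaled_util_def)
  qed (auto simp: z scaled_util_def)
qed

lemma maxim_on_scale:
  assumes b: "0 \<le> b"
  shows "maxim_on (\<lambda>t. f (t * b)) 1 t \<Longrightarrow> maxim_on f b (t * b)"
    and "0 < b \<Longrightarrow> maxim_on f b p \<Longrightarrow> maxim_on (\<lambda>t. f (t * b)) 1 (p / b)"
proof -
  assume t: "maxim_on (\<lambda>t. f (t * b)) 1 t"
  have "f q \<le> f (t * b)" if "q \<in> {0..b}" for q
  proof (cases "b = 0")
    case False
    then have "q / b \<in> {0..1}" using that b by auto
    then have "f (q / b * b) \<le> f (t * b)" using t unfolding maxim_on_def by blast
    then show ?thesis using False by simp
  qed (use that in auto)
  then show "maxim_on f b (t * b)" using t b by (auto simp: maxim_on_def intro: mult_left_le_one_le)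
next
  assume b0: "0 < b" and p: "maxim_on f b p"
  have "t * b \<in> {0..b}" if "t \<in> {0..1}" for t using that b by (auto intro: mult_left_le_one_le)
  then show "maxim_on (\<lambda>t. f (t * b)) 1 (p / b)" using b0 p by (auto simp: maxim_on_def)
qed

definition best_frac ::
  "params \<Rightarrow> (nat \<Rightarrow> real) \<Rightarrow> (nat \<Rightarrow> real) \<Rightarrow> (nat \<Rightarrow> real) \<Rightarrow> nat \<Rightarrow> nat \<Rightarrow> real \<times> real \<times> real \<Rightarrow> real" where
  "best_frac S \<pi> \<theta> \<rho> k m = (SOME T. T \<in> borel_measurable borel3 \<and>
     (\<forall>z. maxim_on (scaled_util S \<pi> \<theta> \<rho> k m z) 1 (T z)))"

lemma best_frac:
  assumes "valid_params S" "k \<in> {1..nCh S}" "m \<in> {1..nSU S}"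
  shows "best_frac S \<pi> \<theta> \<rho> k m \<in> borel_measurable borel3"
    and "maxim_on (scaled_util S \<pi> \<theta> \<rho> k m z) 1 (best_frac S \<pi> \<theta> \<rho> k m z)"
proof -
  have "(\<lambda>z. scaled_util S \<pi> \<theta> \<rho> k m z t) \<in> borel_measurable borel3" for t
    by (rule measurable_scaled_util) simp
  from measurable_maximizer[OF this continuous_on_scaled_util[OF assms]]
  have "\<exists>T. T \<in> borel_measurable borel3 \<and> (\<forall>z. maxim_on (scaled_util S \<pi> \<theta> \<rho> k m z) 1 (T z))"
    by (metis (full_types) UNIV_I space_borel space_pair_measure UNIV_Times_UNIV)
  note * = someI_ex[OF this, folded best_frac_def]
  show "best_frac S \<pi> \<theta> \<rho> k m \<in> borel_measurable borel3"
    using * by (rule conjunct1)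
  show "maxim_on (scaled_util S \<pi> \<theta> \<rho> k m z) 1 (best_frac S \<pi> \<theta> \<rho> k m z)"
    using conjunct2[OF *] by (rule spec)
qed

definition best_power ::
  "params \<Rightarrow> (nat \<Rightarrow> real) \<Rightarrow> (nat \<Rightarrow> real) \<Rightarrow> (nat \<Rightarrow> real) \<Rightarrow> nat \<Rightarrow> nat \<Rightarrow> real \<times> real \<times> real \<Rightarrow> real" where
  "best_power S \<pi> \<theta> \<rho> k m z = best_frac S \<pi> \<theta> \<rho> k m z * peak_power S k m (fst z) (fst (snd z))"

lemma measurable_best_power:
  assumes "valid_params S" "k \<in> {1..nCh S}" "m \<in> {1..nSU S}"
  shows "best_power S \<pi> \<theta> \<rho> k m \<in> borel_measurable borel3"
  using best_frac(1)[OF assms, measurable] unfolding best_power_def[abs_def] by measurable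

lemma best_power:
  assumes v: "valid_params S" "k \<in> {1..nCh S}" "m \<in> {1..nSU S}" and g: "0 < g1" "0 < g2"
  shows "maxim_on (util S \<pi> \<theta> \<rho> k m a g1 g2) (peak_power S k m a g1) (best_power S \<pi> \<theta> \<rho> k m (a, g1, g2))"
proof -
  have "maxim_on (\<lambda>t. util S \<pi> \<theta> \<rho> k m a g1 g2 (t * peak_power S k m a g1)) 1 (best_frac S \<pi> \<theta> \<rho> k m (a, g1, g2))"
    using best_frac(2)[OF v, of \<pi> \<theta> \<rho> "(a, g1, g2)"] g by (simp add: scaled_util_def[of S \<pi> \<theta> \<rho> k m] maxim_on_def)
  from maxim_on_scale(1)[OF peak_power_bounds(1)[OF v g(1)] this] show ?thesis by (simp add: best_power_def)
qed

section \<open>Ties have probability zero\<close>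

lemma finite_gain_comps: "finite (gain_comps S)"
  by (auto simp: gain_comps_def)

lemma gain_comps_mem:
  "k \<in> {1..nCh S} \<Longrightarrow> m \<in> {1..nSU S} \<Longrightarrow> GPU k m \<in> gain_comps S"
  "k \<in> {1..nCh S} \<Longrightarrow> m \<in> {1..nSU S} \<Longrightarrow> GAP k m \<in> gain_comps S"
  by (auto simp: gain_comps_def)

text \<open>The second clause requires \<open>0 < p\<close> because ties at zero power are
  unavoidable: there \<open>phi\<close> takes the same value for all users of a channel.\<close>

definition no_ties ::
  "params \<Rightarrow> (nat \<Rightarrow> real) \<Rightarrow> (nat \<Rightarrow> real) \<Rightarrow> (nat \<Rightarrow> real) \<Rightarrow> csi \<Rightarrow> bool" where
  "no_ties S \<pi> \<theta> \<rho> h \<longleftrightarrow> (\<forall>k\<in>{1..nCh S}. \<forall>m\<in>{1..nSU S}.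
     (\<forall>p q. maxim_on (phi S \<pi> \<theta> \<rho> h k m) (peak S h k m) p \<longrightarrow>
        maxim_on (phi S \<pi> \<theta> \<rho> h k m) (peak S h k m) q \<longrightarrow> p = q) \<and>
     (\<forall>l\<in>{0..nSU S}. l \<noteq> m \<longrightarrow> (\<forall>p q. maxim_on (phi S \<pi> \<theta> \<rho> h k m) (peak S h k m) p \<longrightarrow>
        0 < p \<longrightarrow> maxim_on (phi S \<pi> \<theta> \<rho> h k l) (peak S h k l) q \<longrightarrow>
        phi S \<pi> \<theta> \<rho> h k m p \<noteq> phi S \<pi> \<theta> \<rho> h k l q)))"

text \<open>Here \<open>a\<close> is a fixed activity value: only the gains have a density, so a tie has to be an event
  about the gains alone in order to be recognized as null.\<close>

definition power_tie ::
  "params \<Rightarrow> (nat \<Rightarrow> real) \<Rightarrow> (nat \<Rightarrow> real) \<Rightarrow> (nat \<Rightarrow> real) \<Rightarrow> nat \<Rightarrow> nat \<Rightarrow> real \<Rightarrow> csi set" where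
  "power_tie S \<pi> \<theta> \<rho> k m a = {x \<in> space (\<Pi>\<^sub>M c\<in>gain_comps S. lborel).
     0 < x (GPU k m) \<and> 0 < x (GAP k m) \<and> 0 < peak_power S k m a (x (GPU k m)) \<and>
     (\<exists>s t. s < t \<and> maxim_on (scaled_util S \<pi> \<theta> \<rho> k m (a, x (GPU k m), x (GAP k m))) 1 s
                  \<and> maxim_on (scaled_util S \<pi> \<theta> \<rho> k m (a, x (GPU k m), x (GAP k m))) 1 t)}"

text \<open>The maximal utility does not depend on which maximizer realizes it; taking the Borel
  function \<open>best_power\<close> makes it measurable in the gains.\<close>

definition best_util ::
  "params \<Rightarrow> (nat \<Rightarrow> real) \<Rightarrow> (nat \<Rightarrow> real) \<Rightarrow> (nat \<Rightarrow> real) \<Rightarrow> nat \<Rightarrow> nat \<Rightarrow> real \<Rightarrow> csi \<Rightarrow> real" where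
  "best_util S \<pi> \<theta> \<rho> k m a x = (if m = 0 then \<rho> k * a * rate1 (gam S k) 0
     else util S \<pi> \<theta> \<rho> k m a (x (GPU k m)) (x (GAP k m)) (best_power S \<pi> \<theta> \<rho> k m (a, x (GPU k m), x (GAP k m))))"

definition user_tie ::
  "params \<Rightarrow> (nat \<Rightarrow> real) \<Rightarrow> (nat \<Rightarrow> real) \<Rightarrow> (nat \<Rightarrow> real) \<Rightarrow> nat \<Rightarrow> nat \<Rightarrow> nat \<Rightarrow> real \<Rightarrow> csi set" where
  "user_tie S \<pi> \<theta> \<rho> k m l a = {x \<in> space (\<Pi>\<^sub>M c\<in>gain_comps S. lborel).
     0 < x (GPU k m) \<and> 0 < x (GAP k m) \<and>
     0 < best_power S \<pi> \<theta> \<rho> k m (a, x (GPU k m), x (GAP k m)) \<and>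
     best_util S \<pi> \<theta> \<rho> k m a x = best_util S \<pi> \<theta> \<rho> k l a x}"

lemma measurable_gain_triple:
  assumes "k \<in> {1..nCh S}" "m \<in> {1..nSU S}"
  shows "(\<lambda>x. (a, x (GPU k m), x (GAP k m))) \<in> (\<Pi>\<^sub>M c\<in>gain_comps S. lborel) \<rightarrow>\<^sub>M borel3"
proof -
  have [measurable]: "(\<lambda>x. x (GPU k m)) \<in> borel_measurable (\<Pi>\<^sub>M c\<in>gain_comps S. lborel)"
    "(\<lambda>x. x (GAP k m)) \<in> borel_measurable (\<Pi>\<^sub>M c\<in>gain_comps S. lborel)"
    using gain_comps_mem[OF assms] measurable_component_singleton[of _ "gain_comps S" "\<lambda>_. lborel :: real measure"]
    by auto
  show ?thesis by measurable
qed

text \<open>Along a section only the gain to the access point varies. It enters \<open>util\<close>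
  through the logarithm alone and leaves the peak power fixed, so \<open>countable_ties\<close>
  applies with a constant bound.\<close>

lemma power_tie_null:
  assumes v: "valid_params S" and km: "k \<in> {1..nCh S}" "m \<in> {1..nSU S}"
  shows "power_tie S \<pi> \<theta> \<rho> k m a \<in> null_sets (\<Pi>\<^sub>M c\<in>gain_comps S. lborel)"
proof (rule null_sets_PiM_countable_sections[OF finite_gain_comps gain_comps_mem(2)[OF km]])
  let ?N = "\<Pi>\<^sub>M c\<in>gain_comps S. (lborel :: real measure)"
  note tr[measurable] = measurable_gain_triple[OF km, of a]
  let ?U = "{z \<in> space borel3. \<exists>s t. s < t \<and> maxim_on (scaled_util S \<pi> \<theta> \<rho> k m z) 1 s \<and>
        maxim_on (scaled_util S \<pi> \<theta> \<rho> k m z) 1 t}"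
  have "?U \<in> sets borel3"
    by (rule sets_nonunique_maximizer[OF measurable_scaled_util continuous_on_scaled_util[OF v km]]) simp
  moreover have "{z \<in> space borel3. 0 < fst (snd z) \<and> 0 < snd (snd z) \<and> 0 < peak_power S k m (fst z) (fst (snd z))} \<in> sets borel3"
    by measurable
  ultimately have "?U \<inter> {z \<in> space borel3. 0 < fst (snd z) \<and> 0 < snd (snd z) \<and> 0 < peak_power S k m (fst z) (fst (snd z))}
      \<in> sets borel3" (is "?V \<in> _") by (rule sets.Int)
  \<comment> \<open>The tie is the preimage of a Borel set of triples under the map from gains to
    triples with fixed activity.\<close>
  from measurable_sets[OF tr this] show "power_tie S \<pi> \<theta> \<rho> k m a \<in> sets ?N"
    by (rule back_subst[of "\<lambda>X. X \<in> sets ?N"]) (auto simp: power_tie_def space_pair_measure)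
  fix x :: csi
  let ?g = "x (GPU k m)" and ?b = "peak_power S k m a (x (GPU k m))"
  have "countable {g. 0 < g \<and> (\<exists>p q. 0 \<le> p \<and> p < q \<and> q \<le> ?b \<and>
           (\<forall>r\<in>{0..?b}. util S \<pi> \<theta> \<rho> k m a ?g g r \<le> util S \<pi> \<theta> \<rho> k m a ?g g p) \<and>
           (\<forall>r\<in>{0..?b}. util S \<pi> \<theta> \<rho> k m a ?g g r \<le> util S \<pi> \<theta> \<rho> k m a ?g g q))}"
  proof (rule countable_ties)
    fix g g' p p' :: real assume *: "0 < g" "g < g'" "0 \<le> p'" "p' < p"
    have "0 < beta S m" using v km by (auto simp: valid_params_def)
    from mult_strict_left_mono[OF log_increasing_differences[OF *] this]
    show "util S \<pi> \<theta> \<rho> k m a ?g g p - util S \<pi> \<theta> \<rho> k m a ?g g p' <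
      util S \<pi> \<theta> \<rho> k m a ?g g' p - util S \<pi> \<theta> \<rho> k m a ?g g' p'"
      by (simp add: util_def algebra_simps)
  qed
  then show "countable {y. x(GAP k m := y) \<in> power_tie S \<pi> \<theta> \<rho> k m a}"
  proof (rule countable_subset[rotated], intro subsetI)
    fix y assume "y \<in> {y. x(GAP k m := y) \<in> power_tie S \<pi> \<theta> \<rho> k m a}"
    then obtain s t where y: "0 < ?g" "0 < y" "0 < ?b" "s < t"
      "maxim_on (scaled_util S \<pi> \<theta> \<rho> k m (a, ?g, y)) 1 s" "maxim_on (scaled_util S \<pi> \<theta> \<rho> k m (a, ?g, y)) 1 t"
      by (auto simp: power_tie_def)
    have eq: "scaled_util S \<pi> \<theta> \<rho> k m (a, ?g, y) = (\<lambda>t. util S \<pi> \<theta> \<rho> k m a ?g y (t * ?b))"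
      using y by (auto simp: scaled_util_def)
    have "maxim_on (util S \<pi> \<theta> \<rho> k m a ?g y) ?b (s * ?b)" "maxim_on (util S \<pi> \<theta> \<rho> k m a ?g y) ?b (t * ?b)"
      using y(3,5,6) unfolding eq by (auto intro!: maxim_on_scale(1))
    moreover have "s * ?b < t * ?b" using y by simp
    ultimately show "y \<in> {g. 0 < g \<and> (\<exists>p q. 0 \<le> p \<and> p < q \<and> q \<le> ?b \<and>
           (\<forall>r\<in>{0..?b}. util S \<pi> \<theta> \<rho> k m a ?g g r \<le> util S \<pi> \<theta> \<rho> k m a ?g g p) \<and>
           (\<forall>r\<in>{0..?b}. util S \<pi> \<theta> \<rho> k m a ?g g r \<le> util S \<pi> \<theta> \<rho> k m a ?g g q))}"
      using y(2) unfolding maxim_on_def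
      by (intro CollectI conjI exI[of _ "s * ?b"] exI[of _ "t * ?b"]) auto
  qed
qed

lemma measurable_util:
  assumes [measurable]: "A \<in> borel_measurable M" "G1 \<in> borel_measurable M" "G2 \<in> borel_measurable M" "P \<in> borel_measurable M"
  shows "(\<lambda>x. util S \<pi> \<theta> \<rho> k m (A x) (G1 x) (G2 x) (P x)) \<in> borel_measurable M"
  unfolding util_def rate1_def by measurable

lemma is_arg_max_mem:
  fixes f :: "'a \<Rightarrow> 'b :: linorder"
  assumes "m \<in> A"
  shows "is_arg_max f (\<lambda>l. l \<in> A) m \<longleftrightarrow> (\<forall>l\<in>A. f l \<le> f m)"
  using assms by (auto simp: is_arg_max_linorder)

lemma pred_le_borel:
  fixes f g :: "'a \<Rightarrow> real"
  assumes [measurable]: "f \<in> borel_measurable M" "g \<in> borel_measurable M"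
  shows "Measurable.pred M (\<lambda>x. f x \<le> g x)"
  by measurable

lemma sets_eq_conj:
  fixes f f' g g' :: "'a \<Rightarrow> real"
  assumes [measurable]: "f \<in> borel_measurable M" "f' \<in> borel_measurable M"
    "g \<in> borel_measurable M" "g' \<in> borel_measurable M"
  shows "{x \<in> space M. f x = f' x \<and> g x = g' x} \<in> sets M"
  by measurable

lemma sets_tie:
  fixes f1 f2 f3 f4 f5 :: "'a \<Rightarrow> real"
  assumes [measurable]: "f1 \<in> borel_measurable M" "f2 \<in> borel_measurable M" "f3 \<in> borel_measurable M"
    "f4 \<in> borel_measurable M" "f5 \<in> borel_measurable M"
  shows "{x \<in> space M. 0 < f1 x \<and> 0 < f2 x \<and> 0 < f3 x \<and> f4 x = f5 x} \<in> sets M"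
  by measurable

text \<open>The best utility of \<open>m\<close> increases strictly with its own gain to the access
  point as long as its best power is positive, whereas that of \<open>l\<close> does not involve
  this gain. Each section thus has at most one point.\<close>

lemma user_tie_null:
  assumes v: "valid_params S" and km: "k \<in> {1..nCh S}" "m \<in> {1..nSU S}" and l: "l \<in> {0..nSU S}" "l \<noteq> m"
  shows "user_tie S \<pi> \<theta> \<rho> k m l a \<in> null_sets (\<Pi>\<^sub>M c\<in>gain_comps S. lborel)"
proof (rule null_sets_PiM_countable_sections[OF finite_gain_comps gain_comps_mem(2)[OF km]])
  let ?N = "\<Pi>\<^sub>M c\<in>gain_comps S. (lborel :: real measure)"
  have bp: "(\<lambda>x. best_power S \<pi> \<theta> \<rho> k j (a, x (GPU k j), x (GAP k j))) \<in> borel_measurable ?N"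
    if "j \<in> {1..nSU S}" for j
    using measurable_best_power[OF v km(1) that] measurable_gain_triple[OF km(1) that, of a]
    by (rule measurable_compose_rev)
  have cmp: "(\<lambda>x. x (GPU k j)) \<in> borel_measurable ?N" "(\<lambda>x. x (GAP k j)) \<in> borel_measurable ?N"
    if "j \<in> {1..nSU S}" for j
    using gain_comps_mem[OF km(1) that] measurable_component_singleton[of _ "gain_comps S" "\<lambda>_. lborel :: real measure"]
    by auto
  have bu: "best_util S \<pi> \<theta> \<rho> k j a \<in> borel_measurable ?N" if j: "j \<in> {0..nSU S}" for j
  proof (cases "j = 0")
    case False
    then have j': "j \<in> {1..nSU S}" using j by auto
    show ?thesis using False unfolding best_util_def[abs_def]
      by (simp add: measurable_util bp[OF j'] cmp[OF j'])
  qed (simp add: best_util_def[abs_def])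
  show "user_tie S \<pi> \<theta> \<rho> k m l a \<in> sets ?N"
    unfolding user_tie_def using l km by (intro sets_tie bp cmp bu) auto
  fix x :: csi
  let ?g = "x (GPU k m)" and ?b = "peak_power S k m a (x (GPU k m))"
  have less: "best_util S \<pi> \<theta> \<rho> k m a (x(GAP k m := y)) < best_util S \<pi> \<theta> \<rho> k m a (x(GAP k m := y'))"
    if y: "x(GAP k m := y) \<in> user_tie S \<pi> \<theta> \<rho> k m l a" "y < y'" for y y'
  proof -
    let ?p = "best_power S \<pi> \<theta> \<rho> k m (a, ?g, y)" and ?p' = "best_power S \<pi> \<theta> \<rho> k m (a, ?g, y')"
    have y0: "0 < ?g" "0 < y" "0 < ?p" using y(1) by (auto simp: user_tie_def)
    have mx: "maxim_on (util S \<pi> \<theta> \<rho> k m a ?g y) ?b ?p" "maxim_on (util S \<pi> \<theta> \<rho> k m a ?g y') ?b ?p'"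
      using y0 y(2) by (auto intro!: best_power v km)
    have "0 < beta S m" using v km by (auto simp: valid_params_def)
    moreover have "log 2 (1 + y * ?p) < log 2 (1 + y' * ?p)"
      using y0 y(2) by (subst log_less_cancel_iff) (auto intro!: add_pos_nonneg)
    \<comment> \<open>Envelope argument: the power that is best at \<open>y\<close> already earns
      strictly more at \<open>y'\<close>, and the best power at \<open>y'\<close> earns at least as
      much.\<close>
    ultimately have "util S \<pi> \<theta> \<rho> k m a ?g y ?p < util S \<pi> \<theta> \<rho> k m a ?g y' ?p" by (simp add: util_def)
    also have "\<dots> \<le> util S \<pi> \<theta> \<rho> k m a ?g y' ?p'" using mx by (auto simp: maxim_on_def)
    finally show ?thesis using km by (simp add: best_util_def)
  qed
  have const: "best_util S \<pi> \<theta> \<rho> k l a (x(GAP k m := y)) = best_util S \<pi> \<theta> \<rho> k l a x" for y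
    using l(2) by (simp add: best_util_def)
  have "y = y'" if "y \<in> {y. x(GAP k m := y) \<in> user_tie S \<pi> \<theta> \<rho> k m l a}"
    "y' \<in> {y. x(GAP k m := y) \<in> user_tie S \<pi> \<theta> \<rho> k m l a}" for y y'
  proof -
    have "best_util S \<pi> \<theta> \<rho> k m a (x(GAP k m := y)) = best_util S \<pi> \<theta> \<rho> k m a (x(GAP k m := y'))"
      using that const[of y] const[of y'] by (simp add: user_tie_def)
    then show ?thesis using less[of y y'] less[of y' y] that by (cases y y' rule: linorder_cases) auto
  qed
  \<comment> \<open>With at most one element, the section lies in the singleton of its
    \<open>SOME\<close>, even if it is empty.\<close>
  then have "{y. x(GAP k m := y) \<in> user_tie S \<pi> \<theta> \<rho> k m l a} \<subseteq> {SOME y. x(GAP k m := y) \<in> user_tie S \<pi> \<theta> \<rho> k m l a}"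
    by (metis (mono_tags, lifting) mem_Collect_eq singletonI someI subsetI)
  then show "countable {y. x(GAP k m := y) \<in> user_tie S \<pi> \<theta> \<rho> k m l a}"
    by (rule countable_subset) simp
qed

text \<open>The problem and its dual depend on the process only through the law of the state at one
  time. The joint density of the gains is recorded as absolute continuity, in
  \<open>AE_gain_null\<close>.\<close>

locale csi_law_setting = prob_space \<mu> for \<mu> :: "csi measure" +
  fixes S :: params
  assumes valid: "valid_params S"
    and sets_law: "sets \<mu> = sets (csi_space S)"
    and AE_act: "AE h in \<mu>. \<forall>k\<in>{1..nCh S}. act h k \<in> {0, 1}"
    and AE_gain_nonneg: "AE h in \<mu>. \<forall>c\<in>gain_comps S. 0 \<le> h c"
    and AE_gain_null: "\<And>N. N \<in> null_sets (\<Pi>\<^sub>M c\<in>gain_comps S. lborel) \<Longrightarrow>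
      AE h in \<mu>. restrict h (gain_comps S) \<notin> N"
    and active_pos: "\<And>k. k \<in> {1..nCh S} \<Longrightarrow> 0 < measure \<mu> {h \<in> space (csi_space S). act h k = 1}"
    and finite_exp: "finite_expectations S \<mu>"
begin

lemma space_law: "space \<mu> = space (csi_space S)"
  using sets_law by (rule sets_eq_imp_space_eq)

lemma measurable_act[measurable]: "k \<in> {1..nCh S} \<Longrightarrow> (\<lambda>h. act h k) \<in> borel_measurable \<mu>"
  unfolding measurable_cong_sets[OF sets_law refl] csi_space_def act_def
  by (rule measurable_component_singleton) auto

lemma measurable_gain1[measurable]:
  "k \<in> {1..nCh S} \<Longrightarrow> m \<in> {0..nSU S} \<Longrightarrow> (\<lambda>h. gain1 h k m) \<in> borel_measurable \<mu>"
  unfolding measurable_cong_sets[OF sets_law refl] csi_space_def gain1_def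
  by (cases "m = 0") (auto intro!: measurable_component_singleton gain_comps_mem)

lemma measurable_gain2[measurable]:
  "k \<in> {1..nCh S} \<Longrightarrow> m \<in> {0..nSU S} \<Longrightarrow> (\<lambda>h. gain2 h k m) \<in> borel_measurable \<mu>"
  unfolding measurable_cong_sets[OF sets_law refl] csi_space_def gain2_def
  by (cases "m = 0") (auto intro!: measurable_component_singleton gain_comps_mem)

text \<open>As gains are nonnegative, only vanishing ones have to be excluded, and each hyperplane
  \<open>x c = 0\<close> is null.\<close>

lemma AE_regular: "AE h in \<mu>. regular S h"
proof -
  let ?N = "\<Pi>\<^sub>M c\<in>gain_comps S. (lborel :: real measure)"
  have "AE h in \<mu>. \<forall>c\<in>gain_comps S. restrict h (gain_comps S) \<notin> {x \<in> space ?N. x c = 0}"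
  proof (rule AE_ball_countable'[OF _ countable_finite[OF finite_gain_comps]], rule AE_gain_null)
    fix c assume c: "c \<in> gain_comps S"
    show "{x \<in> space ?N. x c = 0} \<in> null_sets ?N"
    proof (rule null_sets_PiM_countable_sections[OF finite_gain_comps c])
      have [measurable]: "(\<lambda>x. x c) \<in> borel_measurable ?N"
        using measurable_component_singleton[OF c, of "\<lambda>_. lborel :: real measure"] by simp
      show "{x \<in> space ?N. x c = 0} \<in> sets ?N" by measurable
      show "countable {y. x(c := y) \<in> {x \<in> space ?N. x c = 0}}" for x
        by (rule countable_subset[of _ "{0}"]) auto
    qed
  qed
  with AE_act AE_gain_nonneg show ?thesis
  proof eventually_elim
    case (elim h)
    have "restrict h (gain_comps S) \<in> space ?N" by (simp add: space_PiM)
    then have "h c \<noteq> 0" if "c \<in> gain_comps S" for c using elim(3) that by auto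
    then have "0 < h c" if "c \<in> gain_comps S" for c using elim(2) that by (auto simp: less_le)
    then show ?case using elim(1) gain_comps_mem by (auto simp: regular_def gain1_def gain2_def)
  qed
qed

text \<open>The activity is discrete and may depend on the gains. Since it takes only the values 0
  and 1 almost surely, it is enough to exclude the null events about the gains for both values at
  once.\<close>

lemma AE_no_ties: "AE h in \<mu>. no_ties S \<pi> \<theta> \<rho> h"
proof -
  have "AE h in \<mu>. \<forall>a\<in>{0, 1}. \<forall>k\<in>{1..nCh S}. \<forall>m\<in>{1..nSU S}. restrict h (gain_comps S) \<notin> power_tie S \<pi> \<theta> \<rho> k m a"
    by (intro AE_ball_countable' AE_gain_null power_tie_null valid) auto
  moreover have "AE h in \<mu>. \<forall>a\<in>{0, 1}. \<forall>k\<in>{1..nCh S}. \<forall>m\<in>{1..nSU S}. \<forall>l\<in>{0..nSU S} - {m}.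
      restrict h (gain_comps S) \<notin> user_tie S \<pi> \<theta> \<rho> k m l a"
    by (intro AE_ball_countable' AE_gain_null user_tie_null valid) auto
  ultimately show ?thesis using AE_regular
  proof eventually_elim
    case (elim h)
    let ?x = "restrict h (gain_comps S)"
    have xs: "?x \<in> space (\<Pi>\<^sub>M c\<in>gain_comps S. (lborel :: real measure))" by (simp add: space_PiM)
    have main: "(\<forall>p q. maxim_on (phi S \<pi> \<theta> \<rho> h k m) (peak S h k m) p \<longrightarrow>
        maxim_on (phi S \<pi> \<theta> \<rho> h k m) (peak S h k m) q \<longrightarrow> p = q) \<and>
     (\<forall>l\<in>{0..nSU S}. l \<noteq> m \<longrightarrow> (\<forall>p q. maxim_on (phi S \<pi> \<theta> \<rho> h k m) (peak S h k m) p \<longrightarrow>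
        0 < p \<longrightarrow> maxim_on (phi S \<pi> \<theta> \<rho> h k l) (peak S h k l) q \<longrightarrow>
        phi S \<pi> \<theta> \<rho> h k m p \<noteq> phi S \<pi> \<theta> \<rho> h k l q))" if km: "k \<in> {1..nCh S}" "m \<in> {1..nSU S}" for k m
    proof -
      define a where "a = act h k"
      have a: "a \<in> {0, 1}" using elim(3) km by (auto simp: a_def regular_def)
      have g: "?x (GPU k j) = gain1 h k j" "?x (GAP k j) = gain2 h k j" "0 < gain1 h k j" "0 < gain2 h k j"
        "peak S h k j = peak_power S k j a (gain1 h k j)"
        "phi S \<pi> \<theta> \<rho> h k j = util S \<pi> \<theta> \<rho> k j a (gain1 h k j) (gain2 h k j)"
        if j: "j \<in> {1..nSU S}" for j
      proof -
        show g0: "0 < gain1 h k j" "0 < gain2 h k j" using j km elim(3) by (auto simp: regular_def)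
        show "?x (GPU k j) = gain1 h k j" "?x (GAP k j) = gain2 h k j"
          using j km gain_comps_mem by (auto simp: gain1_def gain2_def)
        show "peak S h k j = peak_power S k j a (gain1 h k j)"
          using j peak_eq[OF valid km(1) _ g0(1)] by (simp add: a_def)
        show "phi S \<pi> \<theta> \<rho> h k j = util S \<pi> \<theta> \<rho> k j a (gain1 h k j) (gain2 h k j)"
          using j by (auto simp: phi_eq_util a_def)
      qed
      have best: "maxim_on (phi S \<pi> \<theta> \<rho> h k j) (peak S h k j) (best_power S \<pi> \<theta> \<rho> k j (a, gain1 h k j, gain2 h k j))"
        if j: "j \<in> {1..nSU S}" for j
        unfolding g(5,6)[OF j] by (intro best_power valid km j g)
      \<comment> \<open>All maximizers share one utility, so an arbitrary \<open>q\<close> may be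
        replaced by the selected best power.\<close>
      have bu: "phi S \<pi> \<theta> \<rho> h k j q = best_util S \<pi> \<theta> \<rho> k j a ?x"
        if j: "j \<in> {0..nSU S}" and q: "maxim_on (phi S \<pi> \<theta> \<rho> h k j) (peak S h k j) q" for j q
      proof (cases "j = 0")
        case True
        then have "q = 0" using q peak_bounds(3)[OF valid elim(3) km(1) j] by (auto simp: maxim_on_def)
        then show ?thesis using True by (simp add: best_util_def phi_def rate2_def a_def)
      next
        case False
        then have j': "j \<in> {1..nSU S}" using j by auto
        have "phi S \<pi> \<theta> \<rho> h k j q = phi S \<pi> \<theta> \<rho> h k j (best_power S \<pi> \<theta> \<rho> k j (a, gain1 h k j, gain2 h k j))"
          using q best[OF j'] unfolding maxim_on_def by (meson order_antisym)
        then show ?thesis using False by (simp add: best_util_def g[OF j'] del: restrict_apply)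
      qed
      have uniq: "p = q" if p: "maxim_on (phi S \<pi> \<theta> \<rho> h k m) (peak S h k m) p" 
        and q: "maxim_on (phi S \<pi> \<theta> \<rho> h k m) (peak S h k m) q" for p q
      proof -
        have False if p: "maxim_on (phi S \<pi> \<theta> \<rho> h k m) (peak S h k m) p" 
          and q: "maxim_on (phi S \<pi> \<theta> \<rho> h k m) (peak S h k m) q" and pq: "p < q" for p q
        proof -
          let ?b = "peak_power S k m a (gain1 h k m)"
          \<comment> \<open>Two distinct maximizers force a positive peak, without which powers
            could not be turned into fractions.\<close>
          have b: "0 < ?b" using p q pq by (auto simp: maxim_on_def g[OF km(2)])
          have eq: "scaled_util S \<pi> \<theta> \<rho> k m (a, gain1 h k m, gain2 h k m) = 
              (\<lambda>t. util S \<pi> \<theta> \<rho> k m a (gain1 h k m) (gain2 h k m) (t * ?b))"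
            using g[OF km(2)] by (auto simp: scaled_util_def)
          have "maxim_on (scaled_util S \<pi> \<theta> \<rho> k m (a, gain1 h k m, gain2 h k m)) 1 (p / ?b)"
            "maxim_on (scaled_util S \<pi> \<theta> \<rho> k m (a, gain1 h k m, gain2 h k m)) 1 (q / ?b)"
            unfolding eq using p q b by (auto intro!: maxim_on_scale(2) simp: g[OF km(2)])
          moreover have "p / ?b < q / ?b" using pq b by (simp add: divide_strict_right_mono)
          ultimately have "?x \<in> power_tie S \<pi> \<theta> \<rho> k m a"
            unfolding power_tie_def using xs b g[OF km(2)] by (auto simp del: restrict_apply)
          then show False using elim(1) a km by blast
        qed
        from this[OF p q] this[OF q p] show ?thesis by (cases p q rule: linorder_cases) auto
      qed
      have "phi S \<pi> \<theta> \<rho> h k m p \<noteq> phi S \<pi> \<theta> \<rho> h k l q"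
        if l: "l \<in> {0..nSU S}" "l \<noteq> m" and p: "maxim_on (phi S \<pi> \<theta> \<rho> h k m) (peak S h k m) p" "0 < p"
          and q: "maxim_on (phi S \<pi> \<theta> \<rho> h k l) (peak S h k l) q" for l p q
      proof
        assume "phi S \<pi> \<theta> \<rho> h k m p = phi S \<pi> \<theta> \<rho> h k l q"
        then have "best_util S \<pi> \<theta> \<rho> k m a ?x = best_util S \<pi> \<theta> \<rho> k l a ?x"
          using bu[OF _ p(1)] bu[OF l(1) q] km by auto
        moreover have "p = best_power S \<pi> \<theta> \<rho> k m (a, gain1 h k m, gain2 h k m)"
          by (rule uniq[OF p(1) best[OF km(2)]])
        ultimately have "?x \<in> user_tie S \<pi> \<theta> \<rho> k m l a"
          unfolding user_tie_def using xs p(2) g[OF km(2)] by (auto simp del: restrict_apply)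
        then show False using elim(2) a km l by blast
      qed
      with uniq show ?thesis by blast
    qed
    then show ?case unfolding no_ties_def by blast
  qed
qed

end

section \<open>The allocation rule maximizes the Lagrangian\<close>

lemma maxim_on_iff: "maxim_on f b p \<longleftrightarrow> is_arg_max f (\<lambda>x. 0 \<le> x \<and> x \<le> b) p"
  by (auto simp: maxim_on_def is_arg_max_linorder)

lemma phi_zero: "phi S \<pi> \<theta> \<rho> h k m 0 = \<rho> k * act h k * rate1 (gam S k) 0"
  by (simp add: phi_def rate2_def)

lemma power_rule_imp_maxim_on:
  assumes v: "valid_params S" "regular S h" "k \<in> {1..nCh S}" "m \<in> {0..nSU S}"
    and p: "power_rule S \<pi> \<theta> \<rho> h k m p"
  shows "maxim_on (phi S \<pi> \<theta> \<rho> h k m) (peak S h k m) p"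
  using p projected_argmax_quasiconcave[OF continuous_on_phi[OF v] _ peak_bounds(1)[OF v]]
  by (auto simp: power_rule_def maxim_on_iff split: if_splits)

lemma power_rule_exists:
  assumes v: "valid_params S" "regular S h" "k \<in> {1..nCh S}" "m \<in> {0..nSU S}"
  shows "\<exists>p. power_rule S \<pi> \<theta> \<rho> h k m p"
proof -
  have "continuous_on {0..peak S h k m} (phi S \<pi> \<theta> \<rho> h k m)"
    using continuous_on_phi[OF v] by (rule continuous_on_subset) auto
  then have "\<exists>p. is_arg_max (phi S \<pi> \<theta> \<rho> h k m) (\<lambda>x. 0 \<le> x \<and> x \<le> peak S h k m) p"
    using continuous_attains_sup[of "{0..peak S h k m}" "phi S \<pi> \<theta> \<rho> h k m"] peak_bounds(1)[OF v]
    by (auto simp: is_arg_max_linorder)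
  then show ?thesis unfolding power_rule_def projected_argmax_def by auto
qed

lemma maxim_on_phi_unique:
  assumes v: "valid_params S" "regular S h" "k \<in> {1..nCh S}" "m \<in> {0..nSU S}"
    and "no_ties S \<pi> \<theta> \<rho> h"
    and "maxim_on (phi S \<pi> \<theta> \<rho> h k m) (peak S h k m) p" "maxim_on (phi S \<pi> \<theta> \<rho> h k m) (peak S h k m) q"
  shows "p = q"
proof (cases "m = 0")
  case True
  then show ?thesis using assms peak_bounds(3)[OF v] by (auto simp: maxim_on_def)
next
  case False
  then show ?thesis using assms by (fastforce simp: no_ties_def)
qed

text \<open>\<open>maxim_on\<close> stands in for \<open>power_rule\<close>: both determine the same
  power almost surely, and it avoids the case distinction on quasiconcavity.\<close>

definition rule_at ::
  "params \<Rightarrow> (nat \<Rightarrow> real) \<Rightarrow> (nat \<Rightarrow> real) \<Rightarrow> (nat \<Rightarrow> real) \<Rightarrow> csi \<Rightarrow>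
     (nat \<Rightarrow> nat \<Rightarrow> real) \<Rightarrow> (nat \<Rightarrow> nat \<Rightarrow> real) \<Rightarrow> bool" where
  "rule_at S \<pi> \<theta> \<rho> h w p \<longleftrightarrow> (\<forall>k\<in>{1..nCh S}. \<forall>m\<in>{0..nSU S}.
     maxim_on (phi S \<pi> \<theta> \<rho> h k m) (peak S h k m) (p k m) \<and> w k m = schedule_rule S \<pi> \<theta> \<rho> h p k m)"

text \<open>A user assigned zero power yields the same utility as the virtual user, so the best choice
  can be unique only up to the user to whom the unused channel is assigned.\<close>

definition winner ::
  "params \<Rightarrow> (nat \<Rightarrow> real) \<Rightarrow> (nat \<Rightarrow> real) \<Rightarrow> (nat \<Rightarrow> real) \<Rightarrow> csi \<Rightarrow> nat \<Rightarrow>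
     (nat \<Rightarrow> real) \<Rightarrow> (nat \<Rightarrow> real) \<Rightarrow> nat \<Rightarrow> bool" where
  "winner S \<pi> \<theta> \<rho> h k w p ms \<longleftrightarrow> ms \<in> {0..nSU S} \<and>
     (\<forall>m\<in>{0..nSU S}. w m = of_bool (m = ms) \<and> p m \<in> {0..peak S h k m} \<and>
        (\<forall>q\<in>{0..peak S h k m}. phi S \<pi> \<theta> \<rho> h k m q \<le> phi S \<pi> \<theta> \<rho> h k ms (p ms) \<and>
           (phi S \<pi> \<theta> \<rho> h k m q = phi S \<pi> \<theta> \<rho> h k ms (p ms) \<longrightarrow>
              m = ms \<and> q = p ms \<or> q = 0 \<and> p ms = 0)))"

text \<open>A positive power at the top rules out ties, so the first indicator of the schedule
  selects one user. Otherwise the virtual user is among the maximizers too, and the second indicator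
  leaves only that one.\<close>

lemma rule_at_winner:
  assumes v: "valid_params S" "regular S h" and nt: "no_ties S \<pi> \<theta> \<rho> h"
    and r: "rule_at S \<pi> \<theta> \<rho> h w p" and k: "k \<in> {1..nCh S}"
  obtains ms where "winner S \<pi> \<theta> \<rho> h k (w k) (p k) ms"
proof -
  let ?f = "\<lambda>l. phi S \<pi> \<theta> \<rho> h k l (p k l)" and ?I = "{0..nSU S}"
  have mx: "maxim_on (phi S \<pi> \<theta> \<rho> h k m) (peak S h k m) (p k m)" if "m \<in> ?I" for m
    using r k that by (auto simp: rule_at_def)
  have w: "w k m = of_bool ((\<forall>l\<in>?I. ?f l \<le> ?f m) \<and> (0 < p k m \<or> m = 0))" if "m \<in> ?I" for m
    using r k that by (auto simp: rule_at_def schedule_rule_def is_arg_max_linorder)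
  have p0: "p k 0 = 0" using mx[of 0] peak_bounds(3)[OF v k, of 0] by (auto simp: maxim_on_def)
  obtain l where l: "l \<in> ?I" "\<forall>j\<in>?I. ?f j \<le> ?f l"
  proof -
    have "Max (?f ` ?I) \<in> ?f ` ?I" by (intro Max_in) auto
    then obtain l where l: "Max (?f ` ?I) = ?f l" "l \<in> ?I" by (rule imageE)
    have "\<forall>j\<in>?I. ?f j \<le> Max (?f ` ?I)" by (intro ballI Max_ge) auto
    with l show ?thesis by (intro that[of l]) simp_all
  qed
  \<comment> \<open>\<open>no_ties\<close> speaks of actual users; a positive power is enough here
    because the virtual user has power 0.\<close>
  have strict: "?f m \<noteq> ?f j" if "m \<in> ?I" "j \<in> ?I" "0 < p k m" "m \<noteq> j" for m j
    using nt k that mx[OF that(1)] mx[OF that(2)] p0 unfolding no_ties_def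
    by (cases "m = 0") fastforce+
  \<comment> \<open>If the maximizing user \<open>l\<close> has zero power, the virtual user attains
    the same utility by \<open>phi_zero\<close> and receives the channel.\<close>
  define ms where "ms = (if 0 < p k l then l else 0)"
  have nn: "0 \<le> p k m" if "m \<in> ?I" for m using mx[OF that] by (simp add: maxim_on_def)
  have fms: "?f ms = ?f l" and ms: "ms \<in> ?I" "0 < p k ms \<or> ms = 0"
    using nn[OF l(1)] l(1) p0 by (auto simp: ms_def phi_zero)
  have best: "?f j \<le> ?f ms" if "j \<in> ?I" for j using l(2) that fms by simp
  have "winner S \<pi> \<theta> \<rho> h k (w k) (p k) ms"
    unfolding winner_def
  proof (intro conjI ballI ms impI)
    fix m assume m: "m \<in> ?I"
    show "p k m \<in> {0..peak S h k m}" using mx[OF m] by (simp add: maxim_on_def)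
    show "w k m = of_bool (m = ms)"
    proof (cases "m = ms")
      case True
      then show ?thesis using w[OF m] best ms by auto
    next
      case False
      have "\<not> ((\<forall>l\<in>?I. ?f l \<le> ?f m) \<and> (0 < p k m \<or> m = 0))"
      proof
        assume *: "(\<forall>l\<in>?I. ?f l \<le> ?f m) \<and> (0 < p k m \<or> m = 0)"
        then have "?f m = ?f ms" using ms(1) best[OF m] by (auto intro: antisym)
        then show False using strict[OF m ms(1)] strict[OF ms(1) m] * ms(2) False by auto
      qed
      then show ?thesis using w[OF m] False by simp
    qed
    fix q assume q: "q \<in> {0..peak S h k m}"
    have qm: "phi S \<pi> \<theta> \<rho> h k m q \<le> ?f m" using mx[OF m] q by (auto simp: maxim_on_def)
    then show "phi S \<pi> \<theta> \<rho> h k m q \<le> ?f ms" using best[OF m] by simp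
    assume eq: "phi S \<pi> \<theta> \<rho> h k m q = ?f ms"
    then have "maxim_on (phi S \<pi> \<theta> \<rho> h k m) (peak S h k m) q" and fm: "?f m = ?f ms"
      using mx[OF m] q qm best[OF m] by (auto simp: maxim_on_def)
    then have qp: "q = p k m" using maxim_on_phi_unique[OF v k m nt] mx[OF m] by blast
    show "m = ms \<and> q = p k ms \<or> q = 0 \<and> p k ms = 0"
    proof (cases "m = ms")
      case False
      then have "\<not> 0 < p k m" "\<not> 0 < p k ms" using strict[OF m ms(1)] strict[OF ms(1) m] fm by auto
      then show ?thesis using qp nn[OF m] nn[OF ms(1)] by simp
    qed (use qp in simp)
  qed
  then show ?thesis by (rule that)
qed

lemma ex_selected:
  fixes w :: "nat \<Rightarrow> real"
  assumes w: "\<And>m. m \<in> {0..n} \<Longrightarrow> w m \<in> {0, 1}" and s: "(\<Sum>m=0..n. w m) = 1"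
  obtains ms where "ms \<in> {0..n}" "\<And>m. m \<in> {0..n} \<Longrightarrow> w m = of_bool (m = ms)"
proof -
  let ?A = "{m \<in> {0..n}. w m = 1}"
  have "(\<Sum>m=0..n. w m) = (\<Sum>m=0..n. of_bool (w m = 1))"
    using w by (intro sum.cong) auto
  also have "\<dots> = real (card ?A)" by (simp add: sum.If_cases of_bool_def Int_def)
  finally have "card ?A = 1" using s by simp
  then obtain ms where ms: "?A = {ms}" by (auto simp: card_1_singleton_iff)
  show ?thesis
  proof
    show "ms \<in> {0..n}" using ms by auto
    show "w m = of_bool (m = ms)" if "m \<in> {0..n}" for m using w[OF that] ms that by auto
  qed
qed

lemma sum_selected:
  fixes w :: "nat \<Rightarrow> real"
  assumes "ms \<in> {0..n}" "\<And>m. m \<in> {0..n} \<Longrightarrow> w m = of_bool (m = ms)"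
  shows "(\<Sum>m=0..n. w m * f m) = f ms"
proof -
  have "(\<Sum>m=0..n. w m * f m) = (\<Sum>m=0..n. if m = ms then f m else 0)"
    using assms by (intro sum.cong) auto
  then show ?thesis using assms by simp
qed

lemma phi_affine:
  "phi S (\<lambda>m. (1 - t) * \<pi> m + t * \<pi>' m) (\<lambda>k. (1 - t) * \<theta> k + t * \<theta>' k) (\<lambda>k. (1 - t) * \<rho> k + t * \<rho>' k) h k m p
   = (1 - t) * phi S \<pi> \<theta> \<rho> h k m p + t * phi S \<pi>' \<theta>' \<rho>' h k m p"
  unfolding phi_def by (simp add: algebra_simps)

context csi_law_setting
begin

definition feasible_at :: "csi \<Rightarrow> (nat \<Rightarrow> nat \<Rightarrow> real) \<Rightarrow> (nat \<Rightarrow> nat \<Rightarrow> real) \<Rightarrow> bool" where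
  "feasible_at h w p \<longleftrightarrow> (\<forall>k\<in>{1..nCh S}.
        (\<forall>m\<in>{0..nSU S}. w k m \<in> {0, 1} \<and> 0 \<le> p k m \<and> p k m \<le> peak S h k m) \<and>
        (\<Sum>m=0..nSU S. w k m) = 1)"

lemma short_term_iff:
  "short_term S \<mu> w p \<longleftrightarrow> measurable_policy S w \<and> measurable_policy S p \<and>
     (AE h in \<mu>. feasible_at h (w h) (p h))"
  by (simp add: short_term_def feasible_at_def)

definition follows :: "(nat \<Rightarrow> real) \<Rightarrow> (nat \<Rightarrow> real) \<Rightarrow> (nat \<Rightarrow> real) \<Rightarrow> policy \<Rightarrow> policy \<Rightarrow> bool" where
  "follows \<pi> \<theta> \<rho> w p \<longleftrightarrow> measurable_policy S w \<and> measurable_policy S p \<and>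
     (AE h in \<mu>. rule_at S \<pi> \<theta> \<rho> h (w h) (p h))"

lemma follows_winner:
  assumes "follows \<pi> \<theta> \<rho> w p"
  shows "AE h in \<mu>. regular S h \<and> (\<forall>k\<in>{1..nCh S}. \<exists>ms. winner S \<pi> \<theta> \<rho> h k (w h k) (p h k) ms)"
proof -
  have "AE h in \<mu>. rule_at S \<pi> \<theta> \<rho> h (w h) (p h)" using assms by (simp add: follows_def)
  with AE_regular AE_no_ties[of \<pi> \<theta> \<rho>] show ?thesis
  proof eventually_elim
    case (elim h)
    then show ?case using rule_at_winner[OF valid elim(1,2,3)] by blast
  qed
qed

lemma follows_short_term:
  assumes f: "follows \<pi> \<theta> \<rho> w p"
  shows "short_term S \<mu> w p"
proof -
  have "AE h in \<mu>. feasible_at h (w h) (p h)" using follows_winner[OF f]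
  proof eventually_elim
    case (elim h)
    show ?case unfolding feasible_at_def
    proof (intro ballI)
      fix k assume "k \<in> {1..nCh S}"
      then obtain ms where W: "winner S \<pi> \<theta> \<rho> h k (w h k) (p h k) ms" using elim by blast
      then have "(\<Sum>m=0..nSU S. w h k m * 1) = 1"
        by (intro sum_selected) (auto simp: winner_def)
      then show "(\<forall>m\<in>{0..nSU S}. w h k m \<in> {0, 1} \<and> 0 \<le> p h k m \<and> p h k m \<le> peak S h k m) \<and>
        (\<Sum>m=0..nSU S. w h k m) = 1" using W by (auto simp: winner_def)
    qed
  qed
  then show ?thesis using f by (simp add: short_term_iff follows_def)
qed

definition utility :: "(nat \<Rightarrow> real) \<Rightarrow> (nat \<Rightarrow> real) \<Rightarrow> (nat \<Rightarrow> real) \<Rightarrow> csi \<Rightarrow>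
    (nat \<Rightarrow> nat \<Rightarrow> real) \<Rightarrow> (nat \<Rightarrow> nat \<Rightarrow> real) \<Rightarrow> real" where
  "utility \<pi> \<theta> \<rho> h w p = (\<Sum>k=1..nCh S. \<Sum>m=0..nSU S. w k m * phi S \<pi> \<theta> \<rho> h k m (p k m))"

text \<open>A sum of channelwise inequalities is an equality only if each of them is. On a channel,
  \<open>winner\<close> then fixes user and power, or both powers are zero; in either case the
  products of schedule and power agree.\<close>

lemma utility_le:
  assumes W: "\<And>k. k \<in> {1..nCh S} \<Longrightarrow> \<exists>ms. winner S \<pi> \<theta> \<rho> h k (w k) (p k) ms"
    and F: "feasible_at h w' p'"
  shows "utility \<pi> \<theta> \<rho> h w' p' \<le> utility \<pi> \<theta> \<rho> h w p"
    and "utility \<pi> \<theta> \<rho> h w' p' = utility \<pi> \<theta> \<rho> h w p \<Longrightarrow> k \<in> {1..nCh S} \<Longrightarrow> m \<in> {0..nSU S} \<Longrightarrow>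
      w' k m * p' k m = w k m * p k m"
proof -
  let ?u = "\<lambda>w p k. \<Sum>m=0..nSU S. w k m * phi S \<pi> \<theta> \<rho> h k m (p k m)"
  have main: "?u w' p' k \<le> ?u w p k \<and> (?u w' p' k = ?u w p k \<longrightarrow>
     (\<forall>m\<in>{0..nSU S}. w' k m * p' k m = w k m * p k m))" if k: "k \<in> {1..nCh S}" for k
  proof -
    obtain ms where W: "winner S \<pi> \<theta> \<rho> h k (w k) (p k) ms" using W k by blast
    have u: "?u w p k = phi S \<pi> \<theta> \<rho> h k ms (p k ms)"
      by (rule sum_selected) (use W in \<open>auto simp: winner_def\<close>)
    obtain m' where m': "m' \<in> {0..nSU S}" "\<And>m. m \<in> {0..nSU S} \<Longrightarrow> w' k m = of_bool (m = m')"
      by (rule ex_selected[of "nSU S" "w' k"]) (use F k in \<open>auto simp: feasible_at_def\<close>)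
    have u': "?u w' p' k = phi S \<pi> \<theta> \<rho> h k m' (p' k m')" by (rule sum_selected[OF m'])
    have q: "p' k m' \<in> {0..peak S h k m'}" using F k m'(1) by (auto simp: feasible_at_def)
    show ?thesis
    proof (intro conjI impI ballI)
      show "?u w' p' k \<le> ?u w p k" unfolding u u' using W m'(1) q unfolding winner_def by blast
      fix m assume eq: "?u w' p' k = ?u w p k" and m: "m \<in> {0..nSU S}"
      have "m' = ms \<and> p' k m' = p k ms \<or> p' k m' = 0 \<and> p k ms = 0"
        using eq W m'(1) q unfolding u u' winner_def by blast
      moreover have "w k m = of_bool (m = ms)" using W m by (auto simp: winner_def)
      ultimately show "w' k m * p' k m = w k m * p k m" using m'(2)[OF m] by auto
    qed
  qed
  then show "utility \<pi> \<theta> \<rho> h w' p' \<le> utility \<pi> \<theta> \<rho> h w p"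
    unfolding utility_def by (intro sum_mono[of "{1..nCh S}"] conjunct1[OF main])
  assume "utility \<pi> \<theta> \<rho> h w' p' = utility \<pi> \<theta> \<rho> h w p" and km: "k \<in> {1..nCh S}" "m \<in> {0..nSU S}"
  then have "(\<Sum>k=1..nCh S. ?u w p k - ?u w' p' k) = 0" by (simp add: utility_def sum_subtractf)
  then have "?u w p k - ?u w' p' k = 0"
    using km(1) main by (subst (asm) sum_nonneg_eq_0_iff) auto
  then show "w' k m * p' k m = w k m * p k m" using main[OF km(1)] km(2) by auto
qed


lemma borel_law: "borel_measurable \<mu> = borel_measurable (csi_space S)"
  by (rule measurable_cong_sets[OF sets_law refl])

lemma measurable_policyD:
  "measurable_policy S f \<Longrightarrow> k \<in> {1..nCh S} \<Longrightarrow> m \<in> {0..nSU S} \<Longrightarrow> (\<lambda>h. f h k m) \<in> borel_measurable \<mu>"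
  by (auto simp: measurable_policy_def borel_law)

lemma measurable_phi:
  assumes k: "k \<in> {1..nCh S}" "m \<in> {0..nSU S}" and [measurable]: "P \<in> borel_measurable \<mu>"
  shows "(\<lambda>h. phi S \<pi> \<theta> \<rho> h k m (P h)) \<in> borel_measurable \<mu>"
proof -
  note [measurable] = measurable_act[OF k(1)] measurable_gain1[OF k] measurable_gain2[OF k]
  show ?thesis unfolding phi_def rate1_def rate2_def by measurable
qed

section \<open>A measurable policy that follows the rule\<close>

definition best_policy :: "(nat \<Rightarrow> real) \<Rightarrow> (nat \<Rightarrow> real) \<Rightarrow> (nat \<Rightarrow> real) \<Rightarrow> policy" where
  "best_policy \<pi> \<theta> \<rho> h k m = (if m = 0 then 0
     else best_power S \<pi> \<theta> \<rho> k m (act h k, gain1 h k m, gain2 h k m))"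

definition best_schedule :: "(nat \<Rightarrow> real) \<Rightarrow> (nat \<Rightarrow> real) \<Rightarrow> (nat \<Rightarrow> real) \<Rightarrow> policy" where
  "best_schedule \<pi> \<theta> \<rho> h = schedule_rule S \<pi> \<theta> \<rho> h (best_policy \<pi> \<theta> \<rho> h)"

lemma measurable_best_policy:
  assumes k: "k \<in> {1..nCh S}" "m \<in> {0..nSU S}"
  shows "(\<lambda>h. best_policy \<pi> \<theta> \<rho> h k m) \<in> borel_measurable \<mu>"
proof (cases "m = 0")
  case False
  then have m: "m \<in> {1..nSU S}" using k by auto
  note [measurable] = measurable_act[OF k(1)] measurable_gain1[OF k] measurable_gain2[OF k]
    measurable_best_power[OF valid k(1) m]
  have "(\<lambda>h. best_power S \<pi> \<theta> \<rho> k m (act h k, gain1 h k m, gain2 h k m)) \<in> borel_measurable \<mu>"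
    by measurable
  then show ?thesis using False by (simp add: best_policy_def)
qed (simp add: best_policy_def)

lemma measurable_best_schedule:
  assumes k: "k \<in> {1..nCh S}" "m \<in> {0..nSU S}"
  shows "(\<lambda>h. best_schedule \<pi> \<theta> \<rho> h k m) \<in> borel_measurable \<mu>"
proof -
  have ph: "(\<lambda>h. phi S \<pi> \<theta> \<rho> h k l (best_policy \<pi> \<theta> \<rho> h k l)) \<in> borel_measurable \<mu>" if "l \<in> {0..nSU S}" for l
    by (rule measurable_phi[OF k(1) that measurable_best_policy[OF k(1) that]])
  have "Measurable.pred \<mu> (\<lambda>h. \<forall>l\<in>{0..nSU S}. phi S \<pi> \<theta> \<rho> h k l (best_policy \<pi> \<theta> \<rho> h k l)
      \<le> phi S \<pi> \<theta> \<rho> h k m (best_policy \<pi> \<theta> \<rho> h k m))"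
  proof (rule pred_intros_finite(3))
    fix l assume l: "l \<in> {0..nSU S}"
    show "Measurable.pred \<mu> (\<lambda>h. phi S \<pi> \<theta> \<rho> h k l (best_policy \<pi> \<theta> \<rho> h k l)
      \<le> phi S \<pi> \<theta> \<rho> h k m (best_policy \<pi> \<theta> \<rho> h k m))"
      by (rule pred_le_borel[OF ph[OF l] ph[OF k(2)]])
  qed simp
  then have [measurable]: "Measurable.pred \<mu> (\<lambda>h. is_arg_max (\<lambda>l. phi S \<pi> \<theta> \<rho> h k l (best_policy \<pi> \<theta> \<rho> h k l)) (\<lambda>l. l \<in> {0..nSU S}) m)"
    by (simp only: is_arg_max_mem[OF k(2)])
  note [measurable] = measurable_best_policy[OF k]
  show ?thesis unfolding best_schedule_def schedule_rule_def by measurable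
qed

lemma maxim_on_best_policy:
  assumes h: "regular S h" and k: "k \<in> {1..nCh S}" "m \<in> {0..nSU S}"
  shows "maxim_on (phi S \<pi> \<theta> \<rho> h k m) (peak S h k m) (best_policy \<pi> \<theta> \<rho> h k m)"
proof (cases "m = 0")
  case True
  then show ?thesis using peak_bounds(3)[OF valid h k] by (simp add: maxim_on_def best_policy_def)
next
  case False
  then have m: "m \<in> {1..nSU S}" using k by auto
  then have g: "0 < gain1 h k m" "0 < gain2 h k m" using h k by (auto simp: regular_def)
  have "phi S \<pi> \<theta> \<rho> h k m = util S \<pi> \<theta> \<rho> k m (act h k) (gain1 h k m) (gain2 h k m)"
    using False by (auto simp: phi_eq_util)
  then show ?thesis using best_power[OF valid k(1) m g] peak_eq[OF valid k(1) _ g(1)] False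
    by (simp add: best_policy_def)
qed

lemma follows_best: "follows \<pi> \<theta> \<rho> (best_schedule \<pi> \<theta> \<rho>) (best_policy \<pi> \<theta> \<rho>)"
proof -
  have "AE h in \<mu>. rule_at S \<pi> \<theta> \<rho> h (best_schedule \<pi> \<theta> \<rho> h) (best_policy \<pi> \<theta> \<rho> h)"
    using AE_regular by eventually_elim (auto simp: rule_at_def maxim_on_best_policy best_schedule_def)
  then show ?thesis
    using measurable_best_schedule measurable_best_policy
    by (simp add: follows_def measurable_policy_def borel_law)
qed

section \<open>Integrability and the Lagrangian as an expected utility\<close>

text \<open>The bound holds for every feasible power, hence for all policies at once: it gives
  integrability and later dominates the convergence in the multipliers. Its integrability rests on
  \<open>finite_expectations\<close>.\<close>

definition phi_bound :: "(nat \<Rightarrow> real) \<Rightarrow> (nat \<Rightarrow> real) \<Rightarrow> (nat \<Rightarrow> real) \<Rightarrow> csi \<Rightarrow> nat \<Rightarrow> nat \<Rightarrow> real" where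
  "phi_bound \<pi> \<theta> \<rho> h k m = \<bar>beta S m\<bar> * rate2 m (gain2 h k m * peak S h k m) + \<bar>\<pi> m\<bar> * \<bar>ampP S k m\<bar>
     + \<bar>\<theta> k\<bar> * (act h k * gain1 h k m * peak S h k m) + \<bar>\<rho> k\<bar> * rate1 (gam S k) 0"

lemma finite_expD:
  assumes k: "k \<in> {1..nCh S}" "m \<in> {0..nSU S}"
  shows "integrable \<mu> (\<lambda>h. rate2 m (gain2 h k m * peak S h k m))"
    and "integrable \<mu> (\<lambda>h. act h k * gain1 h k m * peak S h k m)"
  using finite_exp k by (cases "m = 0"; auto simp: finite_expectations_def rate2_def gain1_def)+

lemma integrable_phi_bound:
  assumes k: "k \<in> {1..nCh S}" "m \<in> {0..nSU S}"
  shows "integrable \<mu> (\<lambda>h. phi_bound \<pi> \<theta> \<rho> h k m)"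
  unfolding phi_bound_def
  by (intro Bochner_Integration.integrable_add integrable_mult_right finite_expD[OF k]) auto

lemma term_bounds:
  assumes h: "regular S h" and k: "k \<in> {1..nCh S}" "m \<in> {0..nSU S}" and p: "0 \<le> p" "p \<le> peak S h k m"
  shows "0 \<le> rate2 m (gain2 h k m * p)" "rate2 m (gain2 h k m * p) \<le> rate2 m (gain2 h k m * peak S h k m)"
    and "p \<le> \<bar>ampP S k m\<bar>"
    and "0 \<le> act h k * gain1 h k m * p" "act h k * gain1 h k m * p \<le> act h k * gain1 h k m * peak S h k m"
    and "0 \<le> act h k * rate1 (gam S k) (gain1 h k m * p)" "act h k * rate1 (gam S k) (gain1 h k m * p) \<le> rate1 (gam S k) 0"
    and "0 \<le> rate1 (gam S k) (gain1 h k m * p)" "rate1 (gam S k) (gain1 h k m * p) \<le> rate1 (gam S k) 0"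
proof -
  have g: "0 \<le> gain1 h k m" "0 \<le> gain2 h k m" and a: "act h k = 0 \<or> act h k = 1"
  proof -
    show "0 \<le> gain1 h k m" "0 \<le> gain2 h k m"
      using h k by (cases "m = 0"; force simp: regular_def gain1_def gain2_def intro: less_imp_le)+
    show "act h k = 0 \<or> act h k = 1" using h k by (auto simp: regular_def)
  qed
  have G: "0 < gam S k" using valid k by (auto simp: valid_params_def)
  have gp: "0 \<le> gain2 h k m * p" "gain2 h k m * p \<le> gain2 h k m * peak S h k m" "0 \<le> gain1 h k m * p"
    using g p by (auto intro: mult_left_mono)
  show "0 \<le> rate2 m (gain2 h k m * p)" "rate2 m (gain2 h k m * p) \<le> rate2 m (gain2 h k m * peak S h k m)"
    using gp by (auto simp: rate2_def)
  show "p \<le> \<bar>ampP S k m\<bar>" using p peak_bounds(2,3)[OF valid h k] by (cases "m = 0") auto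
  show "0 \<le> act h k * gain1 h k m * p" "act h k * gain1 h k m * p \<le> act h k * gain1 h k m * peak S h k m"
    using g p a by (auto intro: mult_left_mono)
  show r: "0 \<le> rate1 (gam S k) (gain1 h k m * p)" "rate1 (gam S k) (gain1 h k m * p) \<le> rate1 (gam S k) 0"
    by (auto intro!: rate1_bounds gp(3) G)
  have "0 \<le> rate1 (gam S k) 0" using G by (auto simp: rate1_def)
  then show "0 \<le> act h k * rate1 (gam S k) (gain1 h k m * p)" "act h k * rate1 (gam S k) (gain1 h k m * p) \<le> rate1 (gam S k) 0"
    using a r by auto
qed

lemma abs_phi_le:
  assumes h: "regular S h" and k: "k \<in> {1..nCh S}" "m \<in> {0..nSU S}" and p: "0 \<le> p" "p \<le> peak S h k m"
  shows "\<bar>phi S \<pi> \<theta> \<rho> h k m p\<bar> \<le> phi_bound \<pi> \<theta> \<rho> h k m"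
proof -
  note b = term_bounds[OF assms]
  have tri: "\<bar>x - y - u + v\<bar> \<le> \<bar>x\<bar> + \<bar>y\<bar> + \<bar>u\<bar> + \<bar>v\<bar>" for x y u v :: real by linarith
  have *: "\<bar>c * x\<bar> \<le> \<bar>c\<bar> * y" if "0 \<le> x" "x \<le> y" for c x y :: real
    using that by (auto simp: abs_mult intro: mult_left_mono)
  have "phi S \<pi> \<theta> \<rho> h k m p = beta S m * rate2 m (gain2 h k m * p) - \<pi> m * p
     - \<theta> k * (act h k * gain1 h k m * p) + \<rho> k * (act h k * rate1 (gam S k) (gain1 h k m * p))"
    by (simp add: phi_def mult.assoc)
  also have "\<bar>\<dots>\<bar> \<le> phi_bound \<pi> \<theta> \<rho> h k m"
    unfolding phi_bound_def
    by (intro order_trans[OF tri] add_mono *[OF b(1,2)] *[OF p(1) b(3)] *[OF b(4,5)] *[OF b(6,7)])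
  finally show ?thesis .
qed

text \<open>The part of the integrand of the Lagrangian that does not involve the policy.\<close>

definition offset :: "(nat \<Rightarrow> real) \<Rightarrow> (nat \<Rightarrow> real) \<Rightarrow> (nat \<Rightarrow> real) \<Rightarrow> csi \<Rightarrow> real" where
  "offset \<pi> \<theta> \<rho> h = (\<Sum>m=1..nSU S. \<pi> m * limP S m) + (\<Sum>k=1..nCh S. \<theta> k * act h k * limI S k)
     - (\<Sum>k=1..nCh S. \<rho> k * act h k * limR S k)"

lemma integrable_act: "k \<in> {1..nCh S} \<Longrightarrow> integrable \<mu> (\<lambda>h. act h k)"
  using AE_act by (intro integrable_const_bound[where B = 1]) (auto elim!: eventually_mono dest: bspec)

lemma integrable_offset: "integrable \<mu> (offset \<pi> \<theta> \<rho>)"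
  unfolding offset_def[abs_def]
  by (intro Bochner_Integration.integrable_add Bochner_Integration.integrable_diff Bochner_Integration.integrable_sum
      integrable_mult_left integrable_mult_right integrable_act) auto

lemma integrable_weighted_phi:
  assumes st: "short_term S \<mu> w p" and k: "k \<in> {1..nCh S}" "m \<in> {0..nSU S}"
  shows "integrable \<mu> (\<lambda>h. w h k m * phi S \<pi> \<theta> \<rho> h k m (p h k m))"
    and "AE h in \<mu>. \<bar>w h k m * phi S \<pi> \<theta> \<rho> h k m (p h k m)\<bar> \<le> phi_bound \<pi> \<theta> \<rho> h k m"
proof -
  have "AE h in \<mu>. feasible_at h (w h) (p h)" using st by (simp add: short_term_iff)
  with AE_regular show b: "AE h in \<mu>. \<bar>w h k m * phi S \<pi> \<theta> \<rho> h k m (p h k m)\<bar> \<le> phi_bound \<pi> \<theta> \<rho> h k m"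
  proof eventually_elim
    case (elim h)
    then have "w h k m = 0 \<or> w h k m = 1" "\<bar>phi S \<pi> \<theta> \<rho> h k m (p h k m)\<bar> \<le> phi_bound \<pi> \<theta> \<rho> h k m"
      using k by (auto simp: feasible_at_def intro!: abs_phi_le)
    then show ?case by auto
  qed
  have m: "measurable_policy S w" "measurable_policy S p" using st by (auto simp: short_term_def)
  note [measurable] = measurable_policyD[OF m(1) k] measurable_phi[OF k measurable_policyD[OF m(2) k]]
  from b show "integrable \<mu> (\<lambda>h. w h k m * phi S \<pi> \<theta> \<rho> h k m (p h k m))"
    by (intro Bochner_Integration.integrable_bound[OF integrable_phi_bound[OF k, of \<pi> \<theta> \<rho>]])
      (measurable, auto elim!: eventually_mono)
qed

lemma integrable_utility:
  assumes st: "short_term S \<mu> w p"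
  shows "integrable \<mu> (\<lambda>h. utility \<pi> \<theta> \<rho> h (w h) (p h))"
  unfolding utility_def by (intro Bochner_Integration.integrable_sum integrable_weighted_phi[OF st])

text \<open>Only the long-term constraints are dualized, and they are linear in the expectations.
  The Lagrangian therefore separates over states and channels.\<close>

lemma lagrangian_eq_utility:
  assumes st: "short_term S \<mu> w p"
  shows "lagrangian S \<mu> \<pi> \<theta> \<rho> w p = (\<integral>h. utility \<pi> \<theta> \<rho> h (w h) (p h) + offset \<pi> \<theta> \<rho> h \<partial>\<mu>)"
  unfolding lagrangian_def
proof (rule integral_cong_AE)
  have m: "measurable_policy S w" "measurable_policy S p" using st by (auto simp: short_term_def)
  have [measurable]: "(\<lambda>h. w h k m) \<in> borel_measurable \<mu>" "(\<lambda>h. p h k m) \<in> borel_measurable \<mu>"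
     "(\<lambda>h. gain1 h k m) \<in> borel_measurable \<mu>" "(\<lambda>h. gain2 h k m) \<in> borel_measurable \<mu>" "(\<lambda>h. act h k) \<in> borel_measurable \<mu>"
    if "m \<in> {0..nSU S}" "k \<in> {1..nCh S}" for k m
    using m that by (auto intro: measurable_policyD)
  show "(\<lambda>h. (\<Sum>m=0..nSU S. \<Sum>k=1..nCh S. beta S m * w h k m * rate2 m (gain2 h k m * p h k m))
        - (\<Sum>m=1..nSU S. \<pi> m * ((\<Sum>k=1..nCh S. w h k m * p h k m) - limP S m))
        - (\<Sum>k=1..nCh S. \<theta> k * act h k * ((\<Sum>m=0..nSU S. w h k m * gain1 h k m * p h k m) - limI S k))
        + (\<Sum>k=1..nCh S. \<rho> k * act h k * ((\<Sum>m=0..nSU S. w h k m * rate1 (gam S k) (gain1 h k m * p h k m)) - limR S k)))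
     \<in> borel_measurable \<mu>"
    unfolding rate1_def rate2_def by measurable
  show "(\<lambda>h. utility \<pi> \<theta> \<rho> h (w h) (p h) + offset \<pi> \<theta> \<rho> h) \<in> borel_measurable \<mu>"
    using integrable_utility[OF st] integrable_offset by (intro borel_measurable_add borel_measurable_integrable)
  have "AE h in \<mu>. feasible_at h (w h) (p h)" using st by (simp add: short_term_iff)
  then show "AE h in \<mu>. (\<Sum>m=0..nSU S. \<Sum>k=1..nCh S. beta S m * w h k m * rate2 m (gain2 h k m * p h k m))
        - (\<Sum>m=1..nSU S. \<pi> m * ((\<Sum>k=1..nCh S. w h k m * p h k m) - limP S m))
        - (\<Sum>k=1..nCh S. \<theta> k * act h k * ((\<Sum>m=0..nSU S. w h k m * gain1 h k m * p h k m) - limI S k))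
        + (\<Sum>k=1..nCh S. \<rho> k * act h k * ((\<Sum>m=0..nSU S. w h k m * rate1 (gam S k) (gain1 h k m * p h k m)) - limR S k))
     = utility \<pi> \<theta> \<rho> h (w h) (p h) + offset \<pi> \<theta> \<rho> h"
  proof eventually_elim
    case (elim h)
    have p0: "p h k 0 = 0" if "k \<in> {1..nCh S}" for k
      using elim that by (force simp: feasible_at_def peak_def)
    have z: "(\<Sum>k=Suc 0..nCh S. w h k 0 * p h k 0) = 0" by (intro sum.neutral) (auto simp: p0)
    \<comment> \<open>The power constraints start at user 1, the utilities at user 0. The additional
      term vanishes because the peak power of the virtual user is 0.\<close>
    have "(\<Sum>m=1..nSU S. \<pi> m * (\<Sum>k=1..nCh S. w h k m * p h k m))
        = (\<Sum>m=0..nSU S. \<pi> m * (\<Sum>k=1..nCh S. w h k m * p h k m))"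
      by (rule sum.mono_neutral_left) (auto simp: z not_le)
    also have "\<dots> = (\<Sum>k=1..nCh S. \<Sum>m=0..nSU S. \<pi> m * (w h k m * p h k m))"
      unfolding sum_distrib_left by (rule sum.swap)
    finally have P: "(\<Sum>m=1..nSU S. \<pi> m * (\<Sum>k=1..nCh S. w h k m * p h k m)) = \<dots>" .
    have R: "(\<Sum>m=0..nSU S. \<Sum>k=1..nCh S. beta S m * w h k m * rate2 m (gain2 h k m * p h k m))
      = (\<Sum>k=1..nCh S. \<Sum>m=0..nSU S. beta S m * w h k m * rate2 m (gain2 h k m * p h k m))"
      by (rule sum.swap)
    have U: "utility \<pi> \<theta> \<rho> h (w h) (p h) =
       (\<Sum>k=1..nCh S. \<Sum>m=0..nSU S. beta S m * w h k m * rate2 m (gain2 h k m * p h k m))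
       - (\<Sum>k=1..nCh S. \<Sum>m=0..nSU S. \<pi> m * (w h k m * p h k m))
       - (\<Sum>k=1..nCh S. \<theta> k * act h k * (\<Sum>m=0..nSU S. w h k m * gain1 h k m * p h k m))
       + (\<Sum>k=1..nCh S. \<rho> k * act h k * (\<Sum>m=0..nSU S. w h k m * rate1 (gam S k) (gain1 h k m * p h k m)))"
      unfolding utility_def phi_def sum_distrib_left
      by (simp add: sum_subtractf[symmetric] sum.distrib[symmetric] algebra_simps)
    show ?case unfolding U R P[symmetric] offset_def
      by (simp add: right_diff_distrib sum_subtractf algebra_simps)
  qed
qed


text \<open>The rule is at least as good in almost every state. Equal Lagrangians make the integral
  of a nonnegative difference vanish, so the difference is almost surely zero and the equality case
  of \<open>utility_le\<close> applies.\<close>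

lemma lagrangian_le:
  assumes f: "follows \<pi> \<theta> \<rho> w p" and st: "short_term S \<mu> w' p'"
  shows "lagrangian S \<mu> \<pi> \<theta> \<rho> w' p' \<le> lagrangian S \<mu> \<pi> \<theta> \<rho> w p"
    and "lagrangian S \<mu> \<pi> \<theta> \<rho> w' p' = lagrangian S \<mu> \<pi> \<theta> \<rho> w p \<Longrightarrow>
      AE h in \<mu>. \<forall>k\<in>{1..nCh S}. \<forall>m\<in>{0..nSU S}. w' h k m * p' h k m = w h k m * p h k m"
proof -
  note st0 = follows_short_term[OF f]
  let ?u = "\<lambda>w p h. utility \<pi> \<theta> \<rho> h (w h) (p h)"
  have le: "AE h in \<mu>. ?u w' p' h \<le> ?u w p h \<and>
    (?u w' p' h = ?u w p h \<longrightarrow> (\<forall>k\<in>{1..nCh S}. \<forall>m\<in>{0..nSU S}. w' h k m * p' h k m = w h k m * p h k m))"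
  proof -
    have "AE h in \<mu>. feasible_at h (w' h) (p' h)" using st by (simp add: short_term_iff)
    with follows_winner[OF f] show ?thesis
    proof eventually_elim
      case (elim h)
      then show ?case using utility_le[of \<pi> \<theta> \<rho> h "w h" "p h" "w' h" "p' h"] by blast
    qed
  qed
  note int = integrable_utility[OF st, of \<pi> \<theta> \<rho>] integrable_utility[OF st0, of \<pi> \<theta> \<rho>] integrable_offset[of \<pi> \<theta> \<rho>]
  have L: "lagrangian S \<mu> \<pi> \<theta> \<rho> w p - lagrangian S \<mu> \<pi> \<theta> \<rho> w' p' = (\<integral>h. ?u w p h - ?u w' p' h \<partial>\<mu>)"
    using int by (simp add: lagrangian_eq_utility[OF st] lagrangian_eq_utility[OF st0])
  have nn: "AE h in \<mu>. 0 \<le> ?u w p h - ?u w' p' h" using le by eventually_elim simp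
  show "lagrangian S \<mu> \<pi> \<theta> \<rho> w' p' \<le> lagrangian S \<mu> \<pi> \<theta> \<rho> w p"
    using integral_nonneg_AE[OF nn] L by simp
  assume "lagrangian S \<mu> \<pi> \<theta> \<rho> w' p' = lagrangian S \<mu> \<pi> \<theta> \<rho> w p"
  then have "(\<integral>h. ?u w p h - ?u w' p' h \<partial>\<mu>) = 0" using L by simp
  then have "AE h in \<mu>. ?u w p h - ?u w' p' h = 0"
    using integral_nonneg_eq_0_iff_AE[OF Bochner_Integration.integrable_diff[OF int(2,1)] nn] by simp
  with le show "AE h in \<mu>. \<forall>k\<in>{1..nCh S}. \<forall>m\<in>{0..nSU S}. w' h k m * p' h k m = w h k m * p h k m"
    by eventually_elim simp
qed

lemma dual_function_eq:
  assumes "follows \<pi> \<theta> \<rho> w p"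
  shows "dual_function S \<mu> \<pi> \<theta> \<rho> = ereal (lagrangian S \<mu> \<pi> \<theta> \<rho> w p)"
  unfolding dual_function_def
proof (rule antisym)
  show "(SUP (w, p)\<in>{(w, p). short_term S \<mu> w p}. ereal (lagrangian S \<mu> \<pi> \<theta> \<rho> w p)) \<le> ereal (lagrangian S \<mu> \<pi> \<theta> \<rho> w p)"
    by (rule SUP_least) (use lagrangian_le(1)[OF assms] in auto)
  show "ereal (lagrangian S \<mu> \<pi> \<theta> \<rho> w p) \<le> (SUP (w, p)\<in>{(w, p). short_term S \<mu> w p}. ereal (lagrangian S \<mu> \<pi> \<theta> \<rho> w p))"
    by (rule SUP_upper2[of "(w, p)"]) (use follows_short_term[OF assms] in auto)
qed

section \<open>Slacks of the long-term constraints\<close>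

text \<open>The slacks are the coefficients of the multipliers in the Lagrangian. Those of the PU
  constraints are weighted with the activity instead of conditioned on it; by
  \<open>active_pos\<close> this changes them only by a positive factor.\<close>

definition power_slack :: "policy \<Rightarrow> policy \<Rightarrow> nat \<Rightarrow> real" where
  "power_slack w p m = limP S m - (\<integral>h. (\<Sum>k=1..nCh S. w h k m * p h k m) \<partial>\<mu>)"

definition interference_slack :: "policy \<Rightarrow> policy \<Rightarrow> nat \<Rightarrow> real" where
  "interference_slack w p k = (\<integral>h. act h k * (limI S k - (\<Sum>m=0..nSU S. w h k m * gain1 h k m * p h k m)) \<partial>\<mu>)"

definition rate_slack :: "policy \<Rightarrow> policy \<Rightarrow> nat \<Rightarrow> real" where
  "rate_slack w p k = (\<integral>h. act h k * ((\<Sum>m=0..nSU S. w h k m * rate1 (gam S k) (gain1 h k m * p h k m)) - limR S k) \<partial>\<mu>)"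

lemma integrable_weighted:
  assumes st: "short_term S \<mu> w p" and k: "k \<in> {1..nCh S}" "m \<in> {0..nSU S}"
  shows "integrable \<mu> (\<lambda>h. beta S m * w h k m * rate2 m (gain2 h k m * p h k m))"
    and "integrable \<mu> (\<lambda>h. w h k m * p h k m)"
    and "integrable \<mu> (\<lambda>h. act h k * (w h k m * gain1 h k m * p h k m))"
    and "integrable \<mu> (\<lambda>h. act h k * (w h k m * rate1 (gam S k) (gain1 h k m * p h k m)))"
proof -
  have m: "measurable_policy S w" "measurable_policy S p" using st by (auto simp: short_term_def)
  note [measurable] = measurable_policyD[OF m(1) k] measurable_policyD[OF m(2) k]
    measurable_act[OF k(1)] measurable_gain1[OF k] measurable_gain2[OF k]
  have meas: "(\<lambda>h. rate2 m (gain2 h k m * p h k m)) \<in> borel_measurable \<mu>"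
    "(\<lambda>h. act h k * gain1 h k m * p h k m) \<in> borel_measurable \<mu>"
    "(\<lambda>h. act h k * rate1 (gam S k) (gain1 h k m * p h k m)) \<in> borel_measurable \<mu>"
    unfolding rate1_def rate2_def by measurable
  have feas: "AE h in \<mu>. feasible_at h (w h) (p h)" using st by (simp add: short_term_iff)
  \<comment> \<open>All four claims have this form: a binary weight times a nonnegative quantity
    bounded by an integrable one.\<close>
  have dom: "integrable \<mu> (\<lambda>h. w h k m * f h)"
    if fm[measurable]: "f \<in> borel_measurable \<mu>" and g: "integrable \<mu> g"
      and fg: "\<And>h. regular S h \<Longrightarrow> 0 \<le> p h k m \<Longrightarrow> p h k m \<le> peak S h k m \<Longrightarrow> 0 \<le> f h \<and> f h \<le> g h"
    for f g :: "csi \<Rightarrow> real"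
  proof (rule Bochner_Integration.integrable_bound[OF g])
    show "(\<lambda>h. w h k m * f h) \<in> borel_measurable \<mu>" by measurable
    show "AE h in \<mu>. norm (w h k m * f h) \<le> norm (g h)"
      using AE_regular feas
    proof eventually_elim
      case (elim h)
      then have "w h k m = 0 \<or> w h k m = 1" "0 \<le> f h \<and> f h \<le> g h"
        using k fg[of h] by (auto simp: feasible_at_def)
      then show ?case by auto
    qed
  qed
  note tb = term_bounds[OF _ k]
  have "integrable \<mu> (\<lambda>h. w h k m * rate2 m (gain2 h k m * p h k m))"
    by (rule dom[OF meas(1) finite_expD(1)[OF k]]) (intro conjI tb(1,2); assumption)
  then show "integrable \<mu> (\<lambda>h. beta S m * w h k m * rate2 m (gain2 h k m * p h k m))"
    using integrable_mult_right[of "beta S m"] by (simp add: mult.assoc)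
  show "integrable \<mu> (\<lambda>h. w h k m * p h k m)"
    by (rule dom[of _ "\<lambda>_. \<bar>ampP S k m\<bar>"]) (use tb(3) in auto)
  have "integrable \<mu> (\<lambda>h. w h k m * (act h k * gain1 h k m * p h k m))"
    by (rule dom[OF meas(2) finite_expD(2)[OF k]]) (intro conjI tb(4,5); assumption)
  then show "integrable \<mu> (\<lambda>h. act h k * (w h k m * gain1 h k m * p h k m))"
    by (simp add: mult_ac)
  have "integrable \<mu> (\<lambda>_. rate1 (gam S k) 0)" by simp
  from dom[OF meas(3) this]
  have "integrable \<mu> (\<lambda>h. w h k m * (act h k * rate1 (gam S k) (gain1 h k m * p h k m)))"
    using tb(6,7) by blast
  then show "integrable \<mu> (\<lambda>h. act h k * (w h k m * rate1 (gam S k) (gain1 h k m * p h k m)))"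
    by (simp add: mult_ac)
qed

text \<open>The form used by the duality argument: for a fixed policy the Lagrangian is affine in
  the multipliers, with the objective as its value at zero.\<close>

lemma lagrangian_eq_slack:
  assumes st: "short_term S \<mu> w p"
  shows "lagrangian S \<mu> \<pi> \<theta> \<rho> w p = objective S \<mu> w p + (\<Sum>m=1..nSU S. \<pi> m * power_slack w p m)
     + (\<Sum>k=1..nCh S. \<theta> k * interference_slack w p k) + (\<Sum>k=1..nCh S. \<rho> k * rate_slack w p k)"
proof -
  note W = integrable_weighted[OF st]
  let ?R = "\<lambda>h. \<Sum>m=0..nSU S. \<Sum>k=1..nCh S. beta S m * w h k m * rate2 m (gain2 h k m * p h k m)"
  let ?P = "\<lambda>m h. limP S m - (\<Sum>k=1..nCh S. w h k m * p h k m)"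
  let ?I = "\<lambda>k h. act h k * (limI S k - (\<Sum>m=0..nSU S. w h k m * gain1 h k m * p h k m))"
  let ?T = "\<lambda>k h. act h k * ((\<Sum>m=0..nSU S. w h k m * rate1 (gam S k) (gain1 h k m * p h k m)) - limR S k)"
  have R: "integrable \<mu> ?R" by (intro Bochner_Integration.integrable_sum W) auto
  have P: "integrable \<mu> (?P m)" if "m \<in> {1..nSU S}" for m
    by (intro Bochner_Integration.integrable_diff Bochner_Integration.integrable_sum W) (use that in auto)
  have I: "integrable \<mu> (?I k)" if "k \<in> {1..nCh S}" for k
    unfolding right_diff_distrib sum_distrib_left
    by (intro Bochner_Integration.integrable_diff Bochner_Integration.integrable_sum W integrable_mult_left integrable_act that) auto
  have T: "integrable \<mu> (?T k)" if "k \<in> {1..nCh S}" for k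
    unfolding right_diff_distrib sum_distrib_left
    by (intro Bochner_Integration.integrable_diff Bochner_Integration.integrable_sum W integrable_mult_left integrable_act that) auto
  have sP: "integrable \<mu> (\<lambda>h. \<Sum>m=1..nSU S. \<pi> m * ?P m h)" by (intro Bochner_Integration.integrable_sum integrable_mult_right P)
  have sI: "integrable \<mu> (\<lambda>h. \<Sum>k=1..nCh S. \<theta> k * ?I k h)" by (intro Bochner_Integration.integrable_sum integrable_mult_right I)
  have sT: "integrable \<mu> (\<lambda>h. \<Sum>k=1..nCh S. \<rho> k * ?T k h)" by (intro Bochner_Integration.integrable_sum integrable_mult_right T)
  have "lagrangian S \<mu> \<pi> \<theta> \<rho> w p = (\<integral>h. ?R h + (\<Sum>m=1..nSU S. \<pi> m * ?P m h) + (\<Sum>k=1..nCh S. \<theta> k * ?I k h)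
      + (\<Sum>k=1..nCh S. \<rho> k * ?T k h) \<partial>\<mu>)"
    unfolding lagrangian_def
    by (intro Bochner_Integration.integral_cong refl) (simp add: right_diff_distrib sum_subtractf mult.assoc)
  also have "\<dots> = (\<integral>h. ?R h \<partial>\<mu>) + (\<integral>h. (\<Sum>m=1..nSU S. \<pi> m * ?P m h) \<partial>\<mu>) + (\<integral>h. (\<Sum>k=1..nCh S. \<theta> k * ?I k h) \<partial>\<mu>)
      + (\<integral>h. (\<Sum>k=1..nCh S. \<rho> k * ?T k h) \<partial>\<mu>)"
    by (simp only: Bochner_Integration.integral_add Bochner_Integration.integrable_add R sP sI sT)
  also have "(\<integral>h. ?R h \<partial>\<mu>) = objective S \<mu> w p"
  proof -
    have "(\<integral>h. ?R h \<partial>\<mu>) = (\<Sum>m=0..nSU S. \<Sum>k=1..nCh S. \<integral>h. beta S m * w h k m * rate2 m (gain2 h k m * p h k m) \<partial>\<mu>)"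
      by (subst Bochner_Integration.integral_sum, intro Bochner_Integration.integrable_sum W, assumption+)
        (intro sum.cong refl Bochner_Integration.integral_sum W)
    also have "\<dots> = objective S \<mu> w p" unfolding objective_def by (rule sum.swap)
    finally show ?thesis .
  qed
  also have "(\<integral>h. (\<Sum>m=1..nSU S. \<pi> m * ?P m h) \<partial>\<mu>) = (\<Sum>m=1..nSU S. \<pi> m * (\<integral>h. ?P m h \<partial>\<mu>))"
    by (subst Bochner_Integration.integral_sum) (intro integrable_mult_right P, assumption, simp only: integral_mult_right_zero)
  also have "\<dots> = (\<Sum>m=1..nSU S. \<pi> m * power_slack w p m)"
  proof (intro sum.cong refl)
    fix m assume m: "m \<in> {1..nSU S}"
    have "integrable \<mu> (\<lambda>h. \<Sum>k=1..nCh S. w h k m * p h k m)"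
      by (intro Bochner_Integration.integrable_sum W) (use m in auto)
    then show "\<pi> m * (\<integral>h. ?P m h \<partial>\<mu>) = \<pi> m * power_slack w p m"
      by (simp add: power_slack_def prob_space)
  qed
  also have "(\<integral>h. (\<Sum>k=1..nCh S. \<theta> k * ?I k h) \<partial>\<mu>) = (\<Sum>k=1..nCh S. \<theta> k * interference_slack w p k)"
    unfolding interference_slack_def
    by (subst Bochner_Integration.integral_sum) (intro integrable_mult_right I, assumption, simp only: integral_mult_right_zero)
  also have "(\<integral>h. (\<Sum>k=1..nCh S. \<rho> k * ?T k h) \<partial>\<mu>) = (\<Sum>k=1..nCh S. \<rho> k * rate_slack w p k)"
    unfolding rate_slack_def
    by (subst Bochner_Integration.integral_sum) (intro integrable_mult_right T, assumption, simp only: integral_mult_right_zero)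
  finally show ?thesis .
qed

lemma lagrangian_affine:
  assumes st: "short_term S \<mu> w p"
  shows "lagrangian S \<mu> (\<lambda>m. (1 - t) * \<pi> m + t * \<pi>' m) (\<lambda>k. (1 - t) * \<theta> k + t * \<theta>' k) (\<lambda>k. (1 - t) * \<rho> k + t * \<rho>' k) w p
     = (1 - t) * lagrangian S \<mu> \<pi> \<theta> \<rho> w p + t * lagrangian S \<mu> \<pi>' \<theta>' \<rho>' w p"
  unfolding lagrangian_eq_slack[OF st]
  by (simp add: sum_distrib_left sum.distrib distrib_right distrib_left mult.assoc) (simp add: algebra_simps)

text \<open>The activity agrees almost surely with the indicator of the active event, so weighting
  by it is conditioning times the probability of that event.\<close>

lemma cond_active_integral:
  assumes k: "k \<in> {1..nCh S}" and f: "f \<in> borel_measurable \<mu>" "integrable \<mu> (\<lambda>h. act h k * f h)"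
  shows "(\<integral>h. act h k * (f h - c) \<partial>\<mu>) =
    measure \<mu> {h \<in> space (csi_space S). act h k = 1} * ((\<integral>h. f h \<partial>cond_active S \<mu> k) - c)"
proof -
  define A where "A = {h \<in> space (csi_space S). act h k = 1}"
  note [measurable] = measurable_act[OF k] f(1)
  have "{h \<in> space \<mu>. act h k = 1} \<in> sets \<mu>" by measurable
  then have B: "A \<in> sets \<mu>" by (simp add: space_law A_def)
  have ae: "AE h in \<mu>. act h k = indicator A h"
    using AE_act AE_space
  proof eventually_elim
    case (elim h)
    then have "act h k = 0 \<or> act h k = 1" using k by auto
    then show ?case using elim(2) by (auto simp: space_law A_def)
  qed
  have mB: "(\<lambda>h. indicator A h :: real) \<in> borel_measurable \<mu>" using B by (rule borel_measurable_indicator)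
  have i: "integrable \<mu> (\<lambda>h. indicator A h * f h)"
  proof (rule integrable_cong_AE_imp[OF f(2)])
    show "(\<lambda>h. indicator A h * f h) \<in> borel_measurable \<mu>" by (intro borel_measurable_times mB f)
    show "AE h in \<mu>. act h k * f h = indicator A h * f h" using ae by eventually_elim simp
  qed
  have iB: "integrable \<mu> (\<lambda>h. c * indicator A h)"
    using B by (intro integrable_mult_right integrable_real_indicator) (auto simp: emeasure_eq_measure)
  have "(\<integral>h. act h k * (f h - c) \<partial>\<mu>) = (\<integral>h. indicator A h * f h - c * indicator A h \<partial>\<mu>)"
  proof (rule integral_cong_AE)
    show "(\<lambda>h. act h k * (f h - c)) \<in> borel_measurable \<mu>" by measurable
    show "(\<lambda>h. indicator A h * f h - c * indicator A h) \<in> borel_measurable \<mu>"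
      by (intro borel_measurable_diff borel_measurable_times mB f borel_measurable_const)
    show "AE h in \<mu>. act h k * (f h - c) = indicator A h * f h - c * indicator A h"
      using ae by eventually_elim (simp add: algebra_simps)
  qed
  also have "\<dots> = (\<integral>h. indicator A h * f h \<partial>\<mu>) - c * measure \<mu> A"
    using i iB B by (subst Bochner_Integration.integral_diff) (auto simp: sets.sets_into_space Int_absorb1)
  also have "(\<integral>h. indicator A h * f h \<partial>\<mu>) = measure \<mu> A * (\<integral>h. f h \<partial>cond_active S \<mu> k)"
    unfolding cond_active_def A_def[symmetric]
    by (rule integral_uniform_measure[symmetric, OF B active_pos[OF k, folded A_def] i f(1)])
  finally show ?thesis by (simp add: A_def algebra_simps)
qed

lemma long_term_iff:
  assumes st: "short_term S \<mu> w p"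
  shows "long_term S \<mu> w p \<longleftrightarrow> (\<forall>m\<in>{1..nSU S}. 0 \<le> power_slack w p m) \<and>
     (\<forall>k\<in>{1..nCh S}. 0 \<le> interference_slack w p k) \<and> (\<forall>k\<in>{1..nCh S}. 0 \<le> rate_slack w p k)"
proof -
  have m: "measurable_policy S w" "measurable_policy S p" using st by (auto simp: short_term_def)
  note W = integrable_weighted[OF st]
  have "0 \<le> interference_slack w p k \<longleftrightarrow>
      (\<integral>h. (\<Sum>m=0..nSU S. w h k m * gain1 h k m * p h k m) \<partial>cond_active S \<mu> k) \<le> limI S k" (is ?I)
    and "0 \<le> rate_slack w p k \<longleftrightarrow>
      limR S k \<le> (\<integral>h. (\<Sum>m=0..nSU S. w h k m * rate1 (gam S k) (gain1 h k m * p h k m)) \<partial>cond_active S \<mu> k)" (is ?R)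
    if k: "k \<in> {1..nCh S}" for k
  proof -
    have [measurable]: "(\<lambda>h. w h k m) \<in> borel_measurable \<mu>" "(\<lambda>h. p h k m) \<in> borel_measurable \<mu>"
       "(\<lambda>h. gain1 h k m) \<in> borel_measurable \<mu>"
      if "m \<in> {0..nSU S}" for m
      using m that k by (auto intro: measurable_policyD)
    let ?f = "\<lambda>h. \<Sum>m=0..nSU S. w h k m * gain1 h k m * p h k m"
      and ?g = "\<lambda>h. \<Sum>m=0..nSU S. w h k m * rate1 (gam S k) (gain1 h k m * p h k m)"
    have "?f \<in> borel_measurable \<mu>" "?g \<in> borel_measurable \<mu>" unfolding rate1_def by measurable
    moreover have "integrable \<mu> (\<lambda>h. act h k * ?f h)" "integrable \<mu> (\<lambda>h. act h k * ?g h)"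
      unfolding sum_distrib_left by (intro Bochner_Integration.integrable_sum W k; assumption)+
    ultimately have e: "(\<integral>h. act h k * (?f h - limI S k) \<partial>\<mu>) = measure \<mu> {h \<in> space (csi_space S). act h k = 1} *
        ((\<integral>h. ?f h \<partial>cond_active S \<mu> k) - limI S k)"
      "rate_slack w p k = measure \<mu> {h \<in> space (csi_space S). act h k = 1} *
        ((\<integral>h. ?g h \<partial>cond_active S \<mu> k) - limR S k)"
      unfolding rate_slack_def by (auto intro!: cond_active_integral k)
    \<comment> \<open>The interference constraint is an upper bound, so its slack is the negative of
      the form treated by \<open>cond_active_integral\<close>.\<close>
    have "interference_slack w p k = - (\<integral>h. act h k * (?f h - limI S k) \<partial>\<mu>)"
      unfolding interference_slack_def integral_minus[symmetric]
      by (intro Bochner_Integration.integral_cong) (auto simp: algebra_simps)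
    then show ?I ?R using e active_pos[OF k] by (auto simp: zero_le_mult_iff mult_le_0_iff)
  qed
  then show ?thesis by (auto simp: long_term_def power_slack_def)
qed

section \<open>Saddle point and optimality\<close>


text \<open>On one channel this is \<open>argmax_stability\<close>: the winner at the perturbed
  multipliers maximizes a convex combination of two utilities. The third triple of multipliers is
  left free because both sides of the saddle inequality have to pass to the limit.\<close>

lemma winner_stability:
  assumes h: "regular S h" and k: "k \<in> {1..nCh S}"
    and W: "winner S \<pi> \<theta> \<rho> h k w p ms"
    and Wn: "\<And>n. winner S (\<lambda>m. (1 - t n) * \<pi> m + t n * \<pi>' m) (\<lambda>k. (1 - t n) * \<theta> k + t n * \<theta>' k)
        (\<lambda>k. (1 - t n) * \<rho> k + t n * \<rho>' k) h k (wn n) (pn n) (mn n)"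
    and t: "t \<longlonglongrightarrow> 0"
  shows "(\<lambda>n. \<Sum>m=0..nSU S. wn n m * phi S \<pi>'' \<theta>'' \<rho>'' h k m (pn n m))
     \<longlonglongrightarrow> (\<Sum>m=0..nSU S. w m * phi S \<pi>'' \<theta>'' \<rho>'' h k m (p m))"
proof -
  have sum: "(\<Sum>m=0..nSU S. w m * f m) = f ms" if "winner S \<pi> \<theta> \<rho> h k w p ms" for \<pi> \<theta> \<rho> w p ms f
    by (rule sum_selected) (use that in \<open>auto simp: winner_def\<close>)
  have cont: "continuous_on {0..peak S h k m} (phi S \<pi> \<theta> \<rho> h k m)" if "m \<in> {0..nSU S}" for \<pi> \<theta> \<rho> m
    by (rule continuous_on_subset[OF continuous_on_phi[OF valid h k that]]) auto
  have ms: "ms \<in> {0..nSU S}" "p ms \<in> {0..peak S h k ms}" using W by (auto simp: winner_def)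
  show ?thesis unfolding sum[OF W] sum[OF Wn]
  proof (rule argmax_stability[of "{0..nSU S}" "peak S h k" "phi S \<pi> \<theta> \<rho> h k" "phi S \<pi>' \<theta>' \<rho>' h k" "phi S \<pi>'' \<theta>'' \<rho>'' h k"
        ms "p ms" t mn "\<lambda>n. pn n (mn n)", OF _ cont cont cont ms _ _ t])
    fix m q assume m: "m \<in> {0..nSU S}" and q: "q \<in> {0..peak S h k m}"
    show "phi S \<pi> \<theta> \<rho> h k m q \<le> phi S \<pi> \<theta> \<rho> h k ms (p ms)" using W m q by (auto simp: winner_def)
    assume "phi S \<pi> \<theta> \<rho> h k m q = phi S \<pi> \<theta> \<rho> h k ms (p ms)"
    \<comment> \<open>The alternative with zero powers is harmless, as \<open>phi\<close> at power 0
      does not depend on the user.\<close>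
    then have "m = ms \<and> q = p ms \<or> q = 0 \<and> p ms = 0" using W m q unfolding winner_def by blast
    then show "phi S \<pi>'' \<theta>'' \<rho>'' h k m q = phi S \<pi>'' \<theta>'' \<rho>'' h k ms (p ms)" by (auto simp: phi_zero)
  next
    fix n
    show "mn n \<in> {0..nSU S}" "pn n (mn n) \<in> {0..peak S h k (mn n)}" using Wn[of n] by (auto simp: winner_def)
    show "(1 - t n) * phi S \<pi> \<theta> \<rho> h k ms (p ms) + t n * phi S \<pi>' \<theta>' \<rho>' h k ms (p ms)
      \<le> (1 - t n) * phi S \<pi> \<theta> \<rho> h k (mn n) (pn n (mn n)) + t n * phi S \<pi>' \<theta>' \<rho>' h k (mn n) (pn n (mn n))"
      unfolding phi_affine[symmetric] using Wn[of n] ms unfolding winner_def by blast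
  qed auto
qed

text \<open>The utilities, though not necessarily the policies, converge almost surely, and
  \<open>phi_bound\<close> dominates them uniformly in \<open>n\<close>.\<close>

lemma lagrangian_stability:
  assumes f: "follows \<pi> \<theta> \<rho> w p"
    and fn: "\<And>n. follows (\<lambda>m. (1 - t n) * \<pi> m + t n * \<pi>' m) (\<lambda>k. (1 - t n) * \<theta> k + t n * \<theta>' k)
        (\<lambda>k. (1 - t n) * \<rho> k + t n * \<rho>' k) (wn n) (pn n)"
    and t: "t \<longlonglongrightarrow> 0"
  shows "(\<lambda>n. lagrangian S \<mu> \<pi>'' \<theta>'' \<rho>'' (wn n) (pn n)) \<longlonglongrightarrow> lagrangian S \<mu> \<pi>'' \<theta>'' \<rho>'' w p"
proof -
  note st = follows_short_term[OF f] and stn = follows_short_term[OF fn]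
  let ?u = "utility \<pi>'' \<theta>'' \<rho>''" and ?b = "\<lambda>h. \<Sum>k=1..nCh S. \<Sum>m=0..nSU S. phi_bound \<pi>'' \<theta>'' \<rho>'' h k m"
  have "(\<lambda>n. \<integral>h. ?u h (wn n h) (pn n h) \<partial>\<mu>) \<longlonglongrightarrow> (\<integral>h. ?u h (w h) (p h) \<partial>\<mu>)"
  proof (rule integral_dominated_convergence[where w = ?b])
    show "(\<lambda>h. ?u h (w h) (p h)) \<in> borel_measurable \<mu>" "(\<lambda>h. ?u h (wn n h) (pn n h)) \<in> borel_measurable \<mu>" for n
      using integrable_utility[OF st] integrable_utility[OF stn] by auto
    show "integrable \<mu> ?b" by (intro Bochner_Integration.integrable_sum integrable_phi_bound)
    show "AE h in \<mu>. norm (?u h (wn n h) (pn n h)) \<le> ?b h" for n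
    proof -
      have "AE h in \<mu>. \<forall>k\<in>{1..nCh S}. \<forall>m\<in>{0..nSU S}.
          \<bar>wn n h k m * phi S \<pi>'' \<theta>'' \<rho>'' h k m (pn n h k m)\<bar> \<le> phi_bound \<pi>'' \<theta>'' \<rho>'' h k m"
        by (intro AE_ball_countable' integrable_weighted_phi(2)[OF stn]) auto
      then show ?thesis
      proof eventually_elim
        case (elim h)
        then show ?case unfolding utility_def real_norm_def
          by (intro order_trans[OF sum_abs] sum_mono order_trans[OF sum_abs]) auto
      qed
    qed
    \<comment> \<open>The exceptional null events depend on the multipliers; a sequence of them
      still leaves one null event.\<close>
    have "AE h in \<mu>. \<forall>n. \<forall>k\<in>{1..nCh S}. \<exists>ms. winner S (\<lambda>m. (1 - t n) * \<pi> m + t n * \<pi>' m) (\<lambda>k. (1 - t n) * \<theta> k + t n * \<theta>' k)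
        (\<lambda>k. (1 - t n) * \<rho> k + t n * \<rho>' k) h k (wn n h k) (pn n h k) ms"
      unfolding AE_all_countable using follows_winner[OF fn] by (auto elim: eventually_mono)
    with follows_winner[OF f]
    show "AE h in \<mu>. (\<lambda>n. ?u h (wn n h) (pn n h)) \<longlonglongrightarrow> ?u h (w h) (p h)"
    proof eventually_elim
      case (elim h)
      show ?case unfolding utility_def
      proof (rule tendsto_sum)
        fix k assume k: "k \<in> {1..nCh S}"
        obtain ms where W: "winner S \<pi> \<theta> \<rho> h k (w h k) (p h k) ms" using elim(1) k by blast
        have "\<forall>n. \<exists>ms. winner S (\<lambda>m. (1 - t n) * \<pi> m + t n * \<pi>' m) (\<lambda>k. (1 - t n) * \<theta> k + t n * \<theta>' k)
          (\<lambda>k. (1 - t n) * \<rho> k + t n * \<rho>' k) h k (wn n h k) (pn n h k) ms" using elim(2) k by blast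
        from choice[OF this] obtain mn where "\<And>n. winner S (\<lambda>m. (1 - t n) * \<pi> m + t n * \<pi>' m) (\<lambda>k. (1 - t n) * \<theta> k + t n * \<theta>' k)
          (\<lambda>k. (1 - t n) * \<rho> k + t n * \<rho>' k) h k (wn n h k) (pn n h k) (mn n)" by blast
        from winner_stability[OF conjunct1[OF elim(1)] k W this t]
        show "(\<lambda>n. \<Sum>m=0..nSU S. wn n h k m * phi S \<pi>'' \<theta>'' \<rho>'' h k m (pn n h k m))
          \<longlonglongrightarrow> (\<Sum>m=0..nSU S. w h k m * phi S \<pi>'' \<theta>'' \<rho>'' h k m (p h k m))" .
      qed
    qed
  qed
  then have "(\<lambda>n. (\<integral>h. ?u h (wn n h) (pn n h) \<partial>\<mu>) + (\<integral>h. offset \<pi>'' \<theta>'' \<rho>'' h \<partial>\<mu>))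
     \<longlonglongrightarrow> (\<integral>h. ?u h (w h) (p h) \<partial>\<mu>) + (\<integral>h. offset \<pi>'' \<theta>'' \<rho>'' h \<partial>\<mu>)"
    by (intro tendsto_add tendsto_const)
  then show ?thesis
    using integrable_utility[OF st] integrable_utility[OF stn] integrable_offset
    by (simp add: lagrangian_eq_utility[OF st] lagrangian_eq_utility[OF stn])
qed

text \<open>For the multipliers at \<open>t\<close> on the segment from the optimal ones to \<open>\<pi>', \<theta>', \<rho>'\<close>, dual optimality
  gives the inequality at the policy that the rule prescribes there; then let \<open>t\<close> tend to \<open>0\<close>.\<close>

lemma saddle_point:
  assumes opt: "dual_optimal S \<mu> \<pi> \<theta> \<rho>" and f: "follows \<pi> \<theta> \<rho> w p"
    and feas: "dual_feasible S \<pi>' \<theta>' \<rho>'"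
  shows "lagrangian S \<mu> \<pi> \<theta> \<rho> w p \<le> lagrangian S \<mu> \<pi>' \<theta>' \<rho>' w p"
proof -
  \<comment> \<open>Any null sequence in the half-open interval from 0 (excluded) to 1 serves:
    \<open>t n \<le> 1\<close> keeps the intermediate multipliers nonnegative, and
    \<open>0 < t n\<close> permits a later division.\<close>
  define t where "t n = inverse (real (Suc n))" for n
  have t: "0 < t n" "t n \<le> 1" for n by (auto simp: t_def divide_simps)
  define P where "P n m = (1 - t n) * \<pi> m + t n * \<pi>' m" for n m
  define T where "T n k = (1 - t n) * \<theta> k + t n * \<theta>' k" for n k
  define R where "R n k = (1 - t n) * \<rho> k + t n * \<rho>' k" for n k
  define wn where "wn n = best_schedule (P n) (T n) (R n)" for n
  define pn where "pn n = best_policy (P n) (T n) (R n)" for n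
  have fn: "follows (P n) (T n) (R n) (wn n) (pn n)" for n
    unfolding wn_def pn_def by (rule follows_best)
  have df: "dual_feasible S (P n) (T n) (R n)" for n
    using opt feas t(1)[of n] t(2)[of n] unfolding dual_optimal_def dual_feasible_def P_def T_def R_def
    by (auto intro!: add_nonneg_nonneg)
  have le: "lagrangian S \<mu> \<pi> \<theta> \<rho> (wn n) (pn n) \<le> lagrangian S \<mu> \<pi>' \<theta>' \<rho>' (wn n) (pn n)" for n
  proof -
    note st = follows_short_term[OF fn[of n]]
    have "ereal (lagrangian S \<mu> \<pi> \<theta> \<rho> (wn n) (pn n)) \<le> dual_function S \<mu> \<pi> \<theta> \<rho>"
      unfolding dual_function_eq[OF f] using lagrangian_le(1)[OF f st] by simp
    also have "\<dots> \<le> dual_function S \<mu> (P n) (T n) (R n)" using opt df[of n] by (auto simp: dual_optimal_def)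
    also have "\<dots> = ereal (lagrangian S \<mu> (P n) (T n) (R n) (wn n) (pn n))" by (rule dual_function_eq[OF fn])
    finally have "lagrangian S \<mu> \<pi> \<theta> \<rho> (wn n) (pn n) \<le> lagrangian S \<mu> (P n) (T n) (R n) (wn n) (pn n)" by simp
    also have "\<dots> = (1 - t n) * lagrangian S \<mu> \<pi> \<theta> \<rho> (wn n) (pn n) + t n * lagrangian S \<mu> \<pi>' \<theta>' \<rho>' (wn n) (pn n)"
      unfolding P_def[abs_def] T_def[abs_def] R_def[abs_def] by (rule lagrangian_affine[OF st])
    \<comment> \<open>Affinity lets the share \<open>1 - t n\<close> of the Lagrangian at the
      optimal multipliers cancel.\<close>
    finally have "t n * lagrangian S \<mu> \<pi> \<theta> \<rho> (wn n) (pn n) \<le> t n * lagrangian S \<mu> \<pi>' \<theta>' \<rho>' (wn n) (pn n)"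
      by (simp add: algebra_simps)
    then show ?thesis using t(1)[of n] by simp
  qed
  have t0: "t \<longlonglongrightarrow> 0" unfolding t_def[abs_def] by (rule LIMSEQ_inverse_real_of_nat)
  \<comment> \<open>The free multipliers are instantiated twice, with the optimal and with the
    primed ones, because both sides are evaluated at the moving policy.\<close>
  note stab = lagrangian_stability[OF f fn[unfolded P_def[abs_def] T_def[abs_def] R_def[abs_def]] t0]
  show ?thesis by (rule LIMSEQ_le[OF stab stab]) (use le in blast)
qed

text \<open>Raising one multiplier by 1 preserves dual feasibility and changes the Lagrangian by
  exactly the corresponding slack, which the saddle inequality shows to be nonnegative.\<close>

lemma follows_slack_nonneg:
  assumes opt: "dual_optimal S \<mu> \<pi> \<theta> \<rho>" and f: "follows \<pi> \<theta> \<rho> w p"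
  shows "m \<in> {1..nSU S} \<Longrightarrow> 0 \<le> power_slack w p m"
    and "k \<in> {1..nCh S} \<Longrightarrow> 0 \<le> interference_slack w p k"
    and "k \<in> {1..nCh S} \<Longrightarrow> 0 \<le> rate_slack w p k"
proof -
  note L = lagrangian_eq_slack[OF follows_short_term[OF f]]
  have df: "dual_feasible S \<pi> \<theta> \<rho>" using opt by (simp add: dual_optimal_def)
  have bump: "(\<Sum>i\<in>I. (if i = j then c i + 1 else c i) * s i) = (\<Sum>i\<in>I. c i * s i) + s j"
    if "finite I" "j \<in> I" for I j and c s :: "nat \<Rightarrow> real"
  proof -
    have "(\<Sum>i\<in>I. (if i = j then c i + 1 else c i) * s i) = (\<Sum>i\<in>I. c i * s i + (if i = j then s i else 0))"
      by (intro sum.cong) (auto simp: algebra_simps)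
    then show ?thesis using that by (simp add: sum.distrib)
  qed
  {
    assume m: "m \<in> {1..nSU S}"
    have "dual_feasible S (\<lambda>i. if i = m then \<pi> i + 1 else \<pi> i) \<theta> \<rho>" using df by (auto simp: dual_feasible_def)
    from saddle_point[OF opt f this] show "0 \<le> power_slack w p m"
      using m by (simp add: L bump del: atLeastAtMost_iff)
  }
  assume k: "k \<in> {1..nCh S}"
  have "dual_feasible S \<pi> (\<lambda>i. if i = k then \<theta> i + 1 else \<theta> i) \<rho>" using df by (auto simp: dual_feasible_def)
  from saddle_point[OF opt f this] show "0 \<le> interference_slack w p k"
    using k by (simp add: L bump del: atLeastAtMost_iff)
  have "dual_feasible S \<pi> \<theta> (\<lambda>i. if i = k then \<rho> i + 1 else \<rho> i)" using df by (auto simp: dual_feasible_def)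
  from saddle_point[OF opt f this] show "0 \<le> rate_slack w p k"
    using k by (simp add: L bump del: atLeastAtMost_iff)
qed

text \<open>For a feasible competitor, weak duality, maximality of the rule and complementary
  slackness give a chain: its objective is at most its Lagrangian, this is at most the Lagrangian of
  the rule, and this is at most the objective of the rule. For an optimal competitor the chain
  collapses, so it maximizes the Lagrangian too.\<close>

theorem follows_optimal:
  assumes opt: "dual_optimal S \<mu> \<pi> \<theta> \<rho>" and f: "follows \<pi> \<theta> \<rho> w p"
  shows "optimal_solution S \<mu> w p"
    and "optimal_solution S \<mu> w' p' \<Longrightarrow>
      AE h in \<mu>. \<forall>k\<in>{1..nCh S}. \<forall>m\<in>{0..nSU S}. w' h k m * p' h k m = w h k m * p h k m"
proof -
  note st = follows_short_term[OF f]
  have lt: "long_term S \<mu> w p" using follows_slack_nonneg[OF opt f] by (simp add: long_term_iff[OF st])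
  have df: "dual_feasible S \<pi> \<theta> \<rho>" using opt by (simp add: dual_optimal_def)
  \<comment> \<open>The saddle inequality at zero multipliers makes the sum of all multiplier-slack
    products nonpositive. As none of them is negative, this is complementary slackness.\<close>
  have "dual_feasible S (\<lambda>_. 0) (\<lambda>_. 0) (\<lambda>_. 0)" by (simp add: dual_feasible_def)
  from saddle_point[OF opt f this] have le: "lagrangian S \<mu> \<pi> \<theta> \<rho> w p \<le> objective S \<mu> w p"
    by (simp add: lagrangian_eq_slack[OF st, of "\<lambda>_. 0"])
  have weak: "objective S \<mu> w' p' \<le> lagrangian S \<mu> \<pi> \<theta> \<rho> w' p'"
    if st': "short_term S \<mu> w' p'" and lt': "long_term S \<mu> w' p'" for w' p'
  proof -
    have "0 \<le> (\<Sum>m=1..nSU S. \<pi> m * power_slack w' p' m)" "0 \<le> (\<Sum>k=1..nCh S. \<theta> k * interference_slack w' p' k)"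
      "0 \<le> (\<Sum>k=1..nCh S. \<rho> k * rate_slack w' p' k)"
      using df lt' unfolding long_term_iff[OF st'] dual_feasible_def by (auto intro!: sum_nonneg)
    then show ?thesis by (simp add: lagrangian_eq_slack[OF st'])
  qed
  show "optimal_solution S \<mu> w p" unfolding optimal_solution_def
    using st lt weak lagrangian_le(1)[OF f] le by (meson order_trans)
  assume o: "optimal_solution S \<mu> w' p'"
  then have st': "short_term S \<mu> w' p'" and lt': "long_term S \<mu> w' p'"
    and "objective S \<mu> w p \<le> objective S \<mu> w' p'" using st lt by (auto simp: optimal_solution_def)
  then have "lagrangian S \<mu> \<pi> \<theta> \<rho> w' p' = lagrangian S \<mu> \<pi> \<theta> \<rho> w p"
    using weak[OF st' lt'] lagrangian_le(1)[OF f st'] le by linarith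
  then show "AE h in \<mu>. \<forall>k\<in>{1..nCh S}. \<forall>m\<in>{0..nSU S}. w' h k m * p' h k m = w h k m * p h k m"
    by (rule lagrangian_le(2)[OF f st'])
qed

lemma schedule_rule_cong:
  assumes "\<And>l. l \<in> {0..nSU S} \<Longrightarrow> p k l = p' k l" "m \<in> {0..nSU S}"
  shows "schedule_rule S \<pi> \<theta> \<rho> h p k m = schedule_rule S \<pi> \<theta> \<rho> h p' k m"
proof -
  have "is_arg_max (\<lambda>l. phi S \<pi> \<theta> \<rho> h k l (p k l)) (\<lambda>l. l \<in> {0..nSU S}) m \<longleftrightarrow>
      is_arg_max (\<lambda>l. phi S \<pi> \<theta> \<rho> h k l (p' k l)) (\<lambda>l. l \<in> {0..nSU S}) m"
    unfolding is_arg_max_mem[OF assms(2)] using assms by simp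
  then show ?thesis using assms by (simp add: schedule_rule_def)
qed

text \<open>Turns the rule into equality with a measurable policy, and thus into a condition that
  can be carried between the process and its law.\<close>

lemma AE_power_rule_best_policy:
  "AE h in \<mu>. \<forall>k\<in>{1..nCh S}. \<forall>m\<in>{0..nSU S}. \<forall>p. power_rule S \<pi> \<theta> \<rho> h k m p \<longleftrightarrow> p = best_policy \<pi> \<theta> \<rho> h k m"
  using AE_regular AE_no_ties[of \<pi> \<theta> \<rho>]
proof eventually_elim
  case (elim h)
  show ?case
  proof (intro ballI)
    fix k m assume k: "k \<in> {1..nCh S}" "m \<in> {0..nSU S}"
    have "p = best_policy \<pi> \<theta> \<rho> h k m" if "power_rule S \<pi> \<theta> \<rho> h k m p" for p
      using maxim_on_phi_unique[OF valid elim(1) k elim(2)] maxim_on_best_policy[OF elim(1) k]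
        power_rule_imp_maxim_on[OF valid elim(1) k that] by blast
    then show "\<forall>p. power_rule S \<pi> \<theta> \<rho> h k m p \<longleftrightarrow> p = best_policy \<pi> \<theta> \<rho> h k m"
      using power_rule_exists[OF valid elim(1) k, of \<pi> \<theta> \<rho>] by blast
  qed
qed

end

section \<open>From the stationary process to the law of the state\<close>

lemma csi_process_setting:
  assumes v: "valid_params S" and c: "csi_process S Om H" and f: "finite_expectations S (csi_law S Om H)"
  shows "csi_law_setting (csi_law S Om H) S"
proof -
  interpret Om: prob_space Om using c by (simp add: csi_process_def)
  have H: "H 0 \<in> Om \<rightarrow>\<^sub>M csi_space S" using c by (simp add: csi_process_def)
  interpret prob_space "csi_law S Om H" unfolding csi_law_def by (rule Om.prob_space_distr[OF H])
  let ?N = "\<Pi>\<^sub>M c\<in>gain_comps S. (lborel :: real measure)"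
  obtain g where g: "distributed (csi_law S Om H) ?N (\<lambda>h. restrict h (gain_comps S)) g"
    using c by (auto simp: csi_process_def)
  show ?thesis
  proof unfold_locales
    show "sets (csi_law S Om H) = sets (csi_space S)" by (simp add: csi_law_def)
    show "AE h in csi_law S Om H. \<forall>k\<in>{1..nCh S}. act h k \<in> {0, 1}" "AE h in csi_law S Om H. \<forall>c\<in>gain_comps S. 0 \<le> h c"
      using c by (auto simp: csi_process_def)
    show "AE h in csi_law S Om H. restrict h (gain_comps S) \<notin> N" if N: "N \<in> null_sets ?N" for N
    proof (rule AE_distrD[where f = "\<lambda>h. restrict h (gain_comps S)" and M' = ?N and P = "\<lambda>x. x \<notin> N"])
      show "(\<lambda>h. restrict h (gain_comps S)) \<in> csi_law S Om H \<rightarrow>\<^sub>M ?N"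
        using g by (simp add: distributed_def)
      have "AE x in density ?N g. x \<notin> N"
        using AE_not_in[OF N] g by (subst AE_density) (auto simp: distributed_def)
      then show "AE x in distr (csi_law S Om H) ?N (\<lambda>h. restrict h (gain_comps S)). x \<notin> N"
        unfolding distributed_distr_eq_density[OF g] .
    qed
  qed (use v c f in \<open>auto simp: csi_process_def\<close>)
qed

text \<open>Coordinate \<open>n\<close> of the shifted process is coordinate \<open>Suc n\<close> of
  the original one, so invariance under a single shift gives equal marginals by induction.\<close>

lemma csi_process_distr:
  assumes c: "csi_process S Om H"
  shows "distr Om (csi_space S) (H n) = csi_law S Om H"
proof -
  let ?P = "\<Pi>\<^sub>M n\<in>(UNIV :: nat set). csi_space S"
  have H[measurable]: "H n \<in> Om \<rightarrow>\<^sub>M csi_space S" for n using c by (simp add: csi_process_def)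
  have st: "distr Om ?P (\<lambda>\<omega> n. H (Suc n) \<omega>) = distr Om ?P (\<lambda>\<omega> n. H n \<omega>)"
    using c by (simp add: csi_process_def)
  have pr: "distr Om (csi_space S) (G n) = distr (distr Om ?P (\<lambda>\<omega> n. G n \<omega>)) (csi_space S) (\<lambda>x. x n)"
    if G: "\<And>n. G n \<in> Om \<rightarrow>\<^sub>M csi_space S" for G :: "nat \<Rightarrow> 'a \<Rightarrow> csi" and n
  proof -
    have "(\<lambda>\<omega> n. G n \<omega>) \<in> Om \<rightarrow>\<^sub>M ?P"
      by (rule measurable_PiM_single') (use G in \<open>auto dest: measurable_space\<close>)
    then show ?thesis by (subst distr_distr) (auto simp: comp_def)
  qed
  show ?thesis
  proof (induction n)
    case 0
    show ?case by (simp add: csi_law_def)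
  next
    case (Suc n)
    have "distr Om (csi_space S) (H (Suc n)) = distr Om (csi_space S) (H n)"
      using pr[of H n] pr[of "\<lambda>n. H (Suc n)" n] st by simp
    then show ?case using Suc by simp
  qed
qed

text \<open>Existence of a policy following the rule keeps the optimality claim from being vacuous.
  Uniqueness concerns the products of schedule and power, since the holder of a channel used with
  zero power affects neither the objective nor the constraints.\<close>

theorem mainTheorem1:
  fixes S :: params and Om :: "'w measure" and H :: "nat \<Rightarrow> 'w \<Rightarrow> csi"
    and \<pi> \<theta> \<rho> :: "nat \<Rightarrow> real"
  assumes "valid_params S"
    and "csi_process S Om H"
    and "finite_expectations S (csi_law S Om H)"
    and "dual_optimal S (csi_law S Om H) \<pi> \<theta> \<rho>"
  shows "(\<exists>w p. follows_rule S Om H \<pi> \<theta> \<rho> w p) \<and>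
    (\<forall>w p. follows_rule S Om H \<pi> \<theta> \<rho> w p \<longrightarrow>
       optimal_solution S (csi_law S Om H) w p \<and>
       (\<forall>w' p'. optimal_solution S (csi_law S Om H) w' p' \<longrightarrow>
          (AE h in csi_law S Om H. \<forall>k\<in>{1..nCh S}. \<forall>m\<in>{0..nSU S}.
             w' h k m * p' h k m = w h k m * p h k m)) \<and>
       (\<forall>n. AE \<omega> in Om. \<forall>k\<in>{1..nCh S}.
          (\<forall>m\<in>{0..nSU S}. p (H n \<omega>) k m = 0) \<longrightarrow> w (H n \<omega>) k 0 = 1))"
proof (intro conjI allI impI)
  interpret csi_law_setting "csi_law S Om H" S by (rule csi_process_setting[OF assms(1-3)])
  have H: "H n \<in> Om \<rightarrow>\<^sub>M csi_space S" for n using assms(2) by (simp add: csi_process_def)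
  \<comment> \<open>By stationarity a property that is almost sure under the law holds almost surely
    at each time.\<close>
  have AE_H: "AE \<omega> in Om. Q (H n \<omega>)" if "AE h in csi_law S Om H. Q h" for Q n
    by (rule AE_distrD[OF H]) (simp only: csi_process_distr[OF assms(2)] that)
  let ?w = "best_schedule \<pi> \<theta> \<rho>" and ?p = "best_policy \<pi> \<theta> \<rho>"
  have meas: "measurable_policy S ?w" "measurable_policy S ?p"
    using follows_best[of \<pi> \<theta> \<rho>] by (auto simp: follows_def)
  show "\<exists>w p. follows_rule S Om H \<pi> \<theta> \<rho> w p"
  proof (intro exI)
    have "AE \<omega> in Om. \<forall>k\<in>{1..nCh S}. \<forall>m\<in>{0..nSU S}. power_rule S \<pi> \<theta> \<rho> (H n \<omega>) k m (?p (H n \<omega>) k m) \<and>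
        ?w (H n \<omega>) k m = schedule_rule S \<pi> \<theta> \<rho> (H n \<omega>) (?p (H n \<omega>)) k m" for n
      using AE_H[OF AE_power_rule_best_policy[of \<pi> \<theta> \<rho>], of n] by eventually_elim (simp add: best_schedule_def)
    then show "follows_rule S Om H \<pi> \<theta> \<rho> ?w ?p" using meas by (simp add: follows_rule_def)
  qed
  fix w p assume r: "follows_rule S Om H \<pi> \<theta> \<rho> w p"
  then have rule: "AE \<omega> in Om. \<forall>k\<in>{1..nCh S}. \<forall>m\<in>{0..nSU S}.
        power_rule S \<pi> \<theta> \<rho> (H n \<omega>) k m (p (H n \<omega>) k m) \<and>
        w (H n \<omega>) k m = schedule_rule S \<pi> \<theta> \<rho> (H n \<omega>) (p (H n \<omega>)) k m" for n
    by (simp add: follows_rule_def)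
  have mp: "measurable_policy S w" "measurable_policy S p" using r by (auto simp: follows_rule_def)
  have "AE \<omega> in Om. \<forall>k\<in>{1..nCh S}. \<forall>m\<in>{0..nSU S}. p (H 0 \<omega>) k m = ?p (H 0 \<omega>) k m \<and> w (H 0 \<omega>) k m = ?w (H 0 \<omega>) k m"
    using rule[of 0] AE_H[OF AE_power_rule_best_policy[of \<pi> \<theta> \<rho>], of 0]
  proof eventually_elim
    case (elim \<omega>)
    then have p: "p (H 0 \<omega>) k m = ?p (H 0 \<omega>) k m" if "k \<in> {1..nCh S}" "m \<in> {0..nSU S}" for k m
      using that by blast
    have "w (H 0 \<omega>) k m = ?w (H 0 \<omega>) k m" if k: "k \<in> {1..nCh S}" "m \<in> {0..nSU S}" for k m
    proof -
      have "w (H 0 \<omega>) k m = schedule_rule S \<pi> \<theta> \<rho> (H 0 \<omega>) (p (H 0 \<omega>)) k m" using elim(1) k by blast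
      then show ?thesis unfolding best_schedule_def 
        using schedule_rule_cong[where p = "p (H 0 \<omega>)" and p' = "?p (H 0 \<omega>)", OF p[OF k(1)] k(2)] by simp
    qed
    with p show ?case by blast
  qed
  then have "AE \<omega> in Om. \<forall>(k, m)\<in>{1..nCh S} \<times> {0..nSU S}. p (H 0 \<omega>) k m = ?p (H 0 \<omega>) k m \<and> w (H 0 \<omega>) k m = ?w (H 0 \<omega>) k m"
    by eventually_elim auto
  \<comment> \<open>Passing from \<open>Om\<close> back to the law, here through time 0, needs a
    measurable event. The equalities with \<open>best_policy\<close> and
    \<open>best_schedule\<close> provide one.\<close>
  then have "AE h in csi_law S Om H. \<forall>(k, m)\<in>{1..nCh S} \<times> {0..nSU S}. p h k m = ?p h k m \<and> w h k m = ?w h k m"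
    unfolding csi_law_def
  proof (subst AE_distr_iff[OF H])
    have "{h \<in> space (csi_space S). p h k m = ?p h k m \<and> w h k m = ?w h k m} \<in> sets (csi_space S)"
      if "k \<in> {1..nCh S}" "m \<in> {0..nSU S}" for k m
      using mp meas that unfolding measurable_policy_def by (intro sets_eq_conj) blast+
    then show "{h \<in> space (csi_space S). \<forall>(k, m)\<in>{1..nCh S} \<times> {0..nSU S}. p h k m = ?p h k m \<and> w h k m = ?w h k m} \<in> sets (csi_space S)"
      by (intro sets.sets_Collect_finite_All) auto
  qed
  then have "AE h in csi_law S Om H. rule_at S \<pi> \<theta> \<rho> h (w h) (p h)" using AE_regular
  proof eventually_elim
    case (elim h)
    have p: "p h k m = ?p h k m" and w: "w h k m = ?w h k m" if "k \<in> {1..nCh S}" "m \<in> {0..nSU S}" for k m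
      using elim(1) that by auto
    show ?case unfolding rule_at_def
    proof (intro ballI conjI)
      fix k m assume k: "k \<in> {1..nCh S}" "m \<in> {0..nSU S}"
      show "maxim_on (phi S \<pi> \<theta> \<rho> h k m) (peak S h k m) (p h k m)"
        using maxim_on_best_policy[OF elim(2) k] p[OF k] by simp
      show "w h k m = schedule_rule S \<pi> \<theta> \<rho> h (p h) k m"
        using w[OF k] schedule_rule_cong[where p = "p h" and p' = "?p h", OF p[OF k(1)] k(2)]
        by (simp add: best_schedule_def)
    qed
  qed
  then have fo: "follows \<pi> \<theta> \<rho> w p" using mp by (simp add: follows_def)
  show "optimal_solution S (csi_law S Om H) w p" by (rule follows_optimal(1)[OF assms(4) fo])
  show "AE h in csi_law S Om H. \<forall>k\<in>{1..nCh S}. \<forall>m\<in>{0..nSU S}. w' h k m * p' h k m = w h k m * p h k m"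
    if "optimal_solution S (csi_law S Om H) w' p'" for w' p'
    by (rule follows_optimal(2)[OF assms(4) fo that])
  show "AE \<omega> in Om. \<forall>k\<in>{1..nCh S}. (\<forall>m\<in>{0..nSU S}. p (H n \<omega>) k m = 0) \<longrightarrow> w (H n \<omega>) k 0 = 1" for n
    \<comment> \<open>With all powers zero, \<open>phi_zero\<close> makes all utilities equal; the
      virtual user is then among the maximizers, and its second indicator holds by
      \<open>m = 0\<close>.\<close>
    using rule[of n] by eventually_elim (auto simp: schedule_rule_def is_arg_max_linorder phi_zero)
qed

end
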